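(* For all integers $n\geq 2$, $r\geq 1$ and $p\geq 0$: (1) the generalised Thompson group $F_{n,r}$ (resp. $T_{n,r}$) embeds into Thompson's group $F$ (resp. $T$); (2) Higman's group $V_{n,r}$ embeds into Thompson's group $V$; (3) the group of quasi-automorphisms $QV_{n,r,p}$ embeds into $V$; (4) the generalised Houghton group $H_{r,p}$ embeds into $V$. Here "embeds" means that there exists an injective group homomorphism.
   Context: For $n\ge 2$, $r\ge1$: $V_{n,r}$ is the group of right-continuous bijections of $[0,r)$ which are piecewise affine with finitely many pieces, with breakpoints in $\mathbb{Z}[1/n]$, with slopes integral powers of $n$, and which preserve $\mathbb{Z}[1/n]\cap[0,r)$. $T_{n,r}$ is the group of orientation-preserving piecewise affine homeomorphisms of the circle $\mathbb{R}/r\mathbb{Z}$ with finitely many breakpoints, all in $\mathbb{Z}[1/n]$, slopes powers of $n$, preserving the image of $\mathbb{Z}[1/n]$. $F_{n,r}$ is the group of orientation-preserving piecewise affine homeomorphisms of $[0,r]$ with finitely many breakpoints, all in $\mathbb{Z}[1/n]$, slopes powers of $n$, preserving $\mathbb{Z}[1/n]\cap[0,r]$. Thompson's groups are $F=F_{2,1}$, $T=T_{2,1}$, $V=V_{2,1}$. $QV_{n,r,p}$: let $\mathcal{T}=\mathcal{T}_{n,r,p}$ be the disjoint union of $r$ infinite rooted $n$-regular trees (each vertex has $n$ children, ordered left-to-right) and of $p$ isolated vertices. $QV_{n,r,p}$ is the group of bijections $\mathcal{T}^{(0)}\to\mathcal{T}^{(0)}$ of the vertex set which preserve adjacency and the left-to-right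 ordering of the children of a given vertex, for all but finitely many vertices. $H_{n,p}$ ($n\ge1$, $p\ge0$): let $R_{n,p}$ be the graph which is the disjoint union of $n$ rays $\mathbb{N}=\{0,1,2,\ldots\}$ (consecutive integers being adjacent) and of $p$ isolated vertices. $H_{n,p}$ is the group of bijections $R_{n,p}^{(0)}\to R_{n,p}^{(0)}$ preserving adjacency for all but finitely many vertices. *)

theory Defs
  imports "HOL-Analysis.Analysis" "HOL-Algebra.Bij"
begin

text \<open>
  All groups below are groups of bijections of a set \<open>S\<close> under composition.  They are carved out
  of \<^const>\<open>BijGroup\<close>, whose elements are \<^const>\<open>extensional\<close> functions, so that two elements
  are equal as soon as they agree on \<open>S\<close>.
\<close>

definition perm_group :: "'a set \<Rightarrow> (('a \<Rightarrow> 'a) \<Rightarrow> bool) \<Rightarrow> ('a \<Rightarrow> 'a) monoid" where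
  "perm_group S P = BijGroup S\<lparr>carrier := {f \<in> Bij S. P f}\<rparr>"

lemma carrier_perm_group: "carrier (perm_group S P) = {f \<in> Bij S. P f}"
  by (simp add: perm_group_def)

lemma mult_perm_group:
  "f \<in> carrier (perm_group S P) \<Longrightarrow> g \<in> carrier (perm_group S P) \<Longrightarrow>
    g \<otimes>\<^bsub>perm_group S P\<^esub> f = compose S g f"
  by (simp add: perm_group_def BijGroup_def)

lemma group_perm_group:
  assumes "P (\<lambda>x\<in>S. x)"
    and "\<And>f g. f \<in> Bij S \<Longrightarrow> g \<in> Bij S \<Longrightarrow> P f \<Longrightarrow> P g \<Longrightarrow> P (compose S g f)"
    and "\<And>f. f \<in> Bij S \<Longrightarrow> P f \<Longrightarrow> P (\<lambda>x\<in>S. inv_into S f x)"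
  shows "group (perm_group S P)"
proof -
  interpret B: group "BijGroup S" by (rule group_BijGroup)
  have c: "carrier (BijGroup S) = Bij S"
    by (simp add: BijGroup_def)
  have "subgroup {f \<in> Bij S. P f} (BijGroup S)"
  proof (rule B.subgroupI)
    show "{f \<in> Bij S. P f} \<noteq> {}"
      using assms(1) id_Bij[of S] by blast
  next
    fix a assume "a \<in> {f \<in> Bij S. P f}"
    then show "inv\<^bsub>BijGroup S\<^esub> a \<in> {f \<in> Bij S. P f}"
      using assms(3) by (simp add: inv_BijGroup restrict_inv_into_Bij)
  next
    fix a b assume "a \<in> {f \<in> Bij S. P f}" "b \<in> {f \<in> Bij S. P f}"
    then show "a \<otimes>\<^bsub>BijGroup S\<^esub> b \<in> {f \<in> Bij S. P f}"
      using assms(2) compose_Bij[of a S b] by (simp add: BijGroup_def)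
  qed (auto simp: c)
  then show ?thesis
    unfolding perm_group_def by (rule subgroup.subgroup_is_group) (rule group_BijGroup)
qed


section \<open>Thompson-like groups\<close>

text \<open>The ring $\mathbb{Z}[1/n]$, as a set of reals.\<close>

definition n_adic :: "nat \<Rightarrow> real set" where
  "n_adic n = {x. \<exists>(a::int) (k::nat). x = of_int a / real n ^ k}"

text \<open>
  \<open>B\<close> contains all the breakpoints (including discontinuities); the values at
  the points of \<open>B\<close> themselves are controlled by the continuity requirements imposed separately.
\<close>

definition pw_affine :: "nat \<Rightarrow> real set \<Rightarrow> (real \<Rightarrow> real) \<Rightarrow> bool" where
  "pw_affine n S f \<longleftrightarrow>
    (\<exists>B. finite B \<and> B \<subseteq> n_adic n \<and>
      (\<forall>a b. {a<..<b} \<subseteq> S - B \<longrightarrow>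
        (\<exists>(k::int) c. \<forall>x\<in>{a<..<b}. f x = real n powi k * x + c)))"

definition thompson_F :: "nat \<Rightarrow> nat \<Rightarrow> (real \<Rightarrow> real) monoid" where
  "thompson_F n r = perm_group {0..real r} (\<lambda>f.
      (\<exists>g. homeomorphism {0..real r} {0..real r} f g) \<and>
      strict_mono_on {0..real r} f \<and>
      pw_affine n {0..real r} f \<and>
      f ` (n_adic n \<inter> {0..real r}) = n_adic n \<inter> {0..real r})"

definition higman_V :: "nat \<Rightarrow> nat \<Rightarrow> (real \<Rightarrow> real) monoid" where
  "higman_V n r = perm_group {0..<real r} (\<lambda>f.
      (\<forall>x\<in>{0..<real r}. continuous (at_right x) f) \<and>
      pw_affine n {0..<real r} f \<and>
      f ` (n_adic n \<inter> {0..<real r}) = n_adic n \<inter> {0..<real r})"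

text \<open>The circle $\mathbb{R}/r\mathbb{Z}$: its points are the cosets of $r\mathbb{Z}$ in the reals,
  and it carries the quotient topology.\<close>

definition circle_rel :: "nat \<Rightarrow> (real \<times> real) set" where
  "circle_rel r = {(x, y). \<exists>m::int. y = x + real r * of_int m}"

definition circle :: "nat \<Rightarrow> real set set" where
  "circle r = UNIV // circle_rel r"

definition circle_pt :: "nat \<Rightarrow> real \<Rightarrow> real set" where
  "circle_pt r x = circle_rel r `` {x}"

definition circle_topology :: "nat \<Rightarrow> real set topology" where
  "circle_topology r = topology (\<lambda>U. U \<subseteq> circle r \<and> open (circle_pt r -` U))"

text \<open>A homeomorphism of the circle is orientation-preserving if it lifts to an increasing
  map of the line.\<close>

definition circle_orientation_preserving :: "nat \<Rightarrow> (real set \<Rightarrow> real set) \<Rightarrow> bool" where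
  "circle_orientation_preserving r f \<longleftrightarrow>
    (\<exists>\<phi>. continuous_on UNIV \<phi> \<and> strict_mono \<phi> \<and> (\<forall>x. f (circle_pt r x) = circle_pt r (\<phi> x)))"

definition circle_pw_affine :: "nat \<Rightarrow> nat \<Rightarrow> (real set \<Rightarrow> real set) \<Rightarrow> bool" where
  "circle_pw_affine n r f \<longleftrightarrow>
    (\<exists>B. finite B \<and> B \<subseteq> circle_pt r ` n_adic n \<and>
      (\<forall>a b. circle_pt r ` {a<..<b} \<inter> B = {} \<longrightarrow>
        (\<exists>(k::int) c. \<forall>x\<in>{a<..<b}. f (circle_pt r x) = circle_pt r (real n powi k * x + c))))"

definition thompson_T :: "nat \<Rightarrow> nat \<Rightarrow> (real set \<Rightarrow> real set) monoid" where
  "thompson_T n r = perm_group (circle r) (\<lambda>f.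
      homeomorphic_map (circle_topology r) (circle_topology r) f \<and>
      circle_orientation_preserving r f \<and>
      circle_pw_affine n r f \<and>
      f ` (circle_pt r ` n_adic n) = circle_pt r ` n_adic n)"


section \<open>Quasi-automorphism groups and Houghton groups\<close>

text \<open>Vertices of a disjoint union of finitely many copies of a graph with vertices in \<open>'a\<close>
  (the first argument of \<open>Vertex\<close> numbers the copy) and of isolated vertices.\<close>

datatype 'a vertex = Vertex nat 'a | Isolated nat

text \<open>
  Stating preservation as an equivalence makes closure under inverses immediate.  In the graphs
  below all but finitely many of the non-isolated vertices have the same finite degree, which is
  also the maximal one, and the isolated ones are finite in number; so for a bijection it is the
  same, up to finitely many \<open>v\<close>, to ask only that neighbours of \<open>v\<close> be sent to neighbours of \<open>f v\<close>.
\<close>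

definition adj_preserved_at ::
    "'v set \<Rightarrow> ('v \<Rightarrow> 'v \<Rightarrow> bool) \<Rightarrow> ('v \<Rightarrow> 'v) \<Rightarrow> 'v \<Rightarrow> bool" where
  "adj_preserved_at S adj f v \<longleftrightarrow> (\<forall>w\<in>S. adj v w \<longleftrightarrow> adj (f v) (f w))"

text \<open>A vertex of the infinite rooted \<open>n\<close>-regular tree is the word of the child indices, all
  below \<open>n\<close>, on the path leading to it from the root.\<close>

definition forest_vertices :: "nat \<Rightarrow> nat \<Rightarrow> nat \<Rightarrow> nat list vertex set" where
  "forest_vertices n r p =
    {Vertex i w | i w. i < r \<and> set w \<subseteq> {..<n}} \<union> {Isolated j | j. j < p}"

definition nth_child :: "nat list vertex \<Rightarrow> nat \<Rightarrow> nat list vertex \<Rightarrow> bool" where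
  "nth_child v j u \<longleftrightarrow> (\<exists>i w. v = Vertex i w \<and> u = Vertex i (w @ [j]))"

definition forest_adj :: "nat list vertex \<Rightarrow> nat list vertex \<Rightarrow> bool" where
  "forest_adj u v \<longleftrightarrow> (\<exists>j. nth_child u j v \<or> nth_child v j u)"

text \<open>\<open>u\<close> and \<open>u'\<close> are children of \<open>v\<close>, with \<open>u\<close> to the left of \<open>u'\<close>.\<close>

definition children_left_right ::
    "nat list vertex \<Rightarrow> nat list vertex \<Rightarrow> nat list vertex \<Rightarrow> bool" where
  "children_left_right v u u' \<longleftrightarrow> (\<exists>j j'. j < j' \<and> nth_child v j u \<and> nth_child v j' u')"

definition child_order_preserved_at ::
    "nat list vertex set \<Rightarrow> (nat list vertex \<Rightarrow> nat list vertex) \<Rightarrow> nat list vertex \<Rightarrow> bool" where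
  "child_order_preserved_at S f v \<longleftrightarrow>
    (\<forall>u\<in>S. \<forall>u'\<in>S. children_left_right v u u' \<longleftrightarrow> children_left_right (f v) (f u) (f u'))"

definition QV :: "nat \<Rightarrow> nat \<Rightarrow> nat \<Rightarrow> (nat list vertex \<Rightarrow> nat list vertex) monoid" where
  "QV n r p = perm_group (forest_vertices n r p) (\<lambda>f.
      finite {v \<in> forest_vertices n r p.
        \<not> (adj_preserved_at (forest_vertices n r p) forest_adj f v \<and>
           child_order_preserved_at (forest_vertices n r p) f v)})"

definition ray_vertices :: "nat \<Rightarrow> nat \<Rightarrow> nat vertex set" where
  "ray_vertices n p = {Vertex i k | i k. i < n} \<union> {Isolated j | j. j < p}"

definition ray_adj :: "nat vertex \<Rightarrow> nat vertex \<Rightarrow> bool" where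
  "ray_adj u v \<longleftrightarrow>
    (\<exists>i k. u = Vertex i k \<and> v = Vertex i (Suc k) \<or> v = Vertex i k \<and> u = Vertex i (Suc k))"

definition houghton_H :: "nat \<Rightarrow> nat \<Rightarrow> (nat vertex \<Rightarrow> nat vertex) monoid" where
  "houghton_H n p = perm_group (ray_vertices n p) (\<lambda>f.
      finite {v \<in> ray_vertices n p. \<not> adj_preserved_at (ray_vertices n p) ray_adj f v})"


section \<open>These are groups\<close>

lemma Bij_mem: "f \<in> Bij S \<Longrightarrow> x \<in> S \<Longrightarrow> f x \<in> S"
  by (auto simp: Bij_def bij_betw_def)

lemma Bij_inv:
  assumes "f \<in> Bij S" "x \<in> S"
  shows "inv_into S f x \<in> S" "f (inv_into S f x) = x" "inv_into S f (f x) = x"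
  using assms by (auto simp: Bij_def bij_betw_def inv_into_into f_inv_into_f)

lemma finite_bad_compose:
  assumes f: "f \<in> Bij S" and fin: "finite {v \<in> S. \<not> P f v}" "finite {v \<in> S. \<not> P g v}"
    and P: "\<And>v. v \<in> S \<Longrightarrow> P f v \<Longrightarrow> P g (f v) \<Longrightarrow> P (compose S g f) v"
  shows "finite {v \<in> S. \<not> P (compose S g f) v}"
proof -
  have "{v \<in> S. \<not> P (compose S g f) v} \<subseteq>
      {v \<in> S. \<not> P f v} \<union> inv_into S f ` {v \<in> S. \<not> P g v}"
  proof
    fix v assume v: "v \<in> {v \<in> S. \<not> P (compose S g f) v}"
    show "v \<in> {v \<in> S. \<not> P f v} \<union> inv_into S f ` {v \<in> S. \<not> P g v}"
    proof (cases "P f v")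
      case True
      with v P have "\<not> P g (f v)" by auto
      moreover have "v = inv_into S f (f v)" "f v \<in> S"
        using v f by (auto simp: Bij_inv Bij_mem)
      ultimately show ?thesis by blast
    qed (use v in auto)
  qed
  then show ?thesis
    using fin by (meson finite_Un finite_imageI finite_subset)
qed

lemma finite_bad_inv:
  assumes f: "f \<in> Bij S" and fin: "finite {v \<in> S. \<not> P f v}"
    and P: "\<And>v. v \<in> S \<Longrightarrow> P f v \<Longrightarrow> P (\<lambda>x\<in>S. inv_into S f x) (f v)"
  shows "finite {v \<in> S. \<not> P (\<lambda>x\<in>S. inv_into S f x) v}"
proof -
  have "{v \<in> S. \<not> P (\<lambda>x\<in>S. inv_into S f x) v} \<subseteq> f ` {v \<in> S. \<not> P f v}"
  proof
    fix v assume v: "v \<in> {v \<in> S. \<not> P (\<lambda>x\<in>S. inv_into S f x) v}"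
    then have 1: "inv_into S f v \<in> S" "f (inv_into S f v) = v"
      using f by (auto simp: Bij_inv)
    have "\<not> P f (inv_into S f v)" using P[OF 1(1)] 1(2) v by auto
    then show "v \<in> f ` {v \<in> S. \<not> P f v}" using 1
      by (metis (mono_tags, lifting) image_eqI mem_Collect_eq)
  qed
  then show ?thesis using fin finite_surj by blast
qed

lemma adj_preserved_at_id: "v \<in> S \<Longrightarrow> adj_preserved_at S adj (\<lambda>x\<in>S. x) v"
  by (simp add: adj_preserved_at_def)

lemma adj_preserved_at_compose:
  assumes "f \<in> Bij S" "v \<in> S" "adj_preserved_at S adj f v" "adj_preserved_at S adj g (f v)"
  shows "adj_preserved_at S adj (compose S g f) v"
  using assms by (simp add: adj_preserved_at_def compose_eq Bij_mem)

lemma adj_preserved_at_inv: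
  assumes "f \<in> Bij S" "v \<in> S" "adj_preserved_at S adj f v"
  shows "adj_preserved_at S adj (\<lambda>x\<in>S. inv_into S f x) (f v)"
  using assms by (auto simp: adj_preserved_at_def Bij_inv Bij_mem)

lemma group_houghton_H: "group (houghton_H n p)"
  unfolding houghton_H_def
proof (rule group_perm_group, goal_cases)
  case 1
  have "{v \<in> ray_vertices n p. \<not> adj_preserved_at (ray_vertices n p) ray_adj
          (\<lambda>x\<in>ray_vertices n p. x) v} = {}"
    by (auto intro: adj_preserved_at_id)
  then show ?case by (simp only: finite.emptyI)
next
  case (2 f g)
  show ?case
    by (rule finite_bad_compose[where P = "adj_preserved_at _ _", OF 2(1,3,4)])
      (rule adj_preserved_at_compose[OF 2(1)])
next
  case (3 f)
  show ?case
    by (rule finite_bad_inv[where P = "adj_preserved_at _ _", OF 3])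
      (rule adj_preserved_at_inv[OF 3(1)])
qed

lemma group_QV: "group (QV n r p)"
proof -
  define S where "S = forest_vertices n r p"
  define P where "P = (\<lambda>f v. adj_preserved_at S forest_adj f v \<and> child_order_preserved_at S f v)"
  have comp: "P (compose S g f) v" if "f \<in> Bij S" "v \<in> S" "P f v" "P g (f v)" for f g v
    using that unfolding P_def
    by (auto simp: adj_preserved_at_compose child_order_preserved_at_def compose_eq Bij_mem)
  have inv: "P (\<lambda>x\<in>S. inv_into S f x) (f v)" if "f \<in> Bij S" "v \<in> S" "P f v" for f v
    using that unfolding P_def
    by (auto simp: adj_preserved_at_inv child_order_preserved_at_def Bij_inv Bij_mem)
  have QV: "QV n r p = perm_group S (\<lambda>f. finite {v \<in> S. \<not> P f v})"
    by (simp only: QV_def S_def P_def)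
  show ?thesis
    unfolding QV
  proof (rule group_perm_group, goal_cases)
    case 1
    have "{v \<in> S. \<not> P (\<lambda>x\<in>S. x) v} = {}"
      unfolding P_def using adj_preserved_at_id
      by (fastforce simp: child_order_preserved_at_def)
    then show ?case by (simp only: finite.emptyI)
  next
    case (2 f g)
    show ?case
      by (rule finite_bad_compose[where P = P, OF 2(1,3,4)]) (rule comp[OF 2(1)])
  next
    case (3 f)
    show ?case
      by (rule finite_bad_inv[where P = P, OF 3]) (rule inv[OF 3(1)])
  qed
qed

lemma affine_solve:
  fixes m :: real
  assumes "y = m * x + c" "m > 0"
  shows "x = inverse m * y + (- c * inverse m)"
proof -
  have "inverse m * (m * x) = x" using assms(2) by simp
  then show ?thesis using assms(1) by (simp add: algebra_simps)
qed

lemma zero_n_adic: "0 \<in> n_adic n"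
  unfolding n_adic_def by (auto intro!: exI[of _ 0])

lemma preserved_image_compose:
  assumes "D \<subseteq> S" "f ` D = D" "g ` D = D"
  shows "compose S g f ` D = D"
proof -
  have "compose S g f ` D = g ` f ` D"
    using assms(1) by (force simp: compose_eq)
  then show ?thesis using assms by simp
qed

lemma preserved_image_inv:
  assumes "f \<in> Bij S" "D \<subseteq> S" "f ` D = D"
  shows "(\<lambda>x\<in>S. inv_into S f x) ` D = D"
proof -
  have "(\<lambda>x\<in>S. inv_into S f x) ` D = (\<lambda>x\<in>S. inv_into S f x) ` f ` D"
    using assms(3) by simp
  also have "\<dots> = D"
  proof -
    have "(\<lambda>x\<in>S. inv_into S f x) (f d) = d" if "d \<in> D" for d
      using that assms by (auto simp: Bij_inv Bij_mem)
    then have "(\<lambda>x\<in>S. inv_into S f x) ` f ` D = (\<lambda>d. d) ` D"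
      unfolding image_image by (intro image_cong) auto
    then show ?thesis by simp
  qed
  finally show ?thesis .
qed

lemma powi_affine_image:
  fixes n :: nat assumes "n > 0" "x \<in> {a<..<b}"
  shows "real n powi k * x + c \<in> {real n powi k * a + c<..<real n powi k * b + c}"
  using assms by auto

lemma pw_affineE:
  assumes "pw_affine n S f"
  obtains B where "finite B" "B \<subseteq> n_adic n"
    "\<forall>a b. {a<..<b} \<subseteq> S - B \<longrightarrow> (\<exists>(k::int) c. \<forall>x\<in>{a<..<b}. f x = real n powi k * x + c)"
  using assms unfolding pw_affine_def by blast

lemma pw_affine_id: "pw_affine n S (\<lambda>x\<in>S. x)"
  unfolding pw_affine_def
  by (rule exI[of _ "{}"]) (auto intro!: exI[of _ 0])

lemma pw_affine_compose:
  assumes n: "n > 0" and f: "f \<in> Bij S" and g: "g \<in> Bij S"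
    and pf: "pw_affine n S f" and pg: "pw_affine n S g"
    and D: "f ` (n_adic n \<inter> S) = n_adic n \<inter> S"
  shows "pw_affine n S (compose S g f)"
proof -
  obtain B where B: "finite B" "B \<subseteq> n_adic n" and
    Bf: "\<And>a b. {a<..<b} \<subseteq> S - B \<Longrightarrow> \<exists>(k::int) c. \<forall>x\<in>{a<..<b}. f x = real n powi k * x + c"
    using pf unfolding pw_affine_def by blast
  obtain C where C: "finite C" "C \<subseteq> n_adic n" and
    Cg: "\<And>a b. {a<..<b} \<subseteq> S - C \<Longrightarrow> \<exists>(k::int) c. \<forall>x\<in>{a<..<b}. g x = real n powi k * x + c"
    using pg unfolding pw_affine_def by blast
  define E where "E = B \<union> inv_into S f ` (C \<inter> S)"
  have E: "finite E" using B C by (simp add: E_def)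
  have En: "E \<subseteq> n_adic n"
  proof -
    have "inv_into S f x \<in> n_adic n" if "x \<in> C \<inter> S" for x
    proof -
      have "x \<in> f ` (n_adic n \<inter> S)"
        unfolding D using C that by auto
      then obtain d where d: "d \<in> n_adic n \<inter> S" "x = f d"
        by (rule imageE) simp
      then show ?thesis using f by (simp add: Bij_inv)
    qed
    then show ?thesis using B by (auto simp: E_def)
  qed
  have "\<exists>(k::int) c. \<forall>x\<in>{a<..<b}. compose S g f x = real n powi k * x + c"
    if ab: "{a<..<b} \<subseteq> S - E" for a b
  proof -
    obtain k c where kc: "\<forall>x\<in>{a<..<b}. f x = real n powi k * x + c"
      using Bf[of a b] ab unfolding E_def by blast
    define a' b' where "a' = real n powi k * a + c" and "b' = real n powi k * b + c"
    have np: "real n powi k > 0" using n by simp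
    have "{a'<..<b'} \<subseteq> S - C"
    proof
      fix y assume y: "y \<in> {a'<..<b'}"
      define x where "x = (y - c) / real n powi k"
      have xy: "y = real n powi k * x + c" using n by (simp add: x_def)
      have x: "x \<in> {a<..<b}"
        using y np by (simp add: xy a'_def b'_def)
      have fx: "f x = y" using bspec[OF kc x] xy by simp
      have xS: "x \<in> S" "x \<notin> E" using x ab by auto
      then have "y \<in> S" using fx Bij_mem[OF f, of x] by simp
      moreover have "y \<notin> C"
      proof
        assume "y \<in> C"
        then have "inv_into S f y \<in> E" using \<open>y \<in> S\<close> by (simp add: E_def)
        moreover have "inv_into S f y = x" using fx Bij_inv(3)[OF f xS(1)] by simp
        ultimately show False using xS by simp
      qed
      ultimately show "y \<in> S - C" by simp
    qed
    then obtain l d where ld: "\<forall>x\<in>{a'<..<b'}. g x = real n powi l * x + d"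
      using Cg by blast
    have "compose S g f x = real n powi (l + k) * x + (real n powi l * c + d)" if x: "x \<in> {a<..<b}" for x
    proof -
      have "x \<in> S" using x ab by auto
      moreover have "real n powi k * x + c \<in> {a'<..<b'}"
        using powi_affine_image[OF n x] by (simp add: a'_def b'_def)
      ultimately show ?thesis
        using bspec[OF ld] bspec[OF kc x] n by (simp add: compose_eq power_int_add algebra_simps)
    qed
    then show ?thesis by blast
  qed
  then show ?thesis
    unfolding pw_affine_def using E En by (intro exI[of _ E] conjI allI impI)
qed

lemma group_thompson_F:
  assumes n: "n > 0"
  shows "group (thompson_F n r)"
proof -
  define S where "S = {0..real r}"
  show ?thesis
    unfolding thompson_F_def S_def[symmetric]
  proof (rule group_perm_group, goal_cases)
    case 1
    have "homeomorphism S S (\<lambda>x\<in>S. x) (\<lambda>x\<in>S. x)"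
      by (rule homeomorphism_cong[OF homeomorphism_ident]) auto
    moreover have "(\<lambda>x\<in>S. x) ` (n_adic n \<inter> S) = n_adic n \<inter> S" by auto
    moreover have "strict_mono_on S (\<lambda>x\<in>S. x)" by (simp add: strict_mono_on_def)
    ultimately show ?case
      by (intro conjI exI pw_affine_id)
  next
    case (2 f g)
    then obtain f' g' where fg: "homeomorphism S S f f'" "homeomorphism S S g g'" by blast
    have "homeomorphism S S (compose S g f) (f' \<circ> g')"
      by (rule homeomorphism_cong[OF homeomorphism_compose[OF fg]]) (auto simp: compose_eq)
    moreover have "strict_mono_on S (compose S g f)"
      using 2 by (auto simp: strict_mono_on_def compose_eq Bij_mem)
    ultimately show ?case
      using 2 pw_affine_compose[OF n, of f S g] preserved_image_compose[of "n_adic n \<inter> S" S f g] by blast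
  next
    case (3 f)
    define h where "h = (\<lambda>x\<in>S. inv_into S f x)"
    have h: "h y \<in> S" "f (h y) = y" "h (f y) = y" if "y \<in> S" for y
      using that 3 by (auto simp: h_def Bij_inv Bij_mem)
    have mono_f: "f x < f y" if "x \<in> S" "y \<in> S" "x < y" for x y
      using 3 that by (auto simp: strict_mono_on_def)
    obtain f' where f': "homeomorphism S S f f'" using 3 by blast
    have "homeomorphism S S h f"
    proof (rule homeomorphism_cong[OF homeomorphism_symD[OF f']])
      show "h y = f' y" if "y \<in> S" for y
        using f' that h by (metis homeomorphism_apply1)
    qed auto
    moreover have mono: "strict_mono_on S h"
    proof (rule strict_mono_onI)
      fix x y assume xy: "x \<in> S" "y \<in> S" "x < y"
      show "h x < h y"
      proof (rule ccontr)
        assume "\<not> h x < h y"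
        then have "h y \<le> h x" by simp
        then have "f (h y) \<le> f (h x)"
          using mono_f[of "h y" "h x"] h(1) xy by (cases "h y = h x") auto
        then show False using h xy by simp
      qed
    qed
    moreover have "pw_affine n S h"
    proof -
      obtain B where B: "finite B" "B \<subseteq> n_adic n" and
        Bf: "\<And>a b. {a<..<b} \<subseteq> S - B \<Longrightarrow> \<exists>(k::int) c. \<forall>x\<in>{a<..<b}. f x = real n powi k * x + c"
        using 3 unfolding pw_affine_def by blast
      have "\<exists>(k::int) c. \<forall>x\<in>{a<..<b}. h x = real n powi k * x + c"
        if ab: "{a<..<b} \<subseteq> S - f ` (B \<inter> S)" for a b
      proof (cases "a < b")
        case True
        have "{a<..<b} \<subseteq> S" using ab by blast
        then have "a \<ge> 0 \<and> b \<le> real r"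
          using True unfolding S_def by (simp add: greaterThanLessThan_subseteq_atLeastAtMost_iff)
        then have abS: "a \<in> S" "b \<in> S" using True by (auto simp: S_def)
        have "{h a<..<h b} \<subseteq> S - B"
        proof
          fix x assume x: "x \<in> {h a<..<h b}"
          have xS: "x \<in> S" using x h(1)[OF abS(1)] h(1)[OF abS(2)] by (auto simp: S_def)
          have "f (h a) < f x" "f x < f (h b)"
            using x xS mono_f[of "h a" x] mono_f[of x "h b"] h(1) abS by auto
          then have "f x \<in> {a<..<b}" using h abS by simp
          then show "x \<in> S - B" using ab xS by blast
        qed
        then obtain k c where kc: "\<forall>x\<in>{h a<..<h b}. f x = real n powi k * x + c"
          using Bf by blast
        have "h y = real n powi (-k) * y + (- c * real n powi (-k))" if y: "y \<in> {a<..<b}" for y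
        proof -
          have "y \<in> S" using y ab by auto
          then have "h y \<in> {h a<..<h b}" using mono y abS by (auto simp: strict_mono_on_def)
          then have "y = real n powi k * h y + c" using kc h \<open>y \<in> S\<close> by metis
          moreover have "real n powi k > 0" using n by simp
          ultimately show ?thesis using affine_solve by (metis power_int_minus)
        qed
        then show ?thesis by blast
      qed auto
      moreover have "f ` (B \<inter> S) \<subseteq> n_adic n" using 3 B by blast
      ultimately show ?thesis
        unfolding pw_affine_def using B(1) by (intro exI[of _ "f ` (B \<inter> S)"] conjI allI impI) auto
    qed
    moreover have "h ` (n_adic n \<inter> S) = n_adic n \<inter> S"
      using 3 preserved_image_inv[of f S "n_adic n \<inter> S"] by (auto simp: h_def)
    ultimately show ?case unfolding h_def by blast
  qed
qed

lemma right_continuous_affine: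
  assumes "x < (q::real)" "\<And>t. x \<le> t \<Longrightarrow> t < q \<Longrightarrow> f t = m * t + (c::real)"
  shows "continuous (at_right x) f"
proof -
  have "((\<lambda>t. m * t + c) \<longlongrightarrow> m * x + c) (at_right x)"
    by (intro tendsto_intros)
  moreover have "\<forall>\<^sub>F t in at_right x. m * t + c = f t"
    using eventually_at_right_real[OF assms(1)] by eventually_elim (simp add: assms(2))
  ultimately have "(f \<longlongrightarrow> m * x + c) (at_right x)"
    by (rule Lim_transform_eventually)
  moreover have "f x = m * x + c" using assms by simp
  ultimately show ?thesis by (simp add: continuous_within)
qed

lemma right_continuous_affine_left_end:
  assumes "p < (q::real)" "continuous (at_right p) f" "\<And>t. p < t \<Longrightarrow> t < q \<Longrightarrow> f t = m * t + (c::real)"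
  shows "f p = m * p + c"
proof -
  have "((\<lambda>t. m * t + c) \<longlongrightarrow> m * p + c) (at_right p)"
    by (intro tendsto_intros)
  moreover have "\<forall>\<^sub>F t in at_right p. m * t + c = f t"
    using eventually_at_right_real[OF assms(1)] by eventually_elim (simp add: assms(3))
  ultimately have "(f \<longlongrightarrow> m * p + c) (at_right p)"
    by (rule Lim_transform_eventually)
  moreover have "(f \<longlongrightarrow> f p) (at_right p)" using assms(2) by (simp add: continuous_within)
  ultimately show ?thesis
    using tendsto_unique trivial_limit_at_right_real by blast
qed

lemma higman_V_piece:
  assumes B: "finite B"
    and Bf: "\<forall>a b. {a<..<b} \<subseteq> {0..<real r} - B \<longrightarrow>
      (\<exists>(k::int) c. \<forall>x\<in>{a<..<b}. f x = real n powi k * x + c)"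
    and rc: "\<forall>x\<in>{0..<real r}. continuous (at_right x) f"
    and x: "x \<in> {0..<real r}"
  obtains p q c and k :: int where
    "p \<in> insert 0 B" "0 \<le> p" "p \<le> x" "x < q" "q \<le> real r"
    "\<forall>t. p \<le> t \<longrightarrow> t < q \<longrightarrow> f t = real n powi k * t + c"
proof -
  define P where "P = {e \<in> insert 0 B. 0 \<le> e \<and> e \<le> x}"
  define Q where "Q = {e \<in> insert (real r) B. x < e \<and> e \<le> real r}"
  have P: "finite P" "P \<noteq> {}" and Q: "finite Q" "Q \<noteq> {}"
    using B x by (auto simp: P_def Q_def)
  define p q where "p = Max P" and "q = Min Q"
  have p: "p \<in> P" "\<And>e. e \<in> P \<Longrightarrow> e \<le> p" and q: "q \<in> Q" "\<And>e. e \<in> Q \<Longrightarrow> q \<le> e"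
    using P Q by (auto simp: p_def q_def)
  have "{p<..<q} \<subseteq> {0..<real r} - B"
  proof
    fix t assume t: "t \<in> {p<..<q}"
    then have "t \<in> {0..<real r}" using p(1) q(1) by (auto simp: P_def Q_def)
    moreover have "t \<notin> B"
    proof
      assume "t \<in> B"
      then have "t \<in> P \<or> t \<in> Q" using \<open>t \<in> {0..<real r}\<close> by (auto simp: P_def Q_def)
      then show False using p(2) q(2) t by fastforce
    qed
    ultimately show "t \<in> {0..<real r} - B" by simp
  qed
  then obtain k c where kc: "\<forall>x\<in>{p<..<q}. f x = real n powi k * x + c" using Bf by blast
  have "p \<in> {0..<real r}" "p < q" using p(1) q(1) x by (auto simp: P_def Q_def)
  then have "f p = real n powi k * p + c"
    using kc rc by (intro right_continuous_affine_left_end[of p q]) auto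
  then have "f t = real n powi k * t + c" if "p \<le> t" "t < q" for t
    using kc that by (cases "t = p") auto
  then show ?thesis
    using that[of p q k c] p(1) q(1) by (auto simp: P_def Q_def)
qed

lemma group_higman_V:
  assumes n: "n > 0" and r: "r > 0"
  shows "group (higman_V n r)"
proof -
  define S where "S = {0..<real r}"
  show ?thesis
    unfolding higman_V_def S_def[symmetric]
  proof (rule group_perm_group, goal_cases)
    case 1
    have "continuous (at_right x) (\<lambda>x\<in>S. x)" if "x \<in> S" for x
      by (rule right_continuous_affine[of _ "real r" _ 1 0]) (use that in \<open>auto simp: S_def\<close>)
    moreover have "(\<lambda>x\<in>S. x) ` (n_adic n \<inter> S) = n_adic n \<inter> S" by auto
    ultimately show ?case
      by (intro conjI ballI pw_affine_id)
  next
    case (2 f g)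
    have rcf: "\<forall>x\<in>S. continuous (at_right x) f" and pf: "pw_affine n S f"
      and Df: "f ` (n_adic n \<inter> S) = n_adic n \<inter> S"
      using 2(3) by - (elim conjE, assumption)+
    have rcg: "\<forall>x\<in>S. continuous (at_right x) g" and pg: "pw_affine n S g"
      and Dg: "g ` (n_adic n \<inter> S) = n_adic n \<inter> S"
      using 2(4) by - (elim conjE, assumption)+
    have "continuous (at_right x) (compose S g f)" if x: "x \<in> S" for x
    proof -
      obtain B where B: "finite B" "B \<subseteq> n_adic n" and
        Bf: "\<forall>a b. {a<..<b} \<subseteq> S - B \<longrightarrow> (\<exists>(k::int) c. \<forall>x\<in>{a<..<b}. f x = real n powi k * x + c)"
        by (rule pw_affineE[OF pf], rule that)
      obtain C where C: "finite C" "C \<subseteq> n_adic n" and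
        Cg: "\<forall>a b. {a<..<b} \<subseteq> S - C \<longrightarrow> (\<exists>(k::int) c. \<forall>x\<in>{a<..<b}. g x = real n powi k * x + c)"
        by (rule pw_affineE[OF pg], rule that)
      obtain p q c k where p: "p \<in> insert 0 B" "0 \<le> p" "p \<le> x" "x < q" "q \<le> real r"
        and ka: "\<forall>t. p \<le> t \<longrightarrow> t < q \<longrightarrow> f t = real n powi k * t + c"
        by (rule higman_V_piece[OF B(1) Bf[unfolded S_def] rcf[unfolded S_def] x[unfolded S_def]], rule that)
      note k = ka[rule_format]
      have fx: "f x \<in> S" by (rule Bij_mem[OF 2(1) x])
      obtain p' q' c' k' where p': "p' \<in> insert 0 C" "0 \<le> p'" "p' \<le> f x" "f x < q'" "q' \<le> real r"
        and k'a: "\<forall>t. p' \<le> t \<longrightarrow> t < q' \<longrightarrow> g t = real n powi k' * t + c'"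
        by (rule higman_V_piece[OF C(1) Cg[unfolded S_def] rcg[unfolded S_def] fx[unfolded S_def]], rule that)
      note k' = k'a[rule_format]
      have np: "real n powi k > 0" using n by simp
      define u where "u = min q ((q' - c) / real n powi k)"
      have "x < (q' - c) / real n powi k"
        using p' k[of x] p np by (simp add: field_simps)
      then have "x < u" using p by (simp add: u_def)
      then show ?thesis
      proof (rule right_continuous_affine)
        fix t assume t: "x \<le> t" "t < u"
        then have ft: "f t = real n powi k * t + c" using p k by (auto simp: u_def)
        have "t < (q' - c) / real n powi k" using t by (simp add: u_def)
        then have "f t < q'" using ft np by (simp add: field_simps)
        moreover have "f x \<le> f t" using ft k[of x] p t np by simp
        ultimately have "g (f t) = real n powi k' * f t + c'" using k' p' by auto
        moreover have "t \<in> S" using t x p by (auto simp: S_def u_def)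
        ultimately show "compose S g f t =
            (real n powi k' * real n powi k) * t + (real n powi k' * c + c')"
          using ft by (simp add: compose_eq algebra_simps)
      qed
    qed
    then show ?case
      using pw_affine_compose[OF n 2(1,2) pf pg Df] preserved_image_compose[OF Int_lower2 Df Dg]
      by (intro conjI ballI)
  next
    case (3 f)
    have rcf: "\<forall>x\<in>S. continuous (at_right x) f" and pf: "pw_affine n S f"
      and Df: "f ` (n_adic n \<inter> S) = n_adic n \<inter> S"
      using 3(2) by - (elim conjE, assumption)+
    define h where "h = (\<lambda>x\<in>S. inv_into S f x)"
    have h: "h y \<in> S" "f (h y) = y" "h (f y) = y" if "y \<in> S" for y
      using that 3(1) by (auto simp: h_def Bij_inv Bij_mem)
    obtain B where B: "finite B" "B \<subseteq> n_adic n" and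
      Bf: "\<forall>a b. {a<..<b} \<subseteq> S - B \<longrightarrow> (\<exists>(k::int) c. \<forall>x\<in>{a<..<b}. f x = real n powi k * x + c)"
      by (rule pw_affineE[OF pf], rule that)
    have "continuous (at_right y) h" if y: "y \<in> S" for y
    proof -
      obtain p q c k where p: "p \<in> insert 0 B" "0 \<le> p" "p \<le> h y" "h y < q" "q \<le> real r"
        and ka: "\<forall>t. p \<le> t \<longrightarrow> t < q \<longrightarrow> f t = real n powi k * t + c"
        by (rule higman_V_piece[OF B(1) Bf[unfolded S_def] rcf[unfolded S_def] h(1)[OF y, unfolded S_def]], rule that)
      note k = ka[rule_format]
      have np: "real n powi k > 0" using n by simp
      have fy: "y = real n powi k * h y + c" using k[of "h y"] p h(2)[OF y] by simp
      show ?thesis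
      proof (rule right_continuous_affine)
        show "y < real n powi k * q + c" using fy p np
          by (metis add_less_cancel_right mult_less_cancel_left_pos)
      next
        fix t assume t: "y \<le> t" "t < real n powi k * q + c"
        define x where "x = (t - c) / real n powi k"
        have tx: "t = real n powi k * x + c" using n by (simp add: x_def)
        have "x < q" using t(2) np unfolding tx by simp
        have "real n powi k * h y \<le> real n powi k * x" using t(1) fy tx by linarith
        then have "h y \<le> x" using np by (simp only: mult_le_cancel_left_pos)
        with \<open>x < q\<close> have "x \<in> S" "f x = t" using p k[of x] tx by (auto simp: S_def)
        then show "h t = (1 / real n powi k) * t + (- c / real n powi k)"
          using h(3)[of x] by (simp add: x_def diff_divide_distrib)
      qed
    qed
    moreover have "pw_affine n S h"
    proof -
      define E where "E = f ` (insert 0 B \<inter> S)"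
      have "\<exists>(k::int) c. \<forall>x\<in>{a<..<b}. h x = real n powi k * x + c"
        if ab: "{a<..<b} \<subseteq> S - E" for a b
      proof (cases "a < b")
        case True
        have aff: "\<exists>(k::int) c. \<forall>x. a < x \<and> x \<le> y \<longrightarrow> h x = real n powi k * x + c"
          if y: "y \<in> {a<..<b}" for y
        proof -
          have yS: "y \<in> S" using y ab by blast
          obtain p q c k where p: "p \<in> insert 0 B" "0 \<le> p" "p \<le> h y" "h y < q" "q \<le> real r"
            and ka: "\<forall>t. p \<le> t \<longrightarrow> t < q \<longrightarrow> f t = real n powi k * t + c"
            by (rule higman_V_piece[OF B(1) Bf[unfolded S_def] rcf[unfolded S_def] h(1)[OF yS, unfolded S_def]], rule that)
          note k = ka[rule_format]
          have np: "real n powi k > 0" using n by simp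
          have fy: "y = real n powi k * h y + c" using k[of "h y"] p h(2)[OF yS] by simp
          have "p \<in> S" using p by (simp add: S_def)
          then have "f p \<in> E" using p by (simp add: E_def)
          then have "f p \<notin> {a<..<b}" using ab by blast
          moreover have "f p \<le> y"
          proof -
            have "real n powi k * p \<le> real n powi k * h y" using p(3) np by (simp add: mult_left_mono)
            then show ?thesis using k[of p] p fy by simp
          qed
          ultimately have fpa: "f p \<le> a" using y by auto
          have "h x = real n powi (-k) * x + (- c * real n powi (-k))" if x: "a < x" "x \<le> y" for x
          proof -
            define t where "t = (x - c) / real n powi k"
            have tx: "x = real n powi k * t + c" using n by (simp add: t_def)
            have "f p < x" using fpa x by simp
            then have "p < t" using k[of p] p np unfolding tx by simp
            moreover have "t \<le> h y"
            proof -
              have "real n powi k * t \<le> real n powi k * h y" using x(2) fy tx by linarith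
              then show ?thesis using np by (simp only: mult_le_cancel_left_pos)
            qed
            ultimately have "t \<in> S" "f t = x" using p k[of t] tx by (auto simp: S_def)
            then have "h x = t" using h(3)[of t] by simp
            then show ?thesis using affine_solve[OF tx np] by (simp add: power_int_minus)
          qed
          then show ?thesis by blast
        qed
        define z where "z = (a + b) / 2"
        have z: "a < z" "z < b" using True by (auto simp: z_def)
        obtain k c where kc: "\<And>x. a < x \<Longrightarrow> x \<le> z \<Longrightarrow> h x = real n powi k * x + c"
          using aff[of z] z by auto
        have "h x = real n powi k * x + c" if x: "x \<in> {a<..<b}" for x
        proof (cases "x \<le> z")
          case False
          obtain l d where ld: "\<And>u. a < u \<Longrightarrow> u \<le> x \<Longrightarrow> h u = real n powi l * u + d"
            using aff[of x] x by auto
          define w where "w = (a + z) / 2"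
          have w: "a < w" "w < z" using z by (auto simp: w_def)
          have e1: "real n powi l * z + d = real n powi k * z + c"
            using kc[of z] ld[of z] z False by simp
          have e2: "real n powi l * w + d = real n powi k * w + c"
            using kc[of w] ld[of w] w False by simp
          from e1 e2 have "(real n powi l - real n powi k) * (z - w) = 0" by algebra
          then have "real n powi l = real n powi k" using w by simp
          then show ?thesis using e1 ld[of x] x by simp
        qed (use kc x in auto)
        then show ?thesis by blast
      qed auto
      moreover have "E \<subseteq> n_adic n"
      proof
        fix y assume "y \<in> E"
        then obtain e where "e \<in> insert 0 B" "e \<in> S" "y = f e" by (auto simp: E_def)
        then have "e \<in> n_adic n \<inter> S" using B(2) zero_n_adic by auto
        then have "f e \<in> f ` (n_adic n \<inter> S)" by (rule imageI)
        then show "y \<in> n_adic n" unfolding Df using \<open>y = f e\<close> by simp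
      qed
      moreover have "finite E" using B by (simp add: E_def)
      ultimately show ?thesis
        unfolding pw_affine_def by (intro exI[of _ E] conjI allI impI)
    qed
    moreover have "h ` (n_adic n \<inter> S) = n_adic n \<inter> S"
      unfolding h_def by (rule preserved_image_inv[OF 3(1) Int_lower2 Df])
    ultimately show ?case
      unfolding h_def by (intro conjI ballI)
  qed
qed

lemma circle_pt_eq_iff: "circle_pt r x = circle_pt r y \<longleftrightarrow> (\<exists>m::int. y = x + real r * of_int m)"
proof
  assume "circle_pt r x = circle_pt r y"
  moreover have "y \<in> circle_pt r y"
    by (auto simp: circle_pt_def circle_rel_def intro: exI[of _ 0])
  ultimately show "\<exists>m::int. y = x + real r * of_int m"
    by (auto simp: circle_pt_def circle_rel_def)
next
  assume "\<exists>m::int. y = x + real r * of_int m"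
  then obtain m :: int where m: "y = x + real r * of_int m" by blast
  have "(\<exists>j::int. z = x + real r * of_int j) \<longleftrightarrow> (\<exists>j::int. z = y + real r * of_int j)" for z
  proof
    assume "\<exists>j::int. z = x + real r * of_int j"
    then obtain j :: int where "z = x + real r * of_int j" by blast
    then have "z = y + real r * of_int (j - m)" using m by (simp add: algebra_simps)
    then show "\<exists>j::int. z = y + real r * of_int j" by blast
  next
    assume "\<exists>j::int. z = y + real r * of_int j"
    then obtain j :: int where "z = y + real r * of_int j" by blast
    then have "z = x + real r * of_int (j + m)" using m by (simp add: algebra_simps)
    then show "\<exists>j::int. z = x + real r * of_int j" by blast
  qed
  then show "circle_pt r x = circle_pt r y"
    by (auto simp: circle_pt_def circle_rel_def)
qed

lemma circle_eq: "circle r = range (circle_pt r)"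
  by (auto simp: circle_def circle_pt_def quotient_def)

lemma circle_pt_in_circle [simp]: "circle_pt r x \<in> circle r"
  by (simp add: circle_eq)

lemma openin_circle_topology:
  "openin (circle_topology r) U \<longleftrightarrow> U \<subseteq> circle r \<and> open (circle_pt r -` U)"
proof -
  have "istopology (\<lambda>U. U \<subseteq> circle r \<and> open (circle_pt r -` U))"
    unfolding istopology_def by (auto simp: vimage_Union)
  then show ?thesis by (simp add: circle_topology_def)
qed

lemma topspace_circle_topology [simp]: "topspace (circle_topology r) = circle r"
proof
  show "topspace (circle_topology r) \<subseteq> circle r"
    using openin_circle_topology[of r "topspace (circle_topology r)"] by simp
  have "openin (circle_topology r) (circle r)"
    by (simp add: openin_circle_topology vimage_def)
  then show "circle r \<subseteq> topspace (circle_topology r)"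
    by (rule openin_subset)
qed

lemma quotient_map_circle_pt: "quotient_map euclidean (circle_topology r) (circle_pt r)"
  by (auto simp: quotient_map_def openin_circle_topology circle_eq vimage_def)

lemma circle_lift_surj:
  assumes r: "r > 0" and cont: "continuous_on UNIV \<phi>" and mono: "strict_mono \<phi>"
    and lift: "\<And>x. f (circle_pt r x) = circle_pt r (\<phi> x)"
  shows "surj \<phi>"
proof -
  have step: "\<phi> x + real r \<le> \<phi> (x + real r)" for x
  proof -
    have "circle_pt r x = circle_pt r (x + real r)"
      unfolding circle_pt_eq_iff by (rule exI[of _ 1]) simp
    then have "circle_pt r (\<phi> x) = circle_pt r (\<phi> (x + real r))" by (metis lift)
    then obtain m :: int where m: "\<phi> (x + real r) = \<phi> x + real r * of_int m"
      unfolding circle_pt_eq_iff by blast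
    have "\<phi> x < \<phi> (x + real r)" using mono r by (simp add: strict_mono_def)
    then have "0 < real r * of_int m" using m by simp
    then have "1 \<le> m" using r by (simp add: zero_less_mult_iff)
    then have "real r * 1 \<le> real r * of_int m" by (intro mult_left_mono) auto
    then show ?thesis using m by simp
  qed
  have up: "\<phi> 0 + real j * real r \<le> \<phi> (real j * real r)" for j :: nat
  proof (induction j)
    case (Suc j)
    then show ?case using step[of "real j * real r"] by (simp add: algebra_simps)
  qed simp
  have down: "\<phi> (- (real j * real r)) \<le> \<phi> 0 - real j * real r" for j :: nat
  proof (induction j)
    case (Suc j)
    then show ?case using step[of "- (real (Suc j) * real r)"] by (simp add: algebra_simps)
  qed simp
  have "\<exists>x. \<phi> x = y" for y
  proof -
    obtain j :: nat where "\<bar>y - \<phi> 0\<bar> < real j * real r"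
      using r reals_Archimedean3[of "real r"] by auto
    then have "\<phi> (- (real j * real r)) \<le> y" "y \<le> \<phi> (real j * real r)"
      using up[of j] down[of j] by linarith+
    moreover have "- (real j * real r) \<le> real j * real r" by simp
    ultimately show ?thesis
      using IVT'[of \<phi> "- (real j * real r)" y "real j * real r"] cont continuous_on_subset by blast
  qed
  then show ?thesis by (metis surjI)
qed

lemma n_adic_circle_inv:
  assumes "f \<in> Bij (circle r)" "f ` (circle_pt r ` n_adic n) = circle_pt r ` n_adic n"
    "x \<in> circle_pt r ` n_adic n"
  shows "inv_into (circle r) f x \<in> circle_pt r ` n_adic n"
proof -
  have "x \<in> f ` (circle_pt r ` n_adic n)"
    unfolding assms(2) by (rule assms(3))
  then obtain d where d: "d \<in> circle_pt r ` n_adic n" "x = f d"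
    by (rule imageE) simp
  then have "d \<in> circle r" by auto
  then show ?thesis using d assms(1) by (simp add: Bij_inv)
qed

lemma group_thompson_T:
  assumes n: "n > 0" and r: "r > 0"
  shows "group (thompson_T n r)"
proof -
  define S where "S = circle r"
  define D where "D = circle_pt r ` n_adic n"
  have pt [simp]: "circle_pt r x \<in> S" for x by (simp add: S_def)
  have DS: "D \<subseteq> S" by (auto simp: D_def)
  show ?thesis
    unfolding thompson_T_def S_def[symmetric] D_def[symmetric]
  proof (rule group_perm_group, goal_cases)
    case 1
    have "homeomorphic_map (circle_topology r) (circle_topology r) (\<lambda>x\<in>S. x)"
      by (rule homeomorphic_map_eq[OF homeomorphic_map_id[THEN iffD2, OF refl]]) (simp add: S_def)
    moreover have "circle_orientation_preserving r (\<lambda>x\<in>S. x)"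
      unfolding circle_orientation_preserving_def
      by (rule exI[of _ id]) (auto simp: strict_mono_def)
    moreover have "circle_pw_affine n r (\<lambda>x\<in>S. x)"
      unfolding circle_pw_affine_def
      by (rule exI[of _ "{}"]) (auto intro!: exI[of _ "0::int"] exI[of _ "0::real"])
    moreover have "(\<lambda>x\<in>S. x) ` D = D" using DS by force
    ultimately show ?case by (intro conjI)
  next
    case (2 f g)
    have homf: "homeomorphic_map (circle_topology r) (circle_topology r) f" and orf: "circle_orientation_preserving r f"
      and pf: "circle_pw_affine n r f" and Df: "f ` D = D"
      using 2(3) by - (elim conjE, assumption)+
    have homg: "homeomorphic_map (circle_topology r) (circle_topology r) g" and org: "circle_orientation_preserving r g"
      and pg: "circle_pw_affine n r g" and Dg: "g ` D = D"
      using 2(4) by - (elim conjE, assumption)+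
    have "homeomorphic_map (circle_topology r) (circle_topology r) (compose S g f)"
      by (rule homeomorphic_map_eq[OF homeomorphic_map_compose[of _ _ f _ g]])
        (use homf homg in \<open>auto simp: S_def compose_eq\<close>)
    moreover have "circle_orientation_preserving r (compose S g f)"
    proof -
      obtain \<phi> where \<phi>: "continuous_on UNIV \<phi>" "strict_mono \<phi>"
        "\<And>x. f (circle_pt r x) = circle_pt r (\<phi> x)"
        using orf unfolding circle_orientation_preserving_def by blast
      obtain \<psi> where \<psi>: "continuous_on UNIV \<psi>" "strict_mono \<psi>"
        "\<And>x. g (circle_pt r x) = circle_pt r (\<psi> x)"
        using org unfolding circle_orientation_preserving_def by blast
      show ?thesis
        unfolding circle_orientation_preserving_def
      proof (intro exI conjI allI)
        show "continuous_on UNIV (\<psi> \<circ> \<phi>)"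
          using \<phi> \<psi> by (intro continuous_on_compose) (auto intro: continuous_on_subset)
        show "strict_mono (\<psi> \<circ> \<phi>)" using \<phi> \<psi> by (simp add: strict_mono_def)
        show "compose S g f (circle_pt r x) = circle_pt r ((\<psi> \<circ> \<phi>) x)" for x
          using \<phi> \<psi> by (simp add: compose_eq)
      qed
    qed
    moreover have "circle_pw_affine n r (compose S g f)"
    proof -
      obtain B where B: "finite B" "B \<subseteq> D" and Bf: "\<And>a b. circle_pt r ` {a<..<b} \<inter> B = {} \<Longrightarrow>
          \<exists>(k::int) c. \<forall>x\<in>{a<..<b}. f (circle_pt r x) = circle_pt r (real n powi k * x + c)"
        using pf unfolding circle_pw_affine_def D_def by blast
      obtain C where C: "finite C" "C \<subseteq> D" and Cg: "\<And>a b. circle_pt r ` {a<..<b} \<inter> C = {} \<Longrightarrow>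
          \<exists>(k::int) c. \<forall>x\<in>{a<..<b}. g (circle_pt r x) = circle_pt r (real n powi k * x + c)"
        using pg unfolding circle_pw_affine_def D_def by blast
      define E where "E = B \<union> inv_into S f ` C"
      have "E \<subseteq> D"
        using B(2) C(2) n_adic_circle_inv[OF 2(1)[unfolded S_def] Df[unfolded D_def]]
        unfolding E_def S_def D_def by auto
      moreover have "finite E" using B C by (simp add: E_def)
      moreover have "\<exists>(k::int) c. \<forall>x\<in>{a<..<b}.
          compose S g f (circle_pt r x) = circle_pt r (real n powi k * x + c)"
        if ab: "circle_pt r ` {a<..<b} \<inter> E = {}" for a b
      proof -
        obtain k c where kc: "\<forall>x\<in>{a<..<b}. f (circle_pt r x) = circle_pt r (real n powi k * x + c)"
          using Bf[of a b] ab unfolding E_def by blast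
        have np: "real n powi k > 0" using n by simp
        define a' b' where "a' = real n powi k * a + c" and "b' = real n powi k * b + c"
        have "circle_pt r y \<notin> C" if y: "y \<in> {a'<..<b'}" for y
        proof
          assume yC: "circle_pt r y \<in> C"
          define x where "x = (y - c) / real n powi k"
          have xy: "y = real n powi k * x + c" using n by (simp add: x_def)
          have x: "x \<in> {a<..<b}"
            using y np by (simp add: xy a'_def b'_def)
          have "f (circle_pt r x) = circle_pt r y" using bspec[OF kc x] xy by simp
          then have "inv_into S f (circle_pt r y) = circle_pt r x"
            using Bij_inv(3)[OF 2(1) pt, of x] by simp
          then have "circle_pt r x \<in> E" using yC by (auto simp: E_def)
          then show False using ab x by blast
        qed
        then have "circle_pt r ` {a'<..<b'} \<inter> C = {}" by blast
        then obtain l d where ld: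
          "\<forall>x\<in>{a'<..<b'}. g (circle_pt r x) = circle_pt r (real n powi l * x + d)"
          using Cg by blast
        have "compose S g f (circle_pt r x) =
            circle_pt r (real n powi (l + k) * x + (real n powi l * c + d))" if x: "x \<in> {a<..<b}" for x
        proof -
          have "real n powi k * x + c \<in> {a'<..<b'}"
            using powi_affine_image[OF n x] by (simp add: a'_def b'_def)
          then have "g (f (circle_pt r x)) = circle_pt r (real n powi l * (real n powi k * x + c) + d)"
            using bspec[OF kc x] bspec[OF ld] by simp
          then show ?thesis using n by (simp add: compose_eq power_int_add algebra_simps)
        qed
        then show ?thesis by blast
      qed
      ultimately show ?thesis
        unfolding circle_pw_affine_def D_def[symmetric] by (intro exI[of _ E] conjI allI impI)
    qed
    moreover have "compose S g f ` D = D"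
      by (rule preserved_image_compose[OF DS Df Dg])
    ultimately show ?case by (intro conjI)
  next
    case (3 f)
    have homf: "homeomorphic_map (circle_topology r) (circle_topology r) f" and orf: "circle_orientation_preserving r f"
      and pf: "circle_pw_affine n r f" and Df: "f ` D = D"
      using 3(2) by - (elim conjE, assumption)+
    define h where "h = (\<lambda>x\<in>S. inv_into S f x)"
    have h: "h y \<in> S" "f (h y) = y" "h (f y) = y" if "y \<in> S" for y
      using that 3(1) by (auto simp: h_def Bij_inv Bij_mem)
    obtain \<phi> where \<phi>: "continuous_on UNIV \<phi>" "strict_mono \<phi>"
      "\<And>x. f (circle_pt r x) = circle_pt r (\<phi> x)"
      using orf unfolding circle_orientation_preserving_def by blast
    have surj: "surj \<phi>" by (rule circle_lift_surj[OF r \<phi>])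
    define \<psi> where "\<psi> = inv_into UNIV \<phi>"
    have \<psi>: "\<phi> (\<psi> y) = y" "\<psi> (\<phi> y) = y" for y
      using surj strict_mono_imp_inj_on[OF \<phi>(2)] by (auto simp: \<psi>_def surj_f_inv_f)
    have psi_less: "\<psi> x < \<psi> y \<longleftrightarrow> x < y" for x y
      using \<psi>(1) strict_mono_less[OF \<phi>(2), of "\<psi> x" "\<psi> y"] by simp
    have h_lift: "h (circle_pt r y) = circle_pt r (\<psi> y)" for y
      using h(3)[of "circle_pt r (\<psi> y)"] \<phi>(3)[of "\<psi> y"] \<psi>(1) by simp
    have "homeomorphic_map (circle_topology r) (circle_topology r) h"
    proof -
      obtain f' where f': "homeomorphic_maps (circle_topology r) (circle_topology r) f f'"
        using homf homeomorphic_map_maps by blast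
      then have "homeomorphic_map (circle_topology r) (circle_topology r) f'"
        using homeomorphic_maps_map by blast
      moreover have "f' y = h y" if "y \<in> S" for y
        using f' h[OF that] unfolding homeomorphic_maps_def S_def by (metis S_def topspace_circle_topology)
      ultimately show ?thesis
        by (elim homeomorphic_map_eq) (simp add: S_def)
    qed
    moreover have "circle_orientation_preserving r h"
      unfolding circle_orientation_preserving_def
    proof (intro exI conjI allI)
      have "range \<psi> = UNIV" using \<psi>(2) by (metis surjI)
      then show "continuous_on UNIV \<psi>"
        by (intro continuous_onI_mono) (auto simp: psi_less order_le_less)
      show "strict_mono \<psi>" by (simp add: strict_mono_def psi_less)
    qed (rule h_lift)
    moreover have "circle_pw_affine n r h"
    proof -
      obtain B where B: "finite B" "B \<subseteq> D" and Bf: "\<And>a b. circle_pt r ` {a<..<b} \<inter> B = {} \<Longrightarrow>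
          \<exists>(k::int) c. \<forall>x\<in>{a<..<b}. f (circle_pt r x) = circle_pt r (real n powi k * x + c)"
        using pf unfolding circle_pw_affine_def D_def by blast
      have "\<exists>(k::int) c. \<forall>y\<in>{a<..<b}. h (circle_pt r y) = circle_pt r (real n powi k * y + c)"
        if ab: "circle_pt r ` {a<..<b} \<inter> f ` B = {}" for a b
      proof (cases "a < b")
        case True
        have "circle_pt r x \<notin> B" if x: "x \<in> {\<psi> a<..<\<psi> b}" for x
        proof
          assume "circle_pt r x \<in> B"
          then have "circle_pt r (\<phi> x) \<in> f ` B" using \<phi>(3) by (metis image_eqI)
          moreover have "\<phi> x \<in> {a<..<b}" using x psi_less[of a "\<phi> x"] psi_less[of "\<phi> x" b] \<psi> by simp
          ultimately show False using ab by blast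
        qed
        then have "circle_pt r ` {\<psi> a<..<\<psi> b} \<inter> B = {}" by blast
        then obtain k c where kc:
          "\<forall>x\<in>{\<psi> a<..<\<psi> b}. f (circle_pt r x) = circle_pt r (real n powi k * x + c)"
          using Bf by blast
        have np: "real n powi k > 0" using n by simp
        define d where "d = (\<lambda>x. (\<phi> x - (real n powi k * x + c)) / real r)"
        have "d x \<in> \<int>" if "x \<in> {\<psi> a<..<\<psi> b}" for x
        proof -
          have "circle_pt r (real n powi k * x + c) = circle_pt r (\<phi> x)" using kc that \<phi>(3) by metis
          then obtain m :: int where "\<phi> x = real n powi k * x + c + real r * of_int m"
            unfolding circle_pt_eq_iff by blast
          then have "d x = of_int m" using r by (simp add: d_def)
          then show ?thesis by simp
        qed
        then have "d ` {\<psi> a<..<\<psi> b} \<subseteq> \<int>" by blast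
        moreover have "continuous_on {\<psi> a<..<\<psi> b} d"
          unfolding d_def using r
          by (intro continuous_intros continuous_on_subset[OF \<phi>(1)]) auto
        ultimately have const: "d constant_on {\<psi> a<..<\<psi> b}"
        proof (intro continuous_discrete_range_constant)
          fix x assume x: "x \<in> {\<psi> a<..<\<psi> b}" and sub: "d ` {\<psi> a<..<\<psi> b} \<subseteq> \<int>"
          show "\<exists>e>0. \<forall>y. y \<in> {\<psi> a<..<\<psi> b} \<and> d y \<noteq> d x \<longrightarrow> e \<le> norm (d y - d x)"
          proof (intro exI[of _ 1] conjI allI impI)
            fix y assume y: "y \<in> {\<psi> a<..<\<psi> b} \<and> d y \<noteq> d x"
            have "d y \<in> \<int>" "d x \<in> \<int>" using sub x y by blast+
            then have "d y - d x \<in> \<int>" "d y - d x \<noteq> 0" using y by auto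
            then show "1 \<le> norm (d y - d x)" using Ints_nonzero_abs_ge1 by (metis real_norm_def)
          qed simp
        qed auto
        then obtain m where m: "\<And>x. x \<in> {\<psi> a<..<\<psi> b} \<Longrightarrow> d x = m"
          unfolding constant_on_def by blast
        have "\<psi> y = real n powi (-k) * y + (- (c + real r * m) * real n powi (-k))"
          if y: "y \<in> {a<..<b}" for y
        proof -
          have "d (\<psi> y) = m" using y by (intro m) (simp add: psi_less)
          then have "y = real n powi k * \<psi> y + (c + real r * m)"
            using r \<psi>(1)[of y] by (simp add: d_def field_simps)
          from affine_solve[OF this np] show ?thesis by (simp add: power_int_minus)
        qed
        then show ?thesis using h_lift by metis
      qed auto
      moreover have "f ` B \<subseteq> D" using image_mono[OF B(2), of f] Df by simp
      ultimately show ?thesis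
        unfolding circle_pw_affine_def D_def[symmetric] using B(1)
        by (intro exI[of _ "f ` B"] conjI allI impI) (rule finite_imageI)
    qed
    moreover have "h ` D = D"
      unfolding h_def by (rule preserved_image_inv[OF 3(1) DS Df])
    ultimately show ?case unfolding h_def by (intro conjI)
  qed
qed

end

theory Submission
  imports Defs
begin

text \<open>
  Subdividing the line repeatedly, on the one side into \<open>n\<close> equal parts and on the other side
  along the binary prefix code \<open>0, 10, 110, \<dots>\<close> with \<open>n\<close> words, gives in the limit an increasing
  bijection \<open>\<Phi>\<close> which sends $\mathbb{Z}[1/n]$ onto $\mathbb{Z}[1/2]$ and \<open>[0, r)\<close> onto \<open>[0, 1)\<close>.
  On each cell it is a dyadic rescaling of one and the same map, so that conjugation
  by \<open>\<Phi>\<close> turns an affine map between cells of the \<open>n\<close>-adic grids into an affine map with slope a power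
  of two.  This embeds \<open>F\<close>, \<open>T\<close> and \<open>V\<close> with parameters \<open>n, r\<close> into those with parameters \<open>2, 1\<close>.

  For the quasi-automorphisms, each vertex of the \<open>n\<close>-regular forest is given a
  cell of the \<open>(n + 1)\<close>-adic subdivision of \<open>[0, r + p)\<close>: the cone of a vertex is divided into the cones of
  its \<open>n\<close> children and one additional cell.  A bijection of the vertices permutes these cells by affine
  maps; if it respects children at all deep vertices, then on the cone of a deep vertex these maps
  agree, and they fit together to an element of \<open>V\<close> with parameters \<open>n + 1, r + p\<close>.
  Rays are unary trees, so the Houghton groups are covered by the case \<open>n = 1\<close>.
\<close>

section \<open>Subdivided grids\<close>

lemma n_adicI: "(x::real) = of_int a / real n ^ k \<Longrightarrow> x \<in> n_adic n"
  unfolding n_adic_def by blast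

text \<open>A fraction can be expanded to any larger power of \<open>n\<close> in the denominator,
  so finitely many elements share a level.\<close>

lemma n_adicE_level:
  assumes "x \<in> n_adic n" "n > 0"
  obtains k where "\<And>m. m \<ge> k \<Longrightarrow> \<exists>a::int. x = of_int a / real n ^ m"
proof -
  obtain a :: int and k where x: "x = of_int a / real n ^ k"
    using assms(1) unfolding n_adic_def by blast
  have "\<exists>a::int. x = of_int a / real n ^ m" if "m \<ge> k" for m
  proof -
    have "real n ^ m = real n ^ k * real n ^ (m - k)"
      using that by (simp flip: power_add)
    then have "x = of_int (a * int n ^ (m - k)) / real n ^ m"
      using x assms(2) by simp
    then show ?thesis by blast
  qed
  then show ?thesis by (rule that)
qed

lemma n_adic_common_level:
  assumes "x \<in> n_adic n" "y \<in> n_adic n" "n > 0"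
  obtains a b :: int and k where "x = of_int a / real n ^ k" "y = of_int b / real n ^ k"
proof -
  obtain k where k: "\<And>m. m \<ge> k \<Longrightarrow> \<exists>a::int. x = of_int a / real n ^ m"
    using n_adicE_level[OF assms(1,3)] by blast
  obtain l where l: "\<And>m. m \<ge> l \<Longrightarrow> \<exists>a::int. y = of_int a / real n ^ m"
    using n_adicE_level[OF assms(2,3)] by blast
  show ?thesis
    using k[of "max k l"] l[of "max k l"] that by (metis max.cobounded1 max.cobounded2)
qed

lemma n_adic_add:
  assumes "x \<in> n_adic n" "y \<in> n_adic n" "n > 0"
  shows "x + y \<in> n_adic n"
proof -
  obtain a b :: int and k where "x = of_int a / real n ^ k" "y = of_int b / real n ^ k"
    using n_adic_common_level[OF assms] .
  then have "x + y = of_int (a + b) / real n ^ k" by (simp add: add_divide_distrib)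
  then show ?thesis by (rule n_adicI)
qed

lemma n_adic_mult:
  assumes "x \<in> n_adic n" "y \<in> n_adic n"
  shows "x * y \<in> n_adic n"
proof -
  obtain a b :: int and k l where "x = of_int a / real n ^ k" "y = of_int b / real n ^ l"
    using assms unfolding n_adic_def by blast
  then have "x * y = of_int (a * b) / real n ^ (k + l)" by (simp add: power_add)
  then show ?thesis by (rule n_adicI)
qed

lemma n_adic_of_int [simp]: "of_int a \<in> n_adic n"
  by (rule n_adicI[of _ a _ 0]) simp

lemma n_adic_of_nat [simp]: "of_nat a \<in> n_adic n"
  using n_adic_of_int[of "int a"] by simp

lemma n_adic_powi [simp]: "n > 0 \<Longrightarrow> real n powi k \<in> n_adic n"
proof (cases "k \<ge> 0")
  case True
  then show ?thesis using n_adic_of_nat[of "n ^ nat k"] by (simp add: power_int_def)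
next
  case False
  then show ?thesis
    by (intro n_adicI[of _ 1 _ "nat (- k)"]) (simp add: power_int_def divide_inverse power_inverse)
qed

lemma n_adic_diff:
  assumes "x \<in> n_adic n" "y \<in> n_adic n" "n > 0"
  shows "x - y \<in> n_adic n"
proof -
  have "x + of_int (-1) * y \<in> n_adic n"
    by (intro n_adic_add n_adic_mult n_adic_of_int assms)
  then show ?thesis by simp
qed

section \<open>Dyadic grids and their refinement\<close>

lemma strict_mono_intI:
  fixes f :: "int \<Rightarrow> 'a :: order"
  assumes "\<And>a. f a < f (a + 1)"
  shows "strict_mono f"
proof (rule strict_monoI)
  fix a b :: int assume "a < b"
  then show "f a < f b"
    by (induction rule: int_gr_induct) (use assms order_less_trans in blast)+
qed

text \<open>One subdivision step: between \<open>s b\<close> and \<open>s (b + 1)\<close> it inserts the breakpoints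
  of the binary prefix code \<open>0, 10, 110, \<dots>, 1\<^sup>n\<^sup>-\<^sup>1\<close> with \<open>n\<close> words.\<close>

definition refine :: "nat \<Rightarrow> (int \<Rightarrow> real) \<Rightarrow> int \<Rightarrow> real" where
  "refine n s a = s (a div int n) +
    (s (a div int n + 1) - s (a div int n)) * (1 - (1/2) ^ nat (a mod int n))"

text \<open>Every cell of the grid is a standard dyadic interval. The exponent \<open>e\<close> may
  vary from cell to cell, so cell lengths are exact powers of two, and the bound \<open>k\<close>
  keeps them at most \<open>1 / 2 ^ k\<close>.\<close>

definition dyadic_grid :: "nat \<Rightarrow> (int \<Rightarrow> real) \<Rightarrow> bool" where
  "dyadic_grid k s \<longleftrightarrow>
    (\<forall>a. \<exists>(q::int) e. e \<ge> k \<and> s a = of_int q / 2 ^ e \<and> s (a + 1) = of_int (q + 1) / 2 ^ e)"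

lemma dyadic_gridE:
  assumes "dyadic_grid k s"
  obtains q :: int and e where "e \<ge> k" "s a = of_int q / 2 ^ e" "s (a + 1) = of_int (q + 1) / 2 ^ e"
  using assms unfolding dyadic_grid_def by blast

lemma dyadic_grid_of_int: "dyadic_grid 0 of_int"
  unfolding dyadic_grid_def by (auto intro!: exI[of _ "0::nat"])

lemma dyadic_grid_strict_mono:
  assumes "dyadic_grid k s"
  shows "strict_mono s"
proof (rule strict_mono_intI)
  fix a
  show "s a < s (a + 1)"
    by (rule dyadic_gridE[OF assms, of a]) (simp add: divide_strict_right_mono)
qed

lemma dyadic_grid_step_le:
  assumes "dyadic_grid k s"
  shows "s (a + 1) - s a \<le> 1 / 2 ^ k"
proof -
  obtain q :: int and e where e: "e \<ge> k" "s a = of_int q / 2 ^ e" "s (a + 1) = of_int (q + 1) / 2 ^ e"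
    using dyadic_gridE[OF assms] .
  then have "s (a + 1) - s a = 1 / 2 ^ e" by (simp add: add_divide_distrib)
  then show ?thesis using e(1) by (simp add: frac_le)
qed

lemma dyadic_grid_n_adic:
  assumes "dyadic_grid k s"
  shows "s a \<in> n_adic 2"
  by (rule dyadic_gridE[OF assms, of a]) (auto intro!: n_adicI)

text \<open>In a cell of length \<open>1 / 2 ^ e\<close> the \<open>j\<close>-th new cell has length
  \<open>1 / 2 ^ (e + j + 1)\<close>, except the last one, which has \<open>j = n - 1\<close> and
  length \<open>1 / 2 ^ (e + j)\<close>. For \<open>n = 1\<close> nothing is subdivided, whence the
  two cases of the bound.\<close>

lemma dyadic_grid_refine:
  assumes n: "n > 0" and s: "dyadic_grid k s"
  shows "dyadic_grid (if n \<ge> 2 then Suc k else k) (refine n s)"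
  unfolding dyadic_grid_def
proof
  fix a :: int
  define b j where "b = a div int n" and "j = nat (a mod int n)"
  have jn: "j < n" and ja: "a = b * int n + int j"
    using n by (auto simp: j_def b_def nat_less_iff)
  obtain q :: int and e where e: "e \<ge> k" "s b = of_int q / 2 ^ e" "s (b + 1) = of_int (q + 1) / 2 ^ e"
    using dyadic_gridE[OF s] .
  have d: "s (b + 1) - s b = 1 / 2 ^ e" using e by (simp add: add_divide_distrib)
  have ra: "refine n s a = of_int q / 2 ^ e + (1 - 1 / 2 ^ j) / 2 ^ e"
    using d e by (simp add: refine_def flip: b_def j_def) (simp add: power_one_over)
  show "\<exists>(q::int) e. e \<ge> (if n \<ge> 2 then Suc k else k) \<and> refine n s a = of_int q / 2 ^ e \<and>
      refine n s (a + 1) = of_int (q + 1) / 2 ^ e"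
  proof (cases "j + 1 < n")
    case True
    have "(a + 1) div int n = b" "nat ((a + 1) mod int n) = j + 1"
    proof -
      have "a + 1 = int (j + 1) + b * int n" using ja by simp
      then show "(a + 1) div int n = b" "nat ((a + 1) mod int n) = j + 1"
        using True n by (simp_all only: div_mult_self1 mod_mult_self1) auto
    qed
    then have "refine n s (a + 1) = of_int q / 2 ^ e + (1 - 1 / 2 ^ (j + 1)) / 2 ^ e"
      using d e by (simp add: refine_def) (simp add: power_one_over)
    \<comment> \<open>The left end is \<open>(q + 1 - 1 / 2 ^ j) / 2 ^ e\<close>, brought to the
      denominator \<open>2 ^ (e + (j + 1))\<close>; the right end has the next numerator.\<close>
    then have "refine n s (a + 1) = of_int ((q + 1) * 2 ^ (j + 1) - 2 + 1) / 2 ^ (e + (j + 1))"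
      by (simp add: field_simps power_add)
    moreover have "refine n s a = of_int ((q + 1) * 2 ^ (j + 1) - 2) / 2 ^ (e + (j + 1))"
      unfolding ra by (simp add: field_simps power_add)
    ultimately show ?thesis using e(1) by (intro exI[of _ "(q + 1) * 2 ^ (j + 1) - 2"] exI[of _ "e + (j + 1)"]) simp
  next
    case False
    \<comment> \<open>The last cell ends where the old cell ends. Its code word consists of
      \<open>j\<close> ones without a final zero, hence the exponent \<open>e + j\<close>.\<close>
    then have jn': "n = j + 1" using jn by simp
    then have "a + 1 = (b + 1) * int n" using ja by (simp add: algebra_simps)
    then have "(a + 1) div int n = b + 1" "(a + 1) mod int n = 0" using n by auto
    then have "refine n s (a + 1) = of_int (q + 1) / 2 ^ e"
      using e by (simp add: refine_def)
    then have "refine n s (a + 1) = of_int ((q + 1) * 2 ^ j - 1 + 1) / 2 ^ (e + j)"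
      by (simp add: power_add)
    moreover have "refine n s a = of_int ((q + 1) * 2 ^ j - 1) / 2 ^ (e + j)"
      unfolding ra by (simp add: field_simps power_add)
    ultimately show ?thesis using e(1) jn' by (intro exI[of _ "(q + 1) * 2 ^ j - 1"] exI[of _ "e + j"]) simp
  qed
qed

lemma dyadic_grid_funpow:
  assumes n: "n \<ge> 2" and s: "dyadic_grid k s"
  shows "dyadic_grid (k + m) ((refine n ^^ m) s)"
proof (induction m)
  case (Suc m)
  then show ?case using dyadic_grid_refine[OF _ Suc.IH, of n] n by simp
qed (use s in simp)

text \<open>Refinement works cell by cell and commutes with affine changes of the values, so below a
  cell of \<open>s\<close> it reproduces the refined integer grid on [0, 1]. The right end
  \<open>b = int n ^ k\<close> is included because the next refinement reads both ends of a
  cell.\<close>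

lemma refine_funpow_affine:
  assumes n: "n > 0" and "0 \<le> b" "b \<le> int n ^ k"
  shows "(refine n ^^ k) s (a * int n ^ k + b) = s a + (s (a + 1) - s a) * (refine n ^^ k) of_int b"
  using assms(2,3)
proof (induction k arbitrary: b)
  case 0
  then have "b = 0 \<or> b = 1" by auto
  then show ?case by auto
next
  case (Suc k)
  define b' where "b' = b div int n"
  have dm: "(a * int n ^ Suc k + b) div int n = a * int n ^ k + b'"
    "(a * int n ^ Suc k + b) mod int n = b mod int n"
  proof -
    have *: "a * int n ^ Suc k + b = b + int n * (a * int n ^ k)" by simp
    show "(a * int n ^ Suc k + b) div int n = a * int n ^ k + b'"
      "(a * int n ^ Suc k + b) mod int n = b mod int n"
      unfolding * using n by (simp_all add: b'_def)
  qed
  have b': "0 \<le> b'" "b' \<le> int n ^ k"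
  proof -
    show "0 \<le> b'" using Suc.prems n by (simp add: b'_def pos_imp_zdiv_nonneg_iff)
    have "b' \<le> (int n * int n ^ k) div int n"
      unfolding b'_def using Suc.prems n by (intro zdiv_mono1) auto
    then show "b' \<le> int n ^ k" using n by simp
  qed
  have R: "(refine n ^^ Suc k) u z = (refine n ^^ k) u (z div int n) + ((refine n ^^ k) u (z div int n + 1) -
      (refine n ^^ k) u (z div int n)) * (1 - (1/2) ^ nat (z mod int n))" for u z
    by (simp add: refine_def[of n "(refine n ^^ k) u"])
  \<comment> \<open>If \<open>n\<close> divides \<open>b\<close>, the weight of the right neighbour
    \<open>b' + 1\<close> vanishes; otherwise \<open>b' < int n ^ k\<close>, so the induction
    hypothesis also covers the neighbour.\<close>
  show ?case
  proof (cases "b mod int n = 0")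
    case True
    then show ?thesis
      unfolding R dm b'_def[symmetric] Suc.IH[OF b'] by simp
  next
    case False
    have "b' \<noteq> int n ^ k"
    proof
      assume "b' = int n ^ k"
      then have "int n * int n ^ k + b mod int n = b"
        using mult_div_mod_eq[of "int n" b] by (simp add: b'_def)
      moreover have "b mod int n > 0"
        using False n pos_mod_sign[of "int n" b] by linarith
      ultimately show False using Suc.prems by simp
    qed
    then have "0 \<le> b' + 1" "b' + 1 \<le> int n ^ k" using b' by auto
    note IH = Suc.IH[OF this, folded add.assoc] Suc.IH[OF b']
    show ?thesis
      unfolding R dm b'_def[symmetric] IH by (simp add: algebra_simps)
  qed
qed

lemma refine_funpow_of_int_0: "n > 0 \<Longrightarrow> (refine n ^^ k) of_int 0 = 0"
  by (induction k) (auto simp: refine_def)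

text \<open>Each refinement keeps the old grid points and multiplies their indices by
  \<open>n\<close>, so that the value attached to a fraction is independent of its
  denominator.\<close>

lemma refine_funpow_coarse:
  assumes "n > 0"
  shows "(refine n ^^ (m + k)) s (a * int n ^ k) = (refine n ^^ m) s a"
  using refine_funpow_affine[OF assms, of 0 k "(refine n ^^ m) s" a] assms
  by (simp add: funpow_add add.commute[of m k] refine_funpow_of_int_0)

text \<open>The number \<open>a / n\<^sup>m\<close> is sent to the point \<open>a\<close> of the \<open>m\<close>-th subdivision of the grid \<open>s\<close>.\<close>

definition grid_limit :: "nat \<Rightarrow> (int \<Rightarrow> real) \<Rightarrow> real \<Rightarrow> real" where
  "grid_limit n s x = (SUP m. (refine n ^^ m) s \<lfloor>real n ^ m * x\<rfloor>)"

section \<open>Properties of the limit map\<close>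

lemma floor_power_bounds:
  assumes "n > 0"
  shows "\<lfloor>real n ^ m * x\<rfloor> * int n ^ k \<le> \<lfloor>real n ^ (m + k) * x\<rfloor>"
    "\<lfloor>real n ^ (m + k) * x\<rfloor> < (\<lfloor>real n ^ m * x\<rfloor> + 1) * int n ^ k"
proof -
  define a where "a = \<lfloor>real n ^ m * x\<rfloor>"
  have a: "of_int a \<le> real n ^ m * x" "real n ^ m * x < of_int a + 1"
    by (simp_all add: a_def)
  have "of_int a * real n ^ k \<le> (real n ^ m * x) * real n ^ k"
    "(real n ^ m * x) * real n ^ k < (of_int a + 1) * real n ^ k"
    using a assms by (auto intro!: mult_right_mono mult_strict_right_mono)
  then have "of_int (a * int n ^ k) \<le> real n ^ (m + k) * x"
    "real n ^ (m + k) * x < of_int ((a + 1) * int n ^ k)"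
    by (simp_all add: power_add mult.commute mult.left_commute)
  then show "\<lfloor>real n ^ m * x\<rfloor> * int n ^ k \<le> \<lfloor>real n ^ (m + k) * x\<rfloor>"
    "\<lfloor>real n ^ (m + k) * x\<rfloor> < (\<lfloor>real n ^ m * x\<rfloor> + 1) * int n ^ k"
    unfolding a_def[symmetric] by (simp_all only: le_floor_iff floor_less_iff)
qed

text \<open>The initial grid is left open because two are compared: the one defining
  \<open>\<Phi>\<close>, and the integer grid, whose limit is the common shape of
  \<open>\<Phi>\<close> on all cells.\<close>

locale nadic_grid =
  fixes n :: nat and s :: "int \<Rightarrow> real"
  assumes n: "n \<ge> 2" and s: "dyadic_grid 0 s"
begin

abbreviation G :: "nat \<Rightarrow> int \<Rightarrow> real" where
  "G m \<equiv> (refine n ^^ m) s"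

abbreviation \<Phi> :: "real \<Rightarrow> real" where
  "\<Phi> \<equiv> grid_limit n s"

lemma n_pos: "n > 0"
  using n by simp

lemma dyadic_grid_G: "dyadic_grid m (G m)"
  using dyadic_grid_funpow[OF n s, of m] by simp

lemma G_less_iff: "G m a < G m b \<longleftrightarrow> a < b"
  using dyadic_grid_strict_mono[OF dyadic_grid_G] by (simp add: strict_mono_less)

lemma G_le_iff: "G m a \<le> G m b \<longleftrightarrow> a \<le> b"
  using dyadic_grid_strict_mono[OF dyadic_grid_G] by (simp add: strict_mono_less_eq)

lemma G_coarse: "G (m + k) (a * int n ^ k) = G m a"
  by (rule refine_funpow_coarse[OF n_pos])

lemma G_floor_bounds:
  "G m \<lfloor>real n ^ m * x\<rfloor> \<le> G (m + k) \<lfloor>real n ^ (m + k) * x\<rfloor>"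
  "G (m + k) \<lfloor>real n ^ (m + k) * x\<rfloor> < G m (\<lfloor>real n ^ m * x\<rfloor> + 1)"
proof -
  show "G m \<lfloor>real n ^ m * x\<rfloor> \<le> G (m + k) \<lfloor>real n ^ (m + k) * x\<rfloor>"
    unfolding G_coarse[of m k "\<lfloor>real n ^ m * x\<rfloor>", symmetric] G_le_iff
    by (rule floor_power_bounds[OF n_pos])
  show "G (m + k) \<lfloor>real n ^ (m + k) * x\<rfloor> < G m (\<lfloor>real n ^ m * x\<rfloor> + 1)"
    unfolding G_coarse[of m k "\<lfloor>real n ^ m * x\<rfloor> + 1", symmetric] G_less_iff
    by (rule floor_power_bounds[OF n_pos])
qed

text \<open>The images of the left ends of the cells around \<open>x\<close> increase with the level
  and are bounded by that of the right end at level 0. As the supremum is a limit, identities can be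
  checked level by level.\<close>

lemma LIMSEQ_G: "(\<lambda>m. G m \<lfloor>real n ^ m * x\<rfloor>) \<longlonglongrightarrow> \<Phi> x"
  unfolding grid_limit_def
proof (rule LIMSEQ_incseq_SUP)
  show "bdd_above (range (\<lambda>m. G m \<lfloor>real n ^ m * x\<rfloor>))"
  proof (rule bdd_aboveI2)
    show "G m \<lfloor>real n ^ m * x\<rfloor> \<le> G 0 (\<lfloor>real n ^ 0 * x\<rfloor> + 1)" for m
      using G_floor_bounds(2)[where m = 0 and k = m and x = x] unfolding add_0 by (rule less_imp_le)
  qed
  show "incseq (\<lambda>m. G m \<lfloor>real n ^ m * x\<rfloor>)"
  proof (rule incseq_SucI)
    show "G m \<lfloor>real n ^ m * x\<rfloor> \<le> G (Suc m) \<lfloor>real n ^ Suc m * x\<rfloor>" for m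
      using G_floor_bounds(1)[where m = m and x = x and k = 1] unfolding Suc_eq_plus1 .
  qed
qed

lemma LIMSEQ_G_shift: "(\<lambda>k. G (m + k) \<lfloor>real n ^ (m + k) * x\<rfloor>) \<longlonglongrightarrow> \<Phi> x"
  using LIMSEQ_ignore_initial_segment[OF LIMSEQ_G[of x], of m] by (simp add: add.commute)

lemma \<Phi>_bounds: "G m \<lfloor>real n ^ m * x\<rfloor> \<le> \<Phi> x" "\<Phi> x \<le> G m (\<lfloor>real n ^ m * x\<rfloor> + 1)"
proof -
  show "G m \<lfloor>real n ^ m * x\<rfloor> \<le> \<Phi> x"
    by (rule LIMSEQ_le_const[OF LIMSEQ_G_shift[of m]]) (use G_floor_bounds(1)[where m = m and x = x] in blast)
  show "\<Phi> x \<le> G m (\<lfloor>real n ^ m * x\<rfloor> + 1)"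
    by (rule LIMSEQ_le_const2[OF LIMSEQ_G_shift[of m]])
      (use G_floor_bounds(2)[where m = m and x = x] in \<open>blast intro: less_imp_le\<close>)
qed

lemma \<Phi>_grid: "\<Phi> (of_int a / real n ^ m) = G m a"
proof (rule LIMSEQ_unique[OF LIMSEQ_G_shift[of m]])
  have "\<lfloor>real n ^ (m + k) * (of_int a / real n ^ m)\<rfloor> = a * int n ^ k" for k
  proof -
    have "real n ^ (m + k) * (of_int a / real n ^ m) = of_int (a * int n ^ k)"
      using n_pos by (simp add: power_add)
    then show ?thesis by (simp only: floor_of_int)
  qed
  then show "(\<lambda>k. G (m + k) \<lfloor>real n ^ (m + k) * (of_int a / real n ^ m)\<rfloor>) \<longlonglongrightarrow> G m a"
    by (simp only: G_coarse tendsto_const)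
qed

lemma ex_power_gt:
  obtains m where "y < real n ^ m"
  using real_arch_pow[of "real n" y] n by auto

text \<open>At a level with \<open>real n ^ m * (y - x) > 2\<close> a whole cell fits between
  \<open>x\<close> and \<open>y\<close>, and its image has positive length.\<close>

lemma strict_mono_\<Phi>: "strict_mono \<Phi>"
proof (rule strict_monoI)
  fix x y :: real assume "x < y"
  obtain m where "2 / (y - x) < real n ^ m" using ex_power_gt .
  then have "2 < real n ^ m * (y - x)" using \<open>x < y\<close> by (simp add: field_simps)
  then have "2 < real n ^ m * y - real n ^ m * x" by (simp add: algebra_simps)
  then have "\<lfloor>real n ^ m * x\<rfloor> + 1 < \<lfloor>real n ^ m * y\<rfloor>" by linarith
  then have "G m (\<lfloor>real n ^ m * x\<rfloor> + 1) < G m \<lfloor>real n ^ m * y\<rfloor>" by (simp only: G_less_iff)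
  then show "\<Phi> x < \<Phi> y" using \<Phi>_bounds[where m = m and x = x] \<Phi>_bounds[where m = m and x = y] by linarith
qed

lemma \<Phi>_less_iff: "\<Phi> x < \<Phi> y \<longleftrightarrow> x < y"
  using strict_mono_\<Phi> by (simp add: strict_mono_less)

lemma \<Phi>_le_iff: "\<Phi> x \<le> \<Phi> y \<longleftrightarrow> x \<le> y"
  using strict_mono_\<Phi> by (simp add: strict_mono_less_eq)

text \<open>This is \<open>refine_funpow_affine\<close> in the limit.\<close>

lemma \<Phi>_self_similar:
  assumes "0 \<le> t" "t < 1"
  shows "\<Phi> ((of_int a + t) / real n ^ m) = G m a + (G m (a + 1) - G m a) * grid_limit n of_int t"
proof (rule LIMSEQ_unique[OF LIMSEQ_G_shift[of m]])
  interpret U: nadic_grid n of_int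
    by unfold_locales (use n dyadic_grid_of_int in auto)
  have "G (m + k) \<lfloor>real n ^ (m + k) * ((of_int a + t) / real n ^ m)\<rfloor> =
      G m a + (G m (a + 1) - G m a) * U.G k \<lfloor>real n ^ k * t\<rfloor>" for k
  proof -
    define b where "b = \<lfloor>real n ^ k * t\<rfloor>"
    have "real n ^ k * t \<le> real n ^ k * 1" using assms by (intro mult_left_mono) auto
    then have "b \<le> \<lfloor>real n ^ k\<rfloor>" unfolding b_def by (intro floor_mono) simp
    also have "\<lfloor>real n ^ k\<rfloor> = int n ^ k" by (metis floor_of_nat of_nat_power)
    finally have b: "0 \<le> b" "b \<le> int n ^ k" using assms by (auto simp: b_def)
    have "real n ^ (m + k) * ((of_int a + t) / real n ^ m) = of_int (a * int n ^ k) + real n ^ k * t"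
      using n_pos by (simp add: power_add field_simps)
    then have "\<lfloor>real n ^ (m + k) * ((of_int a + t) / real n ^ m)\<rfloor> = a * int n ^ k + b"
      unfolding b_def by (simp only: floor_add_int[symmetric] add.commute)
    then show ?thesis
      using refine_funpow_affine[OF n_pos b, of "G m" a] b_def
      by (simp only: funpow_add add.commute[of m k] comp_apply)
  qed
  then show "(\<lambda>k. G (m + k) \<lfloor>real n ^ (m + k) * ((of_int a + t) / real n ^ m)\<rfloor>)
      \<longlonglongrightarrow> G m a + (G m (a + 1) - G m a) * grid_limit n of_int t"
    using U.LIMSEQ_G[of t] by (auto intro!: tendsto_intros)
qed

text \<open>With \<open>c = z / n ^ (m - k)\<close>, the point \<open>(a + t) / n ^ m\<close> goes
  to \<open>(a + z + t) / n ^ (m - k)\<close>, which has the same coordinate \<open>t\<close> in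
  another cell. By self-similarity both values of \<open>\<Phi>\<close> are dyadic rescalings of one
  number. The claim holds from some level on, so finitely many maps admit a common level.\<close>

lemma \<Phi>_affine:
  assumes "c \<in> n_adic n"
  shows "\<forall>\<^sub>F m in sequentially. \<forall>a. \<exists>(k'::int) c'.
    \<forall>x\<in>{of_int a / real n ^ m..<of_int (a + 1) / real n ^ m}.
      \<Phi> (real n powi k * x + c) = 2 powi k' * \<Phi> x + c'"
proof -
  obtain l where l: "\<And>m. m \<ge> l \<Longrightarrow> \<exists>a::int. c = of_int a / real n ^ m"
    using n_adicE_level[OF assms n_pos] by blast
  show ?thesis
    unfolding eventually_sequentially
  proof (rule exI, intro allI impI)
    fix m :: nat and a :: int
    \<comment> \<open>This makes \<open>m - k\<close> a natural number at least \<open>l\<close>, a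
      level at which \<open>c\<close> is a grid point.\<close>
    assume m: "l + nat \<bar>k\<bar> \<le> m"
    define m' where "m' = nat (int m - k)"
    have m': "m' \<ge> l" "int m' = int m - k" using m by (auto simp: m'_def)
    obtain z :: int where z: "c = of_int z / real n ^ m'" using l[OF m'(1)] by blast
    have nk: "real n powi k = real n ^ m / real n ^ m'"
    proof -
      have "k = int m - int m'" using m' by simp
      then show ?thesis using n_pos by (simp only:) (simp add: power_int_diff)
    qed
    obtain e where e: "G m (a + 1) - G m a = 1 / 2 ^ e"
      by (rule dyadic_gridE[OF dyadic_grid_G, of m a]) (simp add: add_divide_distrib)
    obtain e' where e': "G m' (a + z + 1) - G m' (a + z) = 1 / 2 ^ e'"
      by (rule dyadic_gridE[OF dyadic_grid_G, of m' "a + z"]) (simp add: add_divide_distrib)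
    have ee: "2 powi (int e - int e') * y / 2 ^ e = y / 2 ^ e'" for y :: real
      by (simp add: power_int_diff)
    have "\<Phi> (real n powi k * x + c) = 2 powi (int e - int e') * \<Phi> x +
        (G m' (a + z) - 2 powi (int e - int e') * G m a)"
      if x: "x \<in> {of_int a / real n ^ m..<of_int (a + 1) / real n ^ m}" for x
    proof -
      define t where "t = real n ^ m * x - of_int a"
      have t: "0 \<le> t" "t < 1" using x n_pos by (auto simp: t_def field_simps)
      have x_eq: "x = (of_int a + t) / real n ^ m" using n_pos by (simp add: t_def)
      have "real n powi k * x + c = (of_int (a + z) + t) / real n ^ m'"
        using n_pos unfolding nk z x_eq by (simp add: field_simps)
      then show ?thesis
        using \<Phi>_self_similar[OF t, of a m] \<Phi>_self_similar[OF t, of "a + z" m'] e e' x_eq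
        by (simp add: distrib_left ee)
    qed
    then show "\<exists>(k'::int) c'. \<forall>x\<in>{of_int a / real n ^ m..<of_int (a + 1) / real n ^ m}.
        \<Phi> (real n powi k * x + c) = 2 powi k' * \<Phi> x + c'"
      by blast
  qed
qed

end

section \<open>Periodic grids and the resulting bijection of the line\<close>

lemma refine_shift:
  assumes "r > 0"
  shows "refine r of_int (a + int r) = refine r of_int a + 1"
  using assms by (simp add: refine_def algebra_simps)

lemma refine_funpow_shift:
  assumes "n > 0" "\<And>a. s (a + d) = s a + (1::real)"
  shows "(refine n ^^ m) s (a + d * int n ^ m) = (refine n ^^ m) s a + 1"
proof (induction m arbitrary: a)
  case (Suc m)
  have *: "a + d * int n ^ Suc m = a + int n * (d * int n ^ m)" by simp
  have "(a + d * int n ^ Suc m) div int n = a div int n + d * int n ^ m"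
    "(a + d * int n ^ Suc m) mod int n = a mod int n"
    unfolding * using assms(1) by simp_all
  then show ?case
    using Suc.IH[of "a div int n"] Suc.IH[of "a div int n + 1"] by (simp add: refine_def algebra_simps)
qed (use assms in simp)

locale thompson_conj =
  fixes n r :: nat
  assumes n: "n \<ge> 2" and r: "r \<ge> 1"

text \<open>Each unit interval is first cut into \<open>r\<close> cells, so that \<open>r\<close>
  steps of the initial grid make one unit; this sends \<open>[0, r)\<close> to \<open>[0, 1)\<close>
  and makes \<open>\<Phi>\<close> compatible with the periods of both circles.\<close>

sublocale thompson_conj \<subseteq> nadic_grid n "refine r of_int"
proof
  show "dyadic_grid 0 (refine r of_int)"
    using dyadic_grid_refine[OF _ dyadic_grid_of_int, of r] r
    by (auto simp: dyadic_grid_def split: if_splits) (meson le0)+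
qed (rule n)

context thompson_conj begin

lemma G_shift: "G m (a + int r * int n ^ m) = G m a + 1"
  by (rule refine_funpow_shift[OF n_pos]) (use refine_shift r in auto)

lemma \<Phi>_shift_nat: "\<Phi> (x + real r * real j) = \<Phi> x + real j"
proof (induction j)
  case (Suc j)
  have "\<Phi> (x + real r) = \<Phi> x + 1" for x
  proof (rule LIMSEQ_unique[OF LIMSEQ_G])
    have "\<lfloor>real n ^ m * (x + real r)\<rfloor> = \<lfloor>real n ^ m * x\<rfloor> + int r * int n ^ m" for m
    proof -
      have "real n ^ m * (x + real r) = real n ^ m * x + of_int (int r * int n ^ m)"
        by (simp add: algebra_simps)
      then show ?thesis by (simp only: floor_add_int)
    qed
    then show "(\<lambda>m. G m \<lfloor>real n ^ m * (x + real r)\<rfloor>) \<longlonglongrightarrow> \<Phi> x + 1"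
      by (simp only: G_shift) (intro tendsto_intros LIMSEQ_G)
  qed
  from this[of "x + real r * real j"] show ?case using Suc by (simp add: algebra_simps)
qed simp

lemma \<Phi>_shift: "\<Phi> (x + real r * of_int j) = \<Phi> x + of_int j"
proof (cases "j \<ge> 0")
  case True
  then show ?thesis using \<Phi>_shift_nat[of x "nat j"] by simp
next
  case False
  then show ?thesis using \<Phi>_shift_nat[of "x + real r * of_int j" "nat (- j)"] by simp
qed

lemma \<Phi>_0 [simp]: "\<Phi> 0 = 0"
  using \<Phi>_grid[of 0 0] by (simp add: refine_def)

lemma \<Phi>_r [simp]: "\<Phi> (real r) = 1"
  using \<Phi>_shift[of 0 1] by simp

text \<open>By periodicity the grid is unbounded in both directions, and the cell is found from the
  largest index \<open>a\<close> with \<open>G m a \<le> y\<close>.\<close>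

lemma ex_cell: "\<exists>a. G m a \<le> y \<and> y < G m (a + 1)"
proof -
  define A where "A = {a. G m a \<le> y}"
  have per: "G m (a + int r * int n ^ m * int j) = G m a + real j" for a j
  proof (induction j)
    case (Suc j)
    show ?case using G_shift[of m "a + int r * int n ^ m * int j"] Suc by (simp add: algebra_simps)
  qed simp
  obtain j where j: "\<bar>y\<bar> + \<bar>G m 0\<bar> < real j" using reals_Archimedean2 by blast
  define z where "z = - (int r * int n ^ m * int j)"
  have "G m z = G m 0 - real j" using per[of z j] by (simp add: z_def)
  then have low: "G m z \<le> y" using j by linarith
  define w where "w = int r * int n ^ m * int j"
  have "y < G m w" using per[of 0 j] j by (simp add: w_def)
  then have up: "a < w" if "G m a \<le> y" for a using that G_less_iff[of m a w] by linarith
  have fin: "finite {a. z \<le> a \<and> G m a \<le> y}"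
    by (rule finite_subset[of _ "{z..w}"]) (auto dest: up)
  define a where "a = Max {a. z \<le> a \<and> G m a \<le> y}"
  have a: "a \<in> {a. z \<le> a \<and> G m a \<le> y}"
    unfolding a_def by (rule Max_in[OF fin]) (use low in auto)
  have "\<not> G m (a + 1) \<le> y"
  proof
    assume "G m (a + 1) \<le> y"
    then have "a + 1 \<le> a" using a fin unfolding a_def by (intro Max_ge) auto
    then show False by simp
  qed
  then show ?thesis using a by (intro exI[of _ a]) auto
qed

text \<open>The preimage of \<open>y\<close> is the common point of the \<open>n\<close>-adic cells
  whose images contain \<open>y\<close>; these images have length at most \<open>1 / 2 ^ m\<close>,
  so \<open>\<Phi> x\<close> cannot differ from \<open>y\<close>.\<close>

lemma surj_\<Phi>: "surj \<Phi>"
proof -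
  have "\<exists>x. y = \<Phi> x" for y
  proof -
    obtain c where c: "\<And>m. G m (c m) \<le> y" "\<And>m. y < G m (c m + 1)"
      using ex_cell[of _ y] by metis
    \<comment> \<open>Any left end lies below any right end, across levels, because their images
      enclose \<open>y\<close>.\<close>
    have nest: "of_int (c m) / real n ^ m \<le> of_int (c k + 1) / real n ^ k" for m k
    proof -
      have "\<Phi> (of_int (c m) / real n ^ m) < \<Phi> (of_int (c k + 1) / real n ^ k)"
        using c(1)[of m] c(2)[of k] unfolding \<Phi>_grid by linarith
      then show ?thesis by (simp add: \<Phi>_less_iff)
    qed
    define x where "x = (SUP m. of_int (c m) / real n ^ m)"
    have "of_int (c m) / real n ^ m \<le> x" for m
      unfolding x_def by (intro cSUP_upper bdd_aboveI2[of _ _ "of_int (c 0 + 1) / real n ^ 0"] nest) auto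
    moreover have "x \<le> of_int (c m + 1) / real n ^ m" for m
      unfolding x_def by (intro cSUP_least nest) auto
    ultimately have "\<Phi> (of_int (c m) / real n ^ m) \<le> \<Phi> x" "\<Phi> x \<le> \<Phi> (of_int (c m + 1) / real n ^ m)" for m
      by (simp_all only: \<Phi>_le_iff)
    then have b: "G m (c m) \<le> \<Phi> x" "\<Phi> x \<le> G m (c m + 1)" for m
      by (simp_all only: \<Phi>_grid)
    have "\<bar>y - \<Phi> x\<bar> \<le> 1 / 2 ^ m" for m
      using b[of m] c[of m] dyadic_grid_step_le[OF dyadic_grid_G, of m "c m"] by linarith
    moreover have "(\<lambda>m. 1 / 2 ^ m :: real) \<longlonglongrightarrow> 0"
      using LIMSEQ_power_zero[of "1/2 :: real"] by (simp add: power_one_over)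
    ultimately have "\<bar>y - \<Phi> x\<bar> \<le> 0" by (intro LIMSEQ_le_const[of _ 0]) auto
    then show ?thesis by (intro exI[of _ x]) simp
  qed
  then show ?thesis by (auto simp: surj_def)
qed

lemma bij_\<Phi>: "bij \<Phi>"
  using strict_mono_\<Phi> surj_\<Phi> by (simp add: bij_def strict_mono_imp_inj_on)

text \<open>For the second inclusion, a multiple \<open>y\<close> of \<open>1 / 2 ^ k\<close> lies
  in a half-open cell of length \<open>1 / 2 ^ e\<close> with \<open>e \<ge> k\<close>. The only
  multiple of \<open>1 / 2 ^ e\<close> in this cell is its left end, a grid point.\<close>

lemma \<Phi>_n_adic: "\<Phi> ` n_adic n = n_adic 2"
proof
  show "\<Phi> ` n_adic n \<subseteq> n_adic 2"
    using dyadic_grid_n_adic[OF dyadic_grid_G] by (auto simp: n_adic_def[of n] \<Phi>_grid)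
next
  show "n_adic 2 \<subseteq> \<Phi> ` n_adic n"
  proof
    fix y assume "y \<in> n_adic 2"
    then obtain b :: int and k where y: "y = of_int b / 2 ^ k" by (auto simp: n_adic_def)
    obtain a where a: "G k a \<le> y" "y < G k (a + 1)" using ex_cell by blast
    obtain q :: int and e where e: "e \<ge> k" "G k a = of_int q / 2 ^ e" "G k (a + 1) = of_int (q + 1) / 2 ^ e"
      using dyadic_gridE[OF dyadic_grid_G] .
    have y': "y = of_int (b * 2 ^ (e - k)) / 2 ^ e"
    proof -
      have "(2::real) ^ e = 2 ^ k * 2 ^ (e - k)" using e(1) by (simp flip: power_add)
      then show ?thesis using y by simp
    qed
    have "of_int q \<le> (of_int (b * 2 ^ (e - k)) :: real)" "of_int (b * 2 ^ (e - k)) < (of_int (q + 1) :: real)"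
      using a unfolding e y' by (simp_all only: divide_le_cancel divide_less_cancel) auto
    then have "q = b * 2 ^ (e - k)" by linarith
    then have "y = \<Phi> (of_int a / real n ^ k)" using e(2) y' by (simp only: \<Phi>_grid)
    then show "y \<in> \<Phi> ` n_adic n" by (auto intro: n_adicI)
  qed
qed

end

section \<open>Conjugation\<close>

text \<open>The restriction to \<open>S'\<close> makes the conjugate extensional, as elements of
  \<open>Bij S'\<close> must be; inverting on \<open>S\<close> alone allows maps that are bijective
  only there.\<close>

definition conj_by :: "('a \<Rightarrow> 'b) \<Rightarrow> 'a set \<Rightarrow> 'b set \<Rightarrow> ('a \<Rightarrow> 'a) \<Rightarrow> 'b \<Rightarrow> 'b" where
  "conj_by \<phi> S S' f = (\<lambda>y\<in>S'. \<phi> (f (inv_into S \<phi> y)))"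

lemma conj_by_apply:
  assumes "bij_betw \<phi> S S'" "x \<in> S"
  shows "conj_by \<phi> S S' f (\<phi> x) = \<phi> (f x)"
  using assms by (simp add: conj_by_def bij_betw_inv_into_left bij_betwE)

lemma conj_by_Bij:
  assumes \<phi>: "bij_betw \<phi> S S'" and f: "f \<in> Bij S"
  shows "conj_by \<phi> S S' f \<in> Bij S'"
proof -
  have "bij_betw (\<phi> \<circ> (f \<circ> inv_into S \<phi>)) S' S'"
    using \<phi> f bij_betw_inv_into[OF \<phi>] by (intro bij_betw_trans) (auto simp: Bij_def)
  then have "bij_betw (conj_by \<phi> S S' f) S' S'"
    by (rule iffD1[OF bij_betw_cong, rotated]) (simp add: conj_by_def)
  then show ?thesis by (simp add: Bij_def conj_by_def)
qed

lemma conj_by_compose: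
  assumes \<phi>: "bij_betw \<phi> S S'" and f: "f \<in> Bij S"
  shows "conj_by \<phi> S S' (compose S g f) = compose S' (conj_by \<phi> S S' g) (conj_by \<phi> S S' f)"
proof
  fix y
  show "conj_by \<phi> S S' (compose S g f) y = compose S' (conj_by \<phi> S S' g) (conj_by \<phi> S S' f) y"
  proof (cases "y \<in> S'")
    case True
    then obtain x where "x \<in> S" "y = \<phi> x" using \<phi> by (auto simp: bij_betw_def)
    then show ?thesis
      using True f by (simp add: compose_eq conj_by_apply[OF \<phi>] Bij_mem)
  qed (simp add: conj_by_def compose_def)
qed

lemma conj_by_inj:
  assumes \<phi>: "bij_betw \<phi> S S'" and "f \<in> Bij S" "g \<in> Bij S" "conj_by \<phi> S S' f = conj_by \<phi> S S' g"
  shows "f = g"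
proof
  fix x
  show "f x = g x"
  proof (cases "x \<in> S")
    case True
    then have "\<phi> (f x) = \<phi> (g x)" using assms(4) by (metis conj_by_apply[OF \<phi>])
    then show ?thesis
      using True assms by (meson Bij_mem bij_betw_def inj_onD)
  next
    case False
    then show ?thesis using assms(2,3) by (auto simp: Bij_def extensional_def)
  qed
qed

lemma perm_group_monI:
  assumes "\<And>f. f \<in> Bij S \<Longrightarrow> P f \<Longrightarrow> h f \<in> Bij S' \<and> Q (h f)"
    and "\<And>f g. f \<in> Bij S \<Longrightarrow> P f \<Longrightarrow> g \<in> Bij S \<Longrightarrow> P g \<Longrightarrow> h (compose S g f) = compose S' (h g) (h f)"
    and "\<And>f g. f \<in> Bij S \<Longrightarrow> P f \<Longrightarrow> g \<in> Bij S \<Longrightarrow> P g \<Longrightarrow> h f = h g \<Longrightarrow> f = g"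
  shows "h \<in> mon (perm_group S P) (perm_group S' Q)"
  unfolding mon_def hom_def inj_on_def using assms
  by (auto simp: carrier_perm_group mult_perm_group)

lemma mon_conj_by:
  assumes "bij_betw \<phi> S S'" "\<And>f. f \<in> Bij S \<Longrightarrow> P f \<Longrightarrow> Q (conj_by \<phi> S S' f)"
  shows "conj_by \<phi> S S' \<in> mon (perm_group S P) (perm_group S' Q)"
proof (rule perm_group_monI)
  show "conj_by \<phi> S S' f \<in> Bij S' \<and> Q (conj_by \<phi> S S' f)" if "f \<in> Bij S" "P f" for f
    using assms(2)[OF that] conj_by_Bij[OF assms(1) that(1)] by simp
qed (simp_all only: conj_by_compose[OF assms(1)], rule conj_by_inj[OF assms(1)])

lemma mon_compose:
  assumes "h \<in> mon G H" "k \<in> mon H K"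
  shows "k \<circ> h \<in> mon G K"
proof -
  have "inj_on k (h ` carrier G)"
    using assms by (auto simp: mon_def hom_def intro: inj_on_subset)
  then show ?thesis
    using assms by (auto simp: mon_def intro: hom_compose comp_inj_on)
qed

lemma conj_by_preserves:
  assumes \<phi>: "bij_betw \<phi> S S'" and "D \<subseteq> S" "f ` D = D"
  shows "conj_by \<phi> S S' f ` (\<phi> ` D) = \<phi> ` D"
proof -
  have "conj_by \<phi> S S' f ` (\<phi> ` D) = \<phi> ` (f ` D)"
    using assms(2) by (auto simp: image_image conj_by_apply[OF \<phi>] subset_iff)
  then show ?thesis using assms(3) by simp
qed

text \<open>A monotone map onto the whole line has no jumps, hence is continuous, and the same
  applies to its inverse.\<close>

lemma strict_mono_surj_inv:
  fixes f :: "real \<Rightarrow> real"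
  assumes "strict_mono f" "surj f"
  shows "continuous_on UNIV f" "strict_mono (inv_into UNIV f)" "surj (inv_into UNIV f)" "continuous_on UNIV (inv_into UNIV f)"
    "f (inv_into UNIV f y) = y" "inv_into UNIV f (f x) = x"
proof -
  have cont: "continuous_on UNIV g" if "strict_mono g" "surj g" for g :: "real \<Rightarrow> real"
    using that by (intro continuous_onI_mono) (auto simp: strict_mono_less_eq)
  show inv: "f (inv_into UNIV f y) = y" "inv_into UNIV f (f x) = x" for x y
    using assms strict_mono_imp_inj_on[of f UNIV] by (simp_all add: surj_f_inv_f)
  show "strict_mono (inv_into UNIV f)"
    by (rule strict_monoI) (metis assms(1) inv(1) strict_mono_less)
  moreover show "surj (inv_into UNIV f)" using inv(2) by (metis surjI)
  ultimately show "continuous_on UNIV (inv_into UNIV f)" by (rule cont)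
  show "continuous_on UNIV f" using assms by (rule cont)
qed

text \<open>In the quotient topology openness is tested on the line, where \<open>g\<close> becomes
  the homeomorphism \<open>\<psi>\<close>.\<close>

lemma homeomorphic_map_circle_lift:
  assumes g: "g \<in> Bij (circle r)" and \<psi>: "strict_mono \<psi>" "surj \<psi>"
    and lift: "\<And>y. g (circle_pt r y) = circle_pt r (\<psi> y)"
  shows "homeomorphic_map (circle_topology r) (circle_topology r) g"
  unfolding homeomorphic_map_def quotient_map_def topspace_circle_topology
proof (intro conjI allI impI)
  note inv = strict_mono_surj_inv[OF \<psi>]
  show "g ` circle r = circle r" "inj_on g (circle r)"
    using g by (auto simp: Bij_def bij_betw_def)
  fix U assume U: "U \<subseteq> circle r"
  define W where "W = circle_pt r -` U"
  have "circle_pt r -` {x \<in> circle r. g x \<in> U} = \<psi> -` W" by (auto simp: lift W_def)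
  moreover have "open (\<psi> -` W) \<longleftrightarrow> open W"
  proof
    assume "open (\<psi> -` W)"
    then have "open (inv_into UNIV \<psi> -` (\<psi> -` W))" by (rule open_vimage[OF _ inv(4)])
    also have "inv_into UNIV \<psi> -` (\<psi> -` W) = W" by (auto simp: inv)
    finally show "open W" .
  qed (rule open_vimage[OF _ inv(1)])
  ultimately show "openin (circle_topology r) {x \<in> circle r. g x \<in> U} \<longleftrightarrow> openin (circle_topology r) U"
    unfolding openin_circle_topology W_def using U by simp
qed

section \<open>Cells and piecewise affine maps\<close>

lemma finite_n_adic_level:
  assumes "finite B" "B \<subseteq> n_adic n" "n > 0"
  shows "\<forall>\<^sub>F m in sequentially. \<forall>b\<in>B. \<exists>a::int. b = of_int a / real n ^ m"
proof (intro eventually_ball_finite[OF assms(1)] ballI)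
  fix b assume "b \<in> B"
  then obtain k where "\<And>m. m \<ge> k \<Longrightarrow> \<exists>a::int. b = of_int a / real n ^ m"
    using n_adicE_level[of b n] assms by blast
  then show "\<forall>\<^sub>F m in sequentially. \<exists>a::int. b = of_int a / real n ^ m"
    unfolding eventually_sequentially by blast
qed

text \<open>The first subdivision point of the cell will do. Such points serve to show that the
  constants of affine pieces lie in Z[1/n].\<close>

lemma cell_interior_n_adic:
  assumes "n \<ge> 2"
  obtains x where "x \<in> n_adic n" "x \<in> {of_int a / real n ^ m<..<of_int (a + 1) / real n ^ m}"
proof -
  have "of_int (a * int n + 1) / real n ^ Suc m \<in> {of_int a / real n ^ m<..<of_int (a + 1) / real n ^ m}"
    using assms by (simp add: field_simps)
  then show ?thesis using that n_adicI[of _ "a * int n + 1" n "Suc m"] by blast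
qed

lemma div_in_range:
  fixes a N d :: int
  assumes "0 \<le> a" "a < N * d" "d > 0"
  shows "a div d \<in> {0..<N}"
proof -
  have "a div d * d \<le> a" using pos_mod_sign[OF assms(3), of a] div_mult_mod_eq[of a d] by linarith
  then have "a div d * d < N * d" using assms(2) by linarith
  then have "a div d < N" using assms(3) by simp
  then show ?thesis using assms by (simp add: pos_imp_zdiv_nonneg_iff)
qed

text \<open>The integer quotient is the index of the ancestor of the cell \<open>a\<close> at the
  coarser level.\<close>

lemma coarser_cell:
  assumes "n > 0" "m0 \<le> m"
  shows "{of_int a / real n ^ m<..<of_int (a + 1) / real n ^ m} \<subseteq>
    {of_int (a div int n ^ (m - m0)) / real n ^ m0<..<of_int (a div int n ^ (m - m0) + 1) / real n ^ m0}"
proof -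
  define d b where "d = int n ^ (m - m0)" and "b = a div d"
  have d: "d > 0" using assms(1) by (simp add: d_def)
  have "a = b * d + a mod d" by (simp add: b_def)
  then have "b * d \<le> a" "a < (b + 1) * d"
    using pos_mod_sign[OF d, of a] pos_mod_bound[OF d, of a]
    unfolding distrib_right mult_1 by linarith+
  then have "b * d \<le> a" "a + 1 \<le> (b + 1) * d" by simp_all
  then have le: "of_int (b * d) \<le> (of_int a :: real)" "(of_int (a + 1) :: real) \<le> of_int ((b + 1) * d)"
    by (simp_all only: of_int_le_iff)
  have nm: "real n ^ m = real n ^ m0 * of_int d"
    using assms(2) by (simp add: d_def flip: power_add)
  have eq: "of_int z / real n ^ m0 = of_int (z * d) / real n ^ m" for z
    using d unfolding nm by simp
  have "of_int b / real n ^ m0 \<le> of_int a / real n ^ m" "of_int (a + 1) / real n ^ m \<le> of_int (b + 1) / real n ^ m0"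
    unfolding eq using le by (simp_all only: divide_right_mono zero_le_power of_nat_0_le_iff)
  then show ?thesis unfolding b_def d_def by auto
qed

context thompson_conj begin

abbreviation \<Psi> :: "real \<Rightarrow> real" where
  "\<Psi> \<equiv> inv_into UNIV \<Phi>"

text \<open>Each of the finitely many pieces becomes affine after conjugation from some level on;
  \<open>m\<close> suits all of them, and a cell of level \<open>m\<close> inherits the piece of its
  ancestor. On intervals \<open>R x z\<close> stands for \<open>f x = z\<close>; on the circle it
  says that \<open>z\<close> lifts the image of the point below \<open>x\<close>.\<close>

lemma cells_affine:
  fixes A :: "int set" and R :: "real \<Rightarrow> real \<Rightarrow> bool"
  assumes A: "finite A"
    and R: "\<And>a. a \<in> A \<Longrightarrow> \<exists>(k::int). \<exists>c\<in>n_adic n.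
      \<forall>x\<in>{of_int a / real n ^ m0<..<of_int (a + 1) / real n ^ m0}. R x (real n powi k * x + c)"
  obtains m where "m \<ge> m0"
    "\<And>a. a div int n ^ (m - m0) \<in> A \<Longrightarrow> \<exists>(k::int) c.
      \<forall>x\<in>{of_int a / real n ^ m<..<of_int (a + 1) / real n ^ m}. \<exists>z. R x z \<and> \<Phi> z = 2 powi k * \<Phi> x + c"
proof -
  obtain k :: "int \<Rightarrow> int" and c where kc: "\<And>a. a \<in> A \<Longrightarrow> c a \<in> n_adic n"
    "\<And>a x. a \<in> A \<Longrightarrow> x \<in> {of_int a / real n ^ m0<..<of_int (a + 1) / real n ^ m0} \<Longrightarrow>
      R x (real n powi k a * x + c a)"
    using R by metis
  have "\<forall>\<^sub>F m in sequentially. m0 \<le> m \<and> (\<forall>b\<in>A. \<forall>a. \<exists>(k'::int) c'.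
      \<forall>x\<in>{of_int a / real n ^ m..<of_int (a + 1) / real n ^ m}.
        \<Phi> (real n powi k b * x + c b) = 2 powi k' * \<Phi> x + c')"
    by (intro eventually_conj eventually_ge_at_top eventually_ball_finite A ballI \<Phi>_affine kc)
  then obtain m where m: "m0 \<le> m" "\<And>a b. b \<in> A \<Longrightarrow> \<exists>(k'::int) c'.
      \<forall>x\<in>{of_int a / real n ^ m..<of_int (a + 1) / real n ^ m}.
        \<Phi> (real n powi k b * x + c b) = 2 powi k' * \<Phi> x + c'"
    unfolding eventually_sequentially by blast
  show ?thesis
  proof (rule that[OF m(1)])
    fix a assume a: "a div int n ^ (m - m0) \<in> A"
    define b where "b = a div int n ^ (m - m0)"
    obtain k' :: int and c' where "\<forall>x\<in>{of_int a / real n ^ m..<of_int (a + 1) / real n ^ m}.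
        \<Phi> (real n powi k b * x + c b) = 2 powi k' * \<Phi> x + c'"
      using m(2)[of b a] a unfolding b_def by blast
    moreover have "R x (real n powi k b * x + c b)"
      if "x \<in> {of_int a / real n ^ m<..<of_int (a + 1) / real n ^ m}" for x
      using kc(2)[OF a, of x] that coarser_cell[OF n_pos m(1), of a] unfolding b_def by blast
    ultimately have "\<forall>x\<in>{of_int a / real n ^ m<..<of_int (a + 1) / real n ^ m}.
        \<exists>z. R x z \<and> \<Phi> z = 2 powi k' * \<Phi> x + c'"
      by (meson atLeastLessThan_iff greaterThanLessThan_iff less_imp_le)
    then show "\<exists>(k::int) c. \<forall>x\<in>{of_int a / real n ^ m<..<of_int (a + 1) / real n ^ m}.
        \<exists>z. R x z \<and> \<Phi> z = 2 powi k * \<Phi> x + c"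
      by blast
  qed
qed

text \<open>The ends of the cell around the midpoint are grid points, hence outside the
  interval.\<close>

lemma interval_in_cell:
  assumes "u < v" "{u<..<v} \<inter> range (G m) = {}"
  obtains a where "{u<..<v} \<subseteq> {G m a<..<G m (a + 1)}"
proof -
  obtain a where a: "G m a \<le> (u + v) / 2" "(u + v) / 2 < G m (a + 1)"
    using ex_cell by blast
  have "G m a \<notin> {u<..<v}" "G m (a + 1) \<notin> {u<..<v}" using assms(2) by blast+
  then have "G m a \<le> u" "v \<le> G m (a + 1)" using a assms(1) by auto
  then have "{u<..<v} \<subseteq> {G m a<..<G m (a + 1)}" by auto
  then show ?thesis by (rule that)
qed

lemma \<Phi>_cell: "\<Phi> x \<in> {G m a<..<G m (a + 1)} \<longleftrightarrow> x \<in> {of_int a / real n ^ m<..<of_int (a + 1) / real n ^ m}"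
  unfolding \<Phi>_grid[symmetric] greaterThanLessThan_iff \<Phi>_less_iff ..

lemma G_N: "G m (int r * int n ^ m) = 1"
  using G_shift[of m 0] \<Phi>_grid[of 0 m] by simp

lemma G_0: "G m 0 = 0"
  using \<Phi>_grid[of 0 m] by simp

text \<open>The bounds on \<open>S\<close> cover both \<open>[0, r]\<close> and
  \<open>[0, r)\<close>. The breakpoints of \<open>f\<close> sit on a grid of level
  \<open>m0\<close>; the conjugate breaks at most at the images of a finer grid, which are
  dyadic.\<close>

lemma pw_affine_conj_by:
  assumes S: "{0..<real r} \<subseteq> S" "S \<subseteq> {0..real r}" and S': "S' \<subseteq> {0..1}" and bij: "bij_betw \<Phi> S S'"
    and pf: "pw_affine n S f" and Df: "f ` (n_adic n \<inter> S) = n_adic n \<inter> S"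
  shows "pw_affine 2 S' (conj_by \<Phi> S S' f)"
proof -
  obtain B where B: "finite B" "B \<subseteq> n_adic n" and
    Bf: "\<And>a b. {a<..<b} \<subseteq> S - B \<Longrightarrow> \<exists>(k::int) c. \<forall>x\<in>{a<..<b}. f x = real n powi k * x + c"
    using pf unfolding pw_affine_def by blast
  obtain m0 where m0: "\<And>b. b \<in> B \<Longrightarrow> \<exists>a::int. b = of_int a / real n ^ m0"
    using finite_n_adic_level[OF B n_pos] unfolding eventually_sequentially by blast
  define A where "A = {0..<int r * int n ^ m0}"
  have "\<exists>(k::int). \<exists>c\<in>n_adic n. \<forall>x\<in>{of_int a / real n ^ m0<..<of_int (a + 1) / real n ^ m0}.
      f x = real n powi k * x + c" if a: "a \<in> A" for a
  proof -
    define I where "I = {of_int a / real n ^ m0<..<of_int (a + 1) / real n ^ m0}"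
    have "a + 1 \<le> int r * int n ^ m0" using a by (simp add: A_def)
    then have "of_int (a + 1) \<le> (of_int (int r * int n ^ m0) :: real)" by (simp only: of_int_le_iff)
    then have "of_int (a + 1) / real n ^ m0 \<le> real r" using n_pos by (simp add: field_simps)
    moreover have "0 \<le> of_int a / real n ^ m0" using a by (simp add: A_def)
    ultimately have IS: "I \<subseteq> S" using S(1) unfolding I_def by (force simp: subset_iff)
    moreover have "x \<notin> B" if "x \<in> I" for x
    proof
      assume "x \<in> B"
      then obtain b :: int where "x = of_int b / real n ^ m0" using m0 by blast
      then have "of_int a < (of_int b :: real)" "of_int b < (of_int (a + 1) :: real)"
        using that n_pos unfolding I_def by (simp_all add: divide_less_cancel)
      then show False by simp
    qed
    ultimately have "I \<subseteq> S - B" by blast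
    then obtain k c where kc: "\<forall>x\<in>I. f x = real n powi k * x + c"
      using Bf unfolding I_def by blast
    \<comment> \<open>An \<open>n\<close>-adic interior point and its \<open>n\<close>-adic image
      determine \<open>c\<close>, which is therefore \<open>n\<close>-adic, as
      \<open>\<Phi>_affine\<close> demands.\<close>
    obtain x where x: "x \<in> n_adic n" "x \<in> I"
      using cell_interior_n_adic[OF n] unfolding I_def by blast
    then have "f x \<in> n_adic n" using Df IS by blast
    then have "f x - real n powi k * x \<in> n_adic n"
      using x n_pos by (intro n_adic_diff n_adic_mult n_adic_powi)
    then have "c \<in> n_adic n" using kc x by simp
    then show ?thesis using kc unfolding I_def by blast
  qed
  then obtain m where m: "m \<ge> m0" "\<And>a. a div int n ^ (m - m0) \<in> A \<Longrightarrow> \<exists>(k::int) c.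
      \<forall>x\<in>{of_int a / real n ^ m<..<of_int (a + 1) / real n ^ m}. \<exists>z. f x = z \<and> \<Phi> z = 2 powi k * \<Phi> x + c"
    using cells_affine[of A m0 "\<lambda>x z. f x = z"] unfolding A_def by blast
  have nm: "int r * int n ^ m = int r * int n ^ m0 * int n ^ (m - m0)"
    using m(1) by (simp add: mult.assoc flip: power_add)
  define C where "C = G m ` {0..int r * int n ^ m}"
  have C: "finite C" "C \<subseteq> n_adic 2"
    using dyadic_grid_n_adic[OF dyadic_grid_G] by (auto simp: C_def)
  have range_C: "y \<in> C" if "y \<in> {0..1}" "y \<in> range (G m)" for y
  proof -
    obtain a where a: "y = G m a" using \<open>y \<in> range (G m)\<close> by blast
    have "G m 0 \<le> G m a" "G m a \<le> G m (int r * int n ^ m)" using that(1) a by (simp_all add: G_0 G_N)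
    then show ?thesis using a unfolding C_def G_le_iff by simp
  qed
  have "\<exists>(k::int) c. \<forall>y\<in>{u<..<v}. conj_by \<Phi> S S' f y = real 2 powi k * y + c"
    if uv: "{u<..<v} \<subseteq> S' - C" for u v
  proof (cases "u < v")
    case True
    have "{u<..<v} \<inter> range (G m) = {}" using uv range_C S' by blast
    then obtain a where a: "{u<..<v} \<subseteq> {G m a<..<G m (a + 1)}"
      using interval_in_cell[OF True] by blast
    have pre: "\<exists>x\<in>S. y = \<Phi> x \<and> x \<in> {of_int a / real n ^ m<..<of_int (a + 1) / real n ^ m}"
      if "y \<in> {u<..<v}" for y
    proof -
      have "y \<in> S'" using that uv by blast
      then obtain x where "x \<in> S" "y = \<Phi> x" using bij by (auto simp: bij_betw_def)
      then show ?thesis using \<Phi>_cell[of x m a] a that by blast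
    qed
    \<comment> \<open>The preimage of the midpoint shows that the interior of the cell
      \<open>a\<close> meets \<open>[0, r]\<close>, so its index is in range and its ancestor
      belongs to \<open>A\<close>.\<close>
    have "(u + v) / 2 \<in> {u<..<v}" using True by simp
    then obtain x where x: "x \<in> S" "x \<in> {of_int a / real n ^ m<..<of_int (a + 1) / real n ^ m}"
      using pre by blast
    then have "0 \<le> x" "x \<le> real r" using S(2) by auto
    then have "0 < of_int (a + 1) / real n ^ m" "of_int a / real n ^ m < real r"
      using x(2) by auto
    then have "0 < (of_int (a + 1) :: real)" "of_int a < (of_int (int r * int n ^ m) :: real)"
      using n_pos by (auto simp: field_simps zero_less_divide_iff)
    then have "0 \<le> a" "a < int r * int n ^ m" by linarith+
    then have "a div int n ^ (m - m0) \<in> A"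
      unfolding A_def using n_pos by (intro div_in_range) (simp_all add: nm[symmetric])
    then obtain k c where kc: "\<forall>x\<in>{of_int a / real n ^ m<..<of_int (a + 1) / real n ^ m}.
        \<Phi> (f x) = 2 powi k * \<Phi> x + c"
      using m(2) by blast
    have "conj_by \<Phi> S S' f y = real 2 powi k * y + c" if "y \<in> {u<..<v}" for y
      using pre[OF that] kc by (auto simp: conj_by_apply[OF bij])
    then show ?thesis by blast
  qed auto
  then show ?thesis
    unfolding pw_affine_def using C by (intro exI[of _ C] conjI allI impI)
qed

lemma \<Phi>_image_interval: "\<Phi> ` {0..real r} = {0..1}" "\<Phi> ` {0..<real r} = {0..<1}"
proof -
  have "y \<in> {0..1} \<Longrightarrow> y \<in> \<Phi> ` {0..real r}" "y \<in> {0..<1} \<Longrightarrow> y \<in> \<Phi> ` {0..<real r}" for y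
  proof -
    obtain x where x: "y = \<Phi> x" using surj_\<Phi> by (metis surjD)
    show "y \<in> {0..1} \<Longrightarrow> y \<in> \<Phi> ` {0..real r}"
      using x \<Phi>_le_iff[of 0 x] \<Phi>_le_iff[of x "real r"] by auto
    show "y \<in> {0..<1} \<Longrightarrow> y \<in> \<Phi> ` {0..<real r}"
      using x \<Phi>_le_iff[of 0 x] \<Phi>_less_iff[of x "real r"] by auto
  qed
  moreover have "\<Phi> x \<in> {0..1}" if "x \<in> {0..real r}" for x
    using that \<Phi>_le_iff[of 0 x] \<Phi>_le_iff[of x "real r"] by auto
  moreover have "\<Phi> x \<in> {0..<1}" if "x \<in> {0..<real r}" for x
    using that \<Phi>_le_iff[of 0 x] \<Phi>_less_iff[of x "real r"] by auto
  ultimately show "\<Phi> ` {0..real r} = {0..1}" "\<Phi> ` {0..<real r} = {0..<1}" by blast+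
qed

lemma bij_betw_\<Phi>: "\<Phi> ` S = S' \<Longrightarrow> bij_betw \<Phi> S S'"
  using strict_mono_\<Phi> by (simp add: bij_betw_def strict_mono_imp_inj_on)

lemma n_adic_image: "\<Phi> ` S = S' \<Longrightarrow> n_adic 2 \<inter> S' = \<Phi> ` (n_adic n \<inter> S)"
  using bij_\<Phi> by (auto simp: image_Int[of \<Phi>] bij_def \<Phi>_n_adic)

lemma n_adic_conj_by:
  assumes "\<Phi> ` S = S'" "f ` (n_adic n \<inter> S) = n_adic n \<inter> S"
  shows "conj_by \<Phi> S S' f ` (n_adic 2 \<inter> S') = n_adic 2 \<inter> S'"
  unfolding n_adic_image[OF assms(1)]
  by (rule conj_by_preserves[OF bij_betw_\<Phi>[OF assms(1)] _ assms(2)]) simp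

section \<open>Conjugation of F and V\<close>

lemmas \<Phi>_inv = strict_mono_surj_inv[OF strict_mono_\<Phi> surj_\<Phi>]

lemma mon_thompson_F: "conj_by \<Phi> {0..real r} {0..1} \<in> mon (thompson_F n r) (thompson_F 2 1)"
  unfolding thompson_F_def of_nat_1
proof (rule mon_conj_by)
  define S where "S = {0..real r}"
  define S' where "S' = {0..1::real}"
  have im: "\<Phi> ` S = S'" unfolding S_def S'_def by (rule \<Phi>_image_interval)
  show bij: "bij_betw \<Phi> {0..real r} {0..1}"
    by (rule bij_betw_\<Phi>) (rule \<Phi>_image_interval)
  fix f assume "f \<in> Bij {0..real r}"
    "(\<exists>g. homeomorphism {0..real r} {0..real r} f g) \<and> strict_mono_on {0..real r} f \<and>
      pw_affine n {0..real r} f \<and> f ` (n_adic n \<inter> {0..real r}) = n_adic n \<inter> {0..real r}"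
  then obtain f' where f: "f \<in> Bij S" "homeomorphism S S f f'" "strict_mono_on S f" "pw_affine n S f"
    "f ` (n_adic n \<inter> S) = n_adic n \<inter> S"
    unfolding S_def[symmetric] by blast
  note app = conj_by_apply[OF bij[folded S_def S'_def]]
  have hom: "homeomorphism S S' \<Phi> (\<Psi>)"
  proof (rule homeomorphismI)
    show "continuous_on S \<Phi>" "continuous_on S' \<Psi>"
      by (rule continuous_on_subset[OF \<Phi>_inv(1)] continuous_on_subset[OF \<Phi>_inv(4)], simp)+
  qed (use im in \<open>auto simp: \<Phi>_inv\<close>)
  show "(\<exists>g. homeomorphism {0..1} {0..1} (conj_by \<Phi> {0..real r} {0..1} f) g) \<and>
      strict_mono_on {0..1} (conj_by \<Phi> {0..real r} {0..1} f) \<and>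
      pw_affine 2 {0..1} (conj_by \<Phi> {0..real r} {0..1} f) \<and>
      conj_by \<Phi> {0..real r} {0..1} f ` (n_adic 2 \<inter> {0..1}) = n_adic 2 \<inter> {0..1}"
    unfolding S_def[symmetric] S'_def[symmetric]
  proof (intro conjI)
    have "homeomorphism S' S' (\<Phi> \<circ> f \<circ> \<Psi>) (\<Phi> \<circ> (f' \<circ> \<Psi>))"
      using homeomorphism_compose[OF homeomorphism_compose[OF homeomorphism_symD[OF hom] f(2)] hom]
      by (simp add: comp_assoc)
    then have "homeomorphism S' S' (conj_by \<Phi> S S' f) (\<Phi> \<circ> (f' \<circ> \<Psi>))"
    proof (rule homeomorphism_cong)
      fix y assume "y \<in> S'"
      then obtain x where "x \<in> S" "y = \<Phi> x" using im by blast
      then show "conj_by \<Phi> S S' f y = (\<Phi> \<circ> f \<circ> \<Psi>) y" by (simp add: app \<Phi>_inv)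
    qed auto
    then show "\<exists>g. homeomorphism S' S' (conj_by \<Phi> S S' f) g" by blast
    show "strict_mono_on S' (conj_by \<Phi> S S' f)"
    proof (rule strict_mono_onI)
      fix y y' assume y: "y \<in> S'" "y' \<in> S'" "y < y'"
      then obtain x x' where "x \<in> S" "y = \<Phi> x" "x' \<in> S" "y' = \<Phi> x'" using im by blast
      then show "conj_by \<Phi> S S' f y < conj_by \<Phi> S S' f y'"
        using f(3) y(3) by (simp add: app \<Phi>_less_iff strict_mono_on_def)
    qed
    show "pw_affine 2 S' (conj_by \<Phi> S S' f)"
      using f(4,5) bij_betw_\<Phi>[OF im] by (intro pw_affine_conj_by) (auto simp: S_def S'_def)
    show "conj_by \<Phi> S S' f ` (n_adic 2 \<inter> S') = n_adic 2 \<inter> S'"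
      by (rule n_adic_conj_by[OF im f(5)])
  qed
qed

lemma mon_higman_V: "conj_by \<Phi> {0..<real r} {0..<1} \<in> mon (higman_V n r) (higman_V 2 1)"
  unfolding higman_V_def of_nat_1
proof (rule mon_conj_by)
  define S where "S = {0..<real r}"
  define S' where "S' = {0..<1::real}"
  have im: "\<Phi> ` S = S'" unfolding S_def S'_def by (rule \<Phi>_image_interval)
  show bij: "bij_betw \<Phi> {0..<real r} {0..<1}"
    by (rule bij_betw_\<Phi>) (rule \<Phi>_image_interval)
  fix f assume "f \<in> Bij {0..<real r}"
    "(\<forall>x\<in>{0..<real r}. continuous (at_right x) f) \<and>
      pw_affine n {0..<real r} f \<and> f ` (n_adic n \<inter> {0..<real r}) = n_adic n \<inter> {0..<real r}"
  then have f: "f \<in> Bij S" "\<And>x. x \<in> S \<Longrightarrow> continuous (at_right x) f" "pw_affine n S f"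
    "f ` (n_adic n \<inter> S) = n_adic n \<inter> S"
    unfolding S_def[symmetric] by blast+
  note app = conj_by_apply[OF bij[folded S_def S'_def]]
  show "(\<forall>x\<in>{0..<1}. continuous (at_right x) (conj_by \<Phi> {0..<real r} {0..<1} f)) \<and>
      pw_affine 2 {0..<1} (conj_by \<Phi> {0..<real r} {0..<1} f) \<and>
      conj_by \<Phi> {0..<real r} {0..<1} f ` (n_adic 2 \<inter> {0..<1}) = n_adic 2 \<inter> {0..<1}"
    unfolding S_def[symmetric] S'_def[symmetric]
  proof (intro conjI ballI)
    fix y assume y: "y \<in> S'"
    then obtain x where x: "x \<in> S" "y = \<Phi> x" using im by blast
    have "(\<Psi> \<longlongrightarrow> \<Psi> y) (at_right y)"
      using \<Phi>_inv(4) by (simp add: continuous_on_eq_continuous_at isCont_def filterlim_at_split)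
    moreover have "\<forall>\<^sub>F t in at_right y. \<Psi> t \<in> {x<..} \<and> \<Psi> t \<noteq> x"
      using eventually_at_right_less[of y]
      by eventually_elim (metis \<Phi>_inv(5) \<Phi>_less_iff greaterThan_iff less_irrefl x(2))
    \<comment> \<open>As \<open>\<Psi>\<close> is increasing and continuous, \<open>\<Psi> t\<close>
      approaches \<open>x\<close> from the right, without attaining it, when \<open>t\<close>
      approaches \<open>y\<close> from the right.\<close>
    ultimately have lim: "filterlim (\<Psi>) (at_right x) (at_right y)"
      using x(2) \<Phi>_inv(6) by (simp add: filterlim_at)
    have "(f \<longlongrightarrow> f x) (at_right x)" using f(2)[OF x(1)] by (simp add: continuous_within)
    moreover have "isCont \<Phi> (f x)" using \<Phi>_inv(1) by (simp add: continuous_on_eq_continuous_at)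
    ultimately have "((\<lambda>t. \<Phi> (f (\<Psi> t))) \<longlongrightarrow> \<Phi> (f x)) (at_right y)"
      using filterlim_compose[OF _ lim, of f "nhds (f x)"] by (auto intro: isCont_tendsto_compose)
    \<comment> \<open>The conjugate agrees with the composite only on \<open>S'\<close>; since
      \<open>y < 1\<close>, points slightly to the right of \<open>y\<close> still belong to
      it.\<close>
    moreover have "\<forall>\<^sub>F t in at_right y. \<Phi> (f (\<Psi> t)) = conj_by \<Phi> S S' f t"
    proof -
      have "y < 1" using y by (simp add: S'_def)
      from eventually_at_right_real[OF this] show ?thesis
      proof eventually_elim
        case (elim t)
        then have "t \<in> S'" using y by (auto simp: S'_def)
        then obtain x' where "x' \<in> S" "t = \<Phi> x'" using im by blast
        then show ?case by (simp add: app \<Phi>_inv)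
      qed
    qed
    ultimately have "(conj_by \<Phi> S S' f \<longlongrightarrow> \<Phi> (f x)) (at_right y)"
      by (rule Lim_transform_eventually)
    then show "continuous (at_right y) (conj_by \<Phi> S S' f)"
      using app[OF x(1)] x(2) by (simp add: continuous_within)
  next
    show "pw_affine 2 S' (conj_by \<Phi> S S' f)"
      using f(3,4) bij_betw_\<Phi>[OF im] by (intro pw_affine_conj_by) (auto simp: S_def S'_def)
    show "conj_by \<Phi> S S' f ` (n_adic 2 \<inter> S') = n_adic 2 \<inter> S'"
      by (rule n_adic_conj_by[OF im f(4)])
  qed
qed

text \<open>Otherwise the simplifier turns \<open>circle_pt 1\<close> into \<open>circle_pt (Suc 0)\<close>.\<close>

declare One_nat_def [simp del]

section \<open>Conjugation of T on the circle\<close>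

lemma \<Phi>_circle_pt_iff:
  "circle_pt 1 (\<Phi> x) = circle_pt 1 (\<Phi> y) \<longleftrightarrow> circle_pt r x = circle_pt r y"
proof -
  have "\<Phi> y = \<Phi> x + of_int j \<longleftrightarrow> y = x + real r * of_int j" for j
    using strict_mono_eq[OF strict_mono_\<Phi>, of y "x + real r * of_int j"] by (simp add: \<Phi>_shift)
  then show ?thesis by (simp add: circle_pt_eq_iff)
qed

text \<open>The map of circles induced by \<open>\<Phi>\<close>. All representatives give the same
  value, since \<open>\<Phi>\<close> turns shifts by multiples of \<open>r\<close> into shifts by
  integers.\<close>

definition circle_\<Phi> :: "real set \<Rightarrow> real set" where
  "circle_\<Phi> P = circle_pt 1 (\<Phi> (SOME x. P = circle_pt r x))"

lemma circle_\<Phi>_pt [simp]: "circle_\<Phi> (circle_pt r x) = circle_pt 1 (\<Phi> x)"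
  unfolding circle_\<Phi>_def by (rule someI2[of _ x]) (simp_all add: \<Phi>_circle_pt_iff)

lemma bij_betw_circle_\<Phi>: "bij_betw circle_\<Phi> (circle r) (circle 1)"
  unfolding bij_betw_def
proof
  show "inj_on circle_\<Phi> (circle r)"
    by (rule inj_onI) (auto simp: circle_eq \<Phi>_circle_pt_iff)
  show "circle_\<Phi> ` circle r = circle 1"
    unfolding circle_eq image_image circle_\<Phi>_pt using surj_\<Phi> by (metis image_image)
qed

abbreviation circle_conj :: "(real set \<Rightarrow> real set) \<Rightarrow> real set \<Rightarrow> real set" where
  "circle_conj \<equiv> conj_by circle_\<Phi> (circle r) (circle 1)"

lemma circle_conj_pt:
  assumes "f (circle_pt r x) = circle_pt r z"
  shows "circle_conj f (circle_pt 1 (\<Phi> x)) = circle_pt 1 (\<Phi> z)"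
  using conj_by_apply[OF bij_betw_circle_\<Phi> circle_pt_in_circle, of f x] assms by simp

text \<open>Every grid point is congruent modulo 1 to one from a single period of indices, so a grid
  has finitely many points on the circle.\<close>

lemma G_mod: "G m a = G m (a mod (int r * int n ^ m)) + of_int (a div (int r * int n ^ m))"
proof -
  define b j where "b = a mod (int r * int n ^ m)" and "j = a div (int r * int n ^ m)"
  have "a = b + int r * int n ^ m * j" by (simp add: b_def j_def)
  then have "(of_int a :: real) = of_int b + of_int (int r * int n ^ m * j)" by (simp only: of_int_add)
  then have "of_int a / real n ^ m = of_int b / real n ^ m + real r * of_int j"
    using n_pos by (simp add: field_simps)
  then show ?thesis unfolding \<Phi>_grid[symmetric] b_def[symmetric] j_def[symmetric] by (simp only: \<Phi>_shift)
qed

text \<open>The interval argument is repeated on the line with lifts: images are known up to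
  multiples of \<open>r\<close>, and cells are moved into the period \<open>[0, r)\<close>.\<close>

lemma circle_pw_affine_conj:
  assumes pf: "circle_pw_affine n r f"
    and Df: "f ` (circle_pt r ` n_adic n) = circle_pt r ` n_adic n"
  shows "circle_pw_affine 2 1 (circle_conj f)"
proof -
  obtain B where B: "finite B" "B \<subseteq> circle_pt r ` n_adic n" and
    Bf: "\<And>a b. circle_pt r ` {a<..<b} \<inter> B = {} \<Longrightarrow>
      \<exists>(k::int) c. \<forall>x\<in>{a<..<b}. f (circle_pt r x) = circle_pt r (real n powi k * x + c)"
    using pf unfolding circle_pw_affine_def by blast
  obtain B' where B': "finite B'" "B' \<subseteq> n_adic n" "B = circle_pt r ` B'"
    using finite_subset_image[OF B] by blast
  obtain m0 where m0: "\<And>b. b \<in> B' \<Longrightarrow> \<exists>a::int. b = of_int a / real n ^ m0"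
    using finite_n_adic_level[OF B'(1,2) n_pos] unfolding eventually_sequentially by blast
  define A where "A = {0..<int r * int n ^ m0}"
  have "\<exists>(k::int). \<exists>c\<in>n_adic n. \<forall>x\<in>{of_int a / real n ^ m0<..<of_int (a + 1) / real n ^ m0}.
      f (circle_pt r x) = circle_pt r (real n powi k * x + c)" for a
  proof -
    define I where "I = {of_int a / real n ^ m0<..<of_int (a + 1) / real n ^ m0}"
    have "circle_pt r x \<notin> B" if x: "x \<in> I" for x
    proof
      assume "circle_pt r x \<in> B"
      then obtain b where "b \<in> B'" "circle_pt r b = circle_pt r x" using B'(3) by auto
      then obtain b :: int and j :: int where "x = of_int b / real n ^ m0 + real r * of_int j"
        using m0 unfolding circle_pt_eq_iff by blast
      \<comment> \<open>A shift by a multiple of \<open>r\<close> preserves the grid of level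
        \<open>m0\<close>, so every lift of a breakpoint, not only the one in \<open>B'\<close>, is
        a grid point.\<close>
      then have "x = of_int (b + int r * int n ^ m0 * j) / real n ^ m0"
        using n_pos by (simp add: field_simps)
      then obtain b' :: int where "x = of_int b' / real n ^ m0" by blast
      then have "of_int a < (of_int b' :: real)" "of_int b' < (of_int (a + 1) :: real)"
        using x n_pos unfolding I_def by (simp_all add: divide_less_cancel)
      then show False by simp
    qed
    then have "circle_pt r ` I \<inter> B = {}" by blast
    then obtain k c where kc: "\<forall>x\<in>I. f (circle_pt r x) = circle_pt r (real n powi k * x + c)"
      using Bf unfolding I_def by blast
    obtain x where x: "x \<in> n_adic n" "x \<in> I"
      using cell_interior_n_adic[OF n] unfolding I_def by blast
    then have "circle_pt r (real n powi k * x + c) \<in> circle_pt r ` n_adic n"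
      using Df kc by (metis imageI)
    \<comment> \<open>The image point has an \<open>n\<close>-adic lift \<open>d\<close>, and all
      its lifts differ by integers, so the one given by the affine formula is \<open>n\<close>-adic
      too.\<close>
    then obtain d where d: "d \<in> n_adic n" "circle_pt r d = circle_pt r (real n powi k * x + c)" by auto
    then obtain j :: int where "real n powi k * x + c = d + real r * of_int j"
      unfolding circle_pt_eq_iff by blast
    then have "c = d + real r * of_int j - real n powi k * x" by simp
    also have "\<dots> \<in> n_adic n"
      using x d(1) n_pos by (intro n_adic_diff n_adic_add n_adic_mult n_adic_powi n_adic_of_nat n_adic_of_int)
    finally show ?thesis using kc unfolding I_def by blast
  qed
  then obtain m where m: "m \<ge> m0" "\<And>a. a div int n ^ (m - m0) \<in> A \<Longrightarrow> \<exists>(k::int) c.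
      \<forall>x\<in>{of_int a / real n ^ m<..<of_int (a + 1) / real n ^ m}.
        \<exists>z. f (circle_pt r x) = circle_pt r z \<and> \<Phi> z = 2 powi k * \<Phi> x + c"
    using cells_affine[of A m0 "\<lambda>x z. f (circle_pt r x) = circle_pt r z"] unfolding A_def by blast
  define N where "N = int r * int n ^ m"
  have N: "N > 0" using n_pos r by (simp add: N_def)
  have nm: "N = int r * int n ^ m0 * int n ^ (m - m0)"
    using m(1) by (simp add: N_def mult.assoc flip: power_add)
  define C where "C = circle_pt 1 ` G m ` {0..<N}"
  have C: "finite C" "C \<subseteq> circle_pt 1 ` n_adic 2"
    using dyadic_grid_n_adic[OF dyadic_grid_G] by (auto simp: C_def)
  have G_C: "circle_pt 1 (G m a) \<in> C" for a
  proof -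
    have "circle_pt 1 (G m (a mod N)) = circle_pt 1 (G m a)"
      unfolding circle_pt_eq_iff using G_mod[of m a] by (auto simp: N_def)
    then show ?thesis using N unfolding C_def by (metis atLeastLessThan_iff imageI pos_mod_bound pos_mod_sign)
  qed
  have "\<exists>(k::int) c. \<forall>y\<in>{u<..<v}. circle_conj f (circle_pt 1 y) = circle_pt 1 (real 2 powi k * y + c)"
    if uv: "circle_pt 1 ` {u<..<v} \<inter> C = {}" for u v
  proof (cases "u < v")
    case True
    have "{u<..<v} \<inter> range (G m) = {}" using uv G_C by blast
    then obtain a where a: "{u<..<v} \<subseteq> {G m a<..<G m (a + 1)}"
      using interval_in_cell[OF True] by blast
    \<comment> \<open>\<open>b\<close> is the index of the translate of the cell \<open>a\<close> in
      the period \<open>[0, r)\<close>, and \<open>j\<close> counts the periods.\<close>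
    define b j where "b = a mod N" and "j = a div N"
    have ab: "a = b + N * j" by (simp add: b_def j_def)
    have "b div int n ^ (m - m0) \<in> A"
      unfolding A_def using n_pos N by (intro div_in_range) (simp_all add: nm[symmetric] b_def)
    then obtain k c where kc: "\<And>x. x \<in> {of_int b / real n ^ m<..<of_int (b + 1) / real n ^ m} \<Longrightarrow>
        \<exists>z. f (circle_pt r x) = circle_pt r z \<and> \<Phi> z = 2 powi k * \<Phi> x + c"
      using m(2) by blast
    \<comment> \<open>The formula is known over the cell \<open>b\<close>; moving \<open>y\<close>
      back by \<open>j\<close> periods lowers the constant by
      \<open>2 powi k * of_int j\<close>.\<close>
    have "circle_conj f (circle_pt 1 y) = circle_pt 1 (real 2 powi k * y + (c - 2 powi k * of_int j))"
      if y: "y \<in> {u<..<v}" for y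
    proof -
      define x where "x = \<Psi> y - real r * of_int j"
      have y_eq: "y = \<Phi> x + of_int j"
        using \<Phi>_shift[of x j] by (simp add: x_def \<Phi>_inv)
      have "G m a = G m b + of_int j" "G m (a + 1) = G m (b + 1) + of_int j"
      proof -
        have "of_int (a + i) / real n ^ m = of_int (b + i) / real n ^ m + real r * of_int j" for i
          using n_pos unfolding ab N_def by (simp add: field_simps)
        from this[of 0] this[of 1] show "G m a = G m b + of_int j" "G m (a + 1) = G m (b + 1) + of_int j"
          unfolding \<Phi>_grid[symmetric] by (simp_all only: \<Phi>_shift add_0_right)
      qed
      then have "\<Phi> x \<in> {G m b<..<G m (b + 1)}" using a y y_eq by auto
      then obtain z where z: "f (circle_pt r x) = circle_pt r z" "\<Phi> z = 2 powi k * \<Phi> x + c"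
        using kc unfolding \<Phi>_cell by blast
      have "circle_pt 1 y = circle_pt 1 (\<Phi> x)"
        unfolding circle_pt_eq_iff y_eq by (intro exI[of _ "- j"]) simp
      then have "circle_conj f (circle_pt 1 y) = circle_pt 1 (\<Phi> z)"
        using circle_conj_pt[of f x z, OF z(1)] by simp
      then show ?thesis by (simp add: z(2) y_eq algebra_simps)
    qed
    then show ?thesis by blast
  qed auto
  then show ?thesis
    unfolding circle_pw_affine_def using C by (intro exI[of _ C] conjI allI impI)
qed

lemma mon_thompson_T: "circle_conj \<in> mon (thompson_T n r) (thompson_T 2 1)"
  unfolding thompson_T_def
proof (rule mon_conj_by[OF bij_betw_circle_\<Phi>])
  fix f assume f: "f \<in> Bij (circle r)" and
    "homeomorphic_map (circle_topology r) (circle_topology r) f \<and> circle_orientation_preserving r f \<and>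
      circle_pw_affine n r f \<and> f ` (circle_pt r ` n_adic n) = circle_pt r ` n_adic n"
  then have orf: "circle_orientation_preserving r f" and pf: "circle_pw_affine n r f"
    and Df: "f ` (circle_pt r ` n_adic n) = circle_pt r ` n_adic n" by blast+
  obtain \<phi> where \<phi>: "continuous_on UNIV \<phi>" "strict_mono \<phi>" "\<And>x. f (circle_pt r x) = circle_pt r (\<phi> x)"
    using orf unfolding circle_orientation_preserving_def by blast
  have "surj \<phi>" using circle_lift_surj[OF _ \<phi>] r by simp
  \<comment> \<open>The conjugate of a lift lifts the conjugate; it is again increasing and
    onto.\<close>
  define \<psi> where "\<psi> = \<Phi> \<circ> \<phi> \<circ> \<Psi>"
  have \<psi>: "strict_mono \<psi>" "surj \<psi>"
    unfolding \<psi>_def using strict_mono_\<Phi> \<phi>(2) \<Phi>_inv(2) \<open>surj \<phi>\<close> surj_\<Phi> \<Phi>_inv(3)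
    by (simp_all only: comp_surj) (simp_all add: strict_mono_def)
  have lift: "circle_conj f (circle_pt 1 y) = circle_pt 1 (\<psi> y)" for y
    using circle_conj_pt[of f "\<Psi> y", OF \<phi>(3)] by (simp add: \<psi>_def \<Phi>_inv)
  have bij: "circle_conj f \<in> Bij (circle 1)"
    by (rule conj_by_Bij[OF bij_betw_circle_\<Phi> f])
  show "homeomorphic_map (circle_topology 1) (circle_topology 1) (circle_conj f) \<and>
      circle_orientation_preserving 1 (circle_conj f) \<and> circle_pw_affine 2 1 (circle_conj f) \<and>
      circle_conj f ` (circle_pt 1 ` n_adic 2) = circle_pt 1 ` n_adic 2"
  proof (intro conjI)
    show "homeomorphic_map (circle_topology 1) (circle_topology 1) (circle_conj f)"
      by (rule homeomorphic_map_circle_lift[OF bij \<psi> lift])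
    show "circle_orientation_preserving 1 (circle_conj f)"
      unfolding circle_orientation_preserving_def
      using \<psi>(1) strict_mono_surj_inv(1)[OF \<psi>] lift by blast
    show "circle_pw_affine 2 1 (circle_conj f)" by (rule circle_pw_affine_conj[OF pf Df])
    have "circle_\<Phi> ` circle_pt r ` n_adic n = circle_pt 1 ` n_adic 2"
      unfolding \<Phi>_n_adic[symmetric] by (simp add: image_image)
    then show "circle_conj f ` (circle_pt 1 ` n_adic 2) = circle_pt 1 ` n_adic 2"
      using conj_by_preserves[OF bij_betw_circle_\<Phi> _ Df] by (simp add: image_subset_iff)
  qed
qed

end

declare One_nat_def [simp]

section \<open>Bijections of forests\<close>

text \<open>By induction on words, such an \<open>f\<close> replaces prefixes on the whole subtree
  below each tree vertex of depth at least \<open>N\<close>. Both the quasi-automorphisms and, for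
  \<open>n = 1\<close>, the elements of the Houghton groups are treated through this
  property.\<close>

definition tame :: "nat \<Rightarrow> nat \<Rightarrow> nat \<Rightarrow> (nat list vertex \<Rightarrow> nat list vertex) \<Rightarrow> bool" where
  "tame n r N f \<longleftrightarrow> (\<forall>i<r. \<forall>w. set w \<subseteq> {..<n} \<longrightarrow> N \<le> length w \<longrightarrow>
    (\<exists>i' w'. f (Vertex i w) = Vertex i' w' \<and> (\<forall>j<n. f (Vertex i (w @ [j])) = Vertex i' (w' @ [j]))))"

lemma tameE:
  assumes "tame n r N f" "Vertex i w \<in> forest_vertices n r p" "N \<le> length w"
  obtains i' w' where "f (Vertex i w) = Vertex i' w'" "\<And>j. j < n \<Longrightarrow> f (Vertex i (w @ [j])) = Vertex i' (w' @ [j])"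
  using assms unfolding tame_def forest_vertices_def by blast

lemma tame_mono: "tame n r N f \<Longrightarrow> N \<le> M \<Longrightarrow> tame n r M f"
  unfolding tame_def by (meson order_trans)

lemma Vertex_in_forest [simp]: "Vertex i w \<in> forest_vertices n r p \<longleftrightarrow> i < r \<and> set w \<subseteq> {..<n}"
  by (auto simp: forest_vertices_def)

lemma Isolated_in_forest [simp]: "Isolated j \<in> forest_vertices n r p \<longleftrightarrow> j < p"
  by (auto simp: forest_vertices_def)

text \<open>Only finitely many vertices are isolated or of depth below \<open>K\<close>, so a
  bijection sends only finitely many there, and \<open>M\<close> exceeds their depths.\<close>

lemma Bij_forest_deep:
  assumes f: "f \<in> Bij (forest_vertices n r p)"
  obtains M where "\<And>i w. Vertex i w \<in> forest_vertices n r p \<Longrightarrow> M \<le> length w \<Longrightarrow>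
    \<exists>i' w'. f (Vertex i w) = Vertex i' w' \<and> K \<le> length w'"
proof -
  define S where "S = forest_vertices n r p"
  define Bad where "Bad = {v \<in> S. \<not> (\<exists>i w. v = Vertex i w \<and> K \<le> length w)}"
  have "Bad \<subseteq> (\<lambda>(i, w). Vertex i w) ` ({..<r} \<times> {w. set w \<subseteq> {..<n} \<and> length w \<le> K}) \<union> Isolated ` {..<p}"
  proof
    fix v assume v: "v \<in> Bad"
    show "v \<in> (\<lambda>(i, w). Vertex i w) ` ({..<r} \<times> {w. set w \<subseteq> {..<n} \<and> length w \<le> K}) \<union> Isolated ` {..<p}"
      using v by (cases v) (auto simp: Bad_def S_def)
  qed
  moreover have "finite ({..<r} \<times> {w :: nat list. set w \<subseteq> {..<n} \<and> length w \<le> K})"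
    by (intro finite_cartesian_product finite_lists_length_le) auto
  ultimately have "finite Bad" by (meson finite_Un finite_imageI finite_lessThan finite_subset)
  then have "finite {v \<in> S. f v \<in> Bad}"
    using f finite_vimage_IntI[of Bad f S] by (auto simp: S_def Bij_def bij_betw_def vimage_def Int_def conj_commute)
  then have "finite ((\<lambda>v. case v of Vertex i w \<Rightarrow> length w | Isolated j \<Rightarrow> 0) ` {v \<in> S. f v \<in> Bad})"
    by (rule finite_imageI)
  then obtain M where M: "\<forall>k\<in>(\<lambda>v. case v of Vertex i w \<Rightarrow> length w | Isolated j \<Rightarrow> 0) ` {v \<in> S. f v \<in> Bad}. k < M"
    unfolding finite_nat_set_iff_bounded by blast
  show ?thesis
  proof (rule that)
    fix i w assume v: "Vertex i w \<in> forest_vertices n r p" "M \<le> length w"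
    have "f (Vertex i w) \<notin> Bad"
    proof
      assume "f (Vertex i w) \<in> Bad"
      then have "length w < M" using M v(1) unfolding S_def[symmetric] by force
      then show False using v(2) by simp
    qed
    then show "\<exists>i' w'. f (Vertex i w) = Vertex i' w' \<and> K \<le> length w'"
      using Bij_mem[OF f v(1)] unfolding Bad_def S_def by blast
  qed
qed

text \<open>A deep vertex has a deep preimage, at which tameness of \<open>f\<close> can be read
  backwards.\<close>

lemma tame_inv:
  assumes f: "f \<in> Bij (forest_vertices n r p)" and t: "tame n r N f"
  shows "\<exists>M. tame n r M (\<lambda>v\<in>forest_vertices n r p. inv_into (forest_vertices n r p) f v)"
proof -
  define S where "S = forest_vertices n r p"
  define h where "h = (\<lambda>v\<in>S. inv_into S f v)"
  have hB: "h \<in> Bij S" unfolding h_def S_def by (rule restrict_inv_into_Bij[OF f])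
  obtain M where M: "\<And>i w. Vertex i w \<in> S \<Longrightarrow> M \<le> length w \<Longrightarrow>
      \<exists>i' w'. h (Vertex i w) = Vertex i' w' \<and> N \<le> length w'"
    using Bij_forest_deep[OF hB[unfolded S_def]] unfolding S_def by metis
  have "tame n r M h"
    unfolding tame_def
  proof (intro allI impI)
    fix i w assume w: "i < r" "set w \<subseteq> {..<n}" "M \<le> length w"
    then have wS: "Vertex i w \<in> S" by (simp add: S_def)
    obtain i' w' where h: "h (Vertex i w) = Vertex i' w'" "N \<le> length w'"
      using M[OF wS w(3)] by blast
    have w'S: "Vertex i' w' \<in> S" using Bij_mem[OF hB wS] h(1) by simp
    have fw: "f (Vertex i' w') = Vertex i w"
      using h(1) wS f by (auto simp: h_def S_def Bij_inv dest: sym)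
    have "h (Vertex i (w @ [j])) = Vertex i' (w' @ [j])" if j: "j < n" for j
    proof -
      have "f (Vertex i' (w' @ [j])) = Vertex i (w @ [j])"
        using tameE[OF t w'S[unfolded S_def] h(2)] fw j by (metis vertex.inject(1))
      moreover have "Vertex i' (w' @ [j]) \<in> S" "Vertex i (w @ [j]) \<in> S"
        using w'S wS j by (auto simp: S_def)
      ultimately show ?thesis using Bij_inv(3)[OF f] by (metis S_def h_def restrict_apply')
    qed
    then show "\<exists>i' w'. h (Vertex i w) = Vertex i' w' \<and> (\<forall>j<n. h (Vertex i (w @ [j])) = Vertex i' (w' @ [j]))"
      using h(1) by blast
  qed
  then show ?thesis unfolding h_def S_def by blast
qed

text \<open>In base \<open>q = n + 1\<close>, the cone of the vertex \<open>w\<close> consists of the numbers whose digits start with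
  \<open>w\<close>, and \<open>w\<close> owns those whose digits start with \<open>w n\<close>.\<close>

locale forest_code =
  fixes n r p :: nat
begin

abbreviation S :: "nat list vertex set" where
  "S \<equiv> forest_vertices n r p"

abbreviation q :: nat where
  "q \<equiv> Suc n"

text \<open>The number with base \<open>q\<close> digits \<open>w\<close> after the leading
  coefficient \<open>i\<close>, which may exceed \<open>q\<close>. The cone of the vertex runs from
  \<open>num i w\<close> to \<open>num i w + 1\<close>, divided by
  \<open>q ^ length w\<close>.\<close>

definition num :: "nat \<Rightarrow> nat list \<Rightarrow> int" where
  "num i w = foldl (\<lambda>a d. a * int q + int d) (int i) w"

lemma num_Nil [simp]: "num i [] = int i"
  by (simp add: num_def)

lemma num_snoc [simp]: "num i (w @ [j]) = num i w * int q + int j"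
  by (simp add: num_def)

lemma num_snoc2 [simp]: "num i (w @ [j, k]) = (num i w * int q + int j) * int q + int k"
  by (simp add: num_def)

text \<open>The interval owned by \<open>v\<close> has index \<open>cell v\<close> in the grid with
  denominator \<open>q ^ level v\<close>. The extra digit \<open>n\<close> puts it one level below
  the cone of a tree vertex; the isolated vertex \<open>j\<close> owns
  \<open>[r + j, r + j + 1)\<close>.\<close>

fun level :: "nat list vertex \<Rightarrow> nat" where
  "level (Vertex i w) = Suc (length w)"
| "level (Isolated j) = 0"

fun cell :: "nat list vertex \<Rightarrow> int" where
  "cell (Vertex i w) = num i (w @ [n])"
| "cell (Isolated j) = int (r + j)"

definition owns :: "nat list vertex \<Rightarrow> real \<Rightarrow> bool" where
  "owns v x \<longleftrightarrow> \<lfloor>real q ^ level v * x\<rfloor> = cell v"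

definition in_cone :: "nat list vertex \<Rightarrow> real \<Rightarrow> bool" where
  "in_cone v x \<longleftrightarrow> (\<exists>i w. v = Vertex i w \<and> \<lfloor>real q ^ length w * x\<rfloor> = num i w)"

text \<open>The increasing affine map that takes the cell owned by \<open>v\<close> to the one owned
  by \<open>v'\<close>.\<close>

definition aff :: "nat list vertex \<Rightarrow> nat list vertex \<Rightarrow> real \<Rightarrow> real" where
  "aff v v' x = (real q ^ level v * x - of_int (cell v) + of_int (cell v')) / real q ^ level v'"

lemma aff_refl [simp]: "aff v v x = x"
  by (simp add: aff_def)

lemma aff_aff [simp]: "aff v' v'' (aff v v' x) = aff v v'' x"
  by (simp add: aff_def)

lemma owns_aff: "owns v x \<Longrightarrow> owns v' (aff v v' x)"
proof -
  assume "owns v x"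
  moreover have "real q ^ level v' * aff v v' x = real q ^ level v * x + of_int (cell v' - cell v)"
    by (simp add: aff_def)
  then have "\<lfloor>real q ^ level v' * aff v v' x\<rfloor> = \<lfloor>real q ^ level v * x\<rfloor> + (cell v' - cell v)"
    by (simp only: floor_add_int)
  ultimately show ?thesis by (simp add: owns_def)
qed

text \<open>The owned cell is the last of \<open>q\<close> equal parts of the cone, so the affine
  map between owned cells is also the one between the cones.\<close>

lemma in_cone_aff:
  assumes "in_cone (Vertex i w) x"
  shows "in_cone (Vertex i' w') (aff (Vertex i w) (Vertex i' w') x)"
proof -
  have "real q ^ length w' * aff (Vertex i w) (Vertex i' w') x =
      real q ^ length w * x + of_int (num i' w' - num i w)"
    by (simp add: aff_def divide_simps del: of_nat_Suc) (simp add: algebra_simps)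
  then have "\<lfloor>real q ^ length w' * aff (Vertex i w) (Vertex i' w') x\<rfloor> =
      \<lfloor>real q ^ length w * x\<rfloor> + (num i' w' - num i w)"
    by (simp only: floor_add_int)
  then show ?thesis using assms by (simp add: in_cone_def)
qed

text \<open>Appending the digit \<open>j\<close> picks corresponding parts of both cones, so the
  affine map stays the same. This is why the maps attached to a deep vertex and to its descendants
  fit together.\<close>

lemma aff_child: "aff (Vertex i (w @ [j])) (Vertex i' (w' @ [j])) x = aff (Vertex i w) (Vertex i' w') x"
  by (simp add: aff_def divide_simps del: of_nat_Suc) (simp add: algebra_simps)

lemma aff_affine:
  obtains k :: int and c where "c \<in> n_adic q" "\<And>x. aff v v' x = real q powi k * x + c"
proof
  show "of_int (cell v' - cell v) / real q ^ level v' \<in> n_adic q" by (rule n_adicI) (rule refl)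
  show "aff v v' x = real q powi (int (level v) - int (level v')) * x +
      of_int (cell v' - cell v) / real q ^ level v'" for x
    by (simp add: aff_def power_int_diff add_divide_distrib diff_divide_distrib del: of_nat_Suc)
qed

text \<open>The digit \<open>n\<close> is allowed, so that owned cells are covered as well as
  cones.\<close>

lemma num_bounds:
  assumes "set w \<subseteq> {..n}"
  shows "int i * int q ^ length w \<le> num i w \<and> num i w < int (i + 1) * int q ^ length w"
  using assms
proof (induction w rule: rev_induct)
  case (snoc j w)
  then have IH: "int i * int q ^ length w \<le> num i w" "num i w + 1 \<le> int (i + 1) * int q ^ length w"
    and j: "j \<le> n" by auto
  have "int i * int q ^ length w * int q \<le> num i w * int q"
    "(num i w + 1) * int q \<le> int (i + 1) * int q ^ length w * int q"
    using IH by (intro mult_right_mono; simp)+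
  then show ?case using j by (simp add: algebra_simps)
qed simp

section \<open>Locating the vertex of a real number\<close>

definition X :: "real set" where
  "X = {0..<real (r + p)}"

lemma X_if_floor:
  assumes "0 \<le> a" "a < int (r + p) * int q ^ m" "\<lfloor>real q ^ m * x\<rfloor> = a"
  shows "x \<in> X"
proof -
  have "0 \<le> real q ^ m * x" using assms by linarith
  moreover have "a + 1 \<le> int (r + p) * int q ^ m" using assms(2) by simp
  then have "of_int (a + 1) \<le> (of_int (int (r + p) * int q ^ m) :: real)" by (simp only: of_int_le_iff)
  then have "real q ^ m * x < of_int (int (r + p) * int q ^ m)"
    using assms(3) by linarith
  then have "real q ^ m * x < real q ^ m * real (r + p)"
    by (simp add: mult.commute)
  moreover have "0 < real q ^ m" by simp
  ultimately show ?thesis by (simp add: X_def zero_le_mult_iff del: of_nat_Suc of_nat_add)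
qed

lemma X_if_at:
  assumes "v \<in> S" "owns v x \<or> in_cone v x"
  shows "x \<in> X"
proof (cases v)
  case (Vertex i w)
  have up: "int (i + 1) * int q ^ m \<le> int (r + p) * int q ^ m" for m
    using assms(1) Vertex by (intro mult_right_mono) auto
  have "set w \<subseteq> {..n}" "set (w @ [n]) \<subseteq> {..n}" using assms(1) Vertex by auto
  then have "int i * int q ^ length w \<le> num i w" "num i w < int (r + p) * int q ^ length w"
    "int i * int q ^ Suc (length w) \<le> num i (w @ [n])" "num i (w @ [n]) < int (r + p) * int q ^ Suc (length w)"
    using num_bounds[of w i] num_bounds[of "w @ [n]" i] up[of "length w"] up[of "Suc (length w)"]
    unfolding length_append_singleton by (meson less_le_trans)+
  moreover have "0 \<le> int i * int q ^ m" for m by simp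
  ultimately show ?thesis
    using assms(2) Vertex X_if_floor order_trans unfolding owns_def in_cone_def
    by (metis cell.simps(1) level.simps(1) vertex.inject(1))
next
  case (Isolated j)
  then show ?thesis
    using assms X_if_floor[of "int (r + j)" 0 x] by (auto simp: owns_def in_cone_def)
qed

text \<open>Descent from a root along the base \<open>q\<close> digits of \<open>x\<close>, to depth
  at most \<open>N\<close>. It stops for good at a vertex owning \<open>x\<close>, which the digit
  \<open>n\<close> signals; the test \<open>length w = N\<close> recognises a descent that has not
  stopped before.\<close>

primrec vx :: "nat \<Rightarrow> real \<Rightarrow> nat list vertex" where
  "vx 0 x = (if \<lfloor>x\<rfloor> < int r then Vertex (nat \<lfloor>x\<rfloor>) [] else Isolated (nat \<lfloor>x\<rfloor> - r))"
| "vx (Suc N) x = (case vx N x of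
      Vertex i w \<Rightarrow> (let d = nat (\<lfloor>real q ^ Suc N * x\<rfloor> mod int q)
        in if length w = N \<and> d < n then Vertex i (w @ [d]) else Vertex i w)
    | Isolated j \<Rightarrow> Isolated j)"

lemma floor_div: "\<lfloor>real q ^ N * x\<rfloor> = \<lfloor>real q ^ Suc N * x\<rfloor> div int q"
proof -
  have "real q ^ N * x = (real q ^ Suc N * x) / of_int (int q)" by (simp del: of_nat_Suc)
  then show ?thesis by (simp only: floor_divide_real_eq_div[of "int q"] of_nat_0_le_iff)
qed

lemma vx_cong: "\<lfloor>real q ^ N * x\<rfloor> = \<lfloor>real q ^ N * y\<rfloor> \<Longrightarrow> vx N x = vx N y"
proof (induction N)
  case (Suc N)
  then have "vx N x = vx N y" using floor_div[of N x] floor_div[of N y] by simp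
  then show ?case using Suc.prems by (simp only: vx.simps)
qed simp

lemma vx_in_S: "x \<in> X \<Longrightarrow> vx N x \<in> S"
proof (induction N)
  case 0
  then show ?case by (auto simp: X_def) linarith+
next
  case (Suc N)
  then show ?case by (auto simp: Let_def split: vertex.split)
qed

text \<open>Either the descent is still running or it has found the owner of \<open>x\<close>; the
  next digit of \<open>x\<close> decides how the first case continues.\<close>

lemma vx_at:
  assumes "x \<in> X"
  shows "(\<exists>i w. vx N x = Vertex i w \<and> length w = N \<and> in_cone (vx N x) x) \<or>
    (owns (vx N x) x \<and> level (vx N x) \<le> N)"
proof (induction N)
  case 0
  show ?case using assms by (auto simp: X_def owns_def in_cone_def)
next
  case (Suc N)
  show ?case
  proof (cases "owns (vx N x) x \<and> level (vx N x) \<le> N")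
    case True
    then have "vx (Suc N) x = vx N x" by (cases "vx N x") auto
    then show ?thesis using True by auto
  next
    case False
    then obtain i w where w: "vx N x = Vertex i w" "length w = N" "\<lfloor>real q ^ N * x\<rfloor> = num i w"
      using Suc.IH by (auto simp: in_cone_def)
    define a where "a = \<lfloor>real q ^ Suc N * x\<rfloor>"
    define d where "d = nat (a mod int q)"
    have d: "d < q" "int d = a mod int q" by (auto simp: d_def nat_less_iff)
    have a: "a = num i w * int q + int d"
      using floor_div[of N x] w(3) d(2) div_mult_mod_eq[of a "int q"] by (simp add: a_def)
    have vx: "vx (Suc N) x = (if d < n then Vertex i (w @ [d]) else Vertex i w)"
      using w by (simp add: d_def a_def Let_def)
    show ?thesis
    proof (cases "d < n")
      case True
      then show ?thesis
        using vx w(2) a unfolding a_def by (simp add: in_cone_def del: vx.simps of_nat_Suc power_Suc)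
    next
      case False
      then have "d = n" using d(1) by simp
      then show ?thesis
        using vx w(2) a unfolding a_def by (simp add: owns_def del: vx.simps of_nat_Suc power_Suc)
    qed
  qed
qed

lemma vx_cone:
  assumes "Vertex i w \<in> S" "in_cone (Vertex i w) x"
  shows "vx (length w) x = Vertex i w"
  using assms
proof (induction w rule: rev_induct)
  case Nil
  then show ?case by (auto simp: in_cone_def)
next
  case (snoc j w)
  have j: "j < n" using snoc.prems by simp
  have a: "\<lfloor>real q ^ Suc (length w) * x\<rfloor> = num i w * int q + int j"
    using snoc.prems(2) by (simp add: in_cone_def)
  then have "\<lfloor>real q ^ length w * x\<rfloor> = num i w"
    unfolding floor_div[of "length w" x] using j by simp
  then have IH: "vx (length w) x = Vertex i w"
    using snoc by (simp add: in_cone_def)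
  have "nat (\<lfloor>real q ^ Suc (length w) * x\<rfloor> mod int q) = j"
    unfolding a using j by simp
  then show ?case using IH j by (simp del: power_Suc of_nat_Suc)
qed

text \<open>The descent stays at the owner of \<open>x\<close> once it is found; hence the cells
  owned by different vertices are disjoint.\<close>

lemma vx_owned:
  assumes "v \<in> S" "owns v x" "level v \<le> N"
  shows "vx N x = v"
  using assms(3)
proof (induction N rule: dec_induct)
  case base
  show ?case
  proof (cases v)
    case (Vertex i w)
    have a: "\<lfloor>real q ^ Suc (length w) * x\<rfloor> = num i w * int q + int n"
      using assms(2) Vertex by (simp add: owns_def)
    then have "\<lfloor>real q ^ length w * x\<rfloor> = num i w"
      unfolding floor_div[of "length w" x] by simp
    then have v: "vx (length w) x = Vertex i w"
      using vx_cone assms(1) Vertex by (simp add: in_cone_def)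
    have "nat (\<lfloor>real q ^ Suc (length w) * x\<rfloor> mod int q) = n"
      unfolding a by simp
    then show ?thesis using v Vertex by (simp del: power_Suc of_nat_Suc)
  next
    case (Isolated j)
    then show ?thesis using assms(2) by (simp add: owns_def)
  qed
next
  case (step N)
  then show ?case by (cases v) auto
qed

section \<open>The action of tame bijections on the interval\<close>

definition act :: "nat \<Rightarrow> (nat list vertex \<Rightarrow> nat list vertex) \<Rightarrow> real \<Rightarrow> real" where
  "act N f x = aff (vx N x) (f (vx N x)) x"

text \<open>Every \<open>N\<close> for which \<open>f\<close> is tame gives the same map, by
  \<open>act_stable\<close>; the choice makes \<open>emb\<close> depend on \<open>f\<close>
  alone.\<close>

definition emb :: "(nat list vertex \<Rightarrow> nat list vertex) \<Rightarrow> real \<Rightarrow> real" where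
  "emb f = (\<lambda>x\<in>X. act (SOME N. tame n r N f) f x)"

text \<open>One more step of the descent stays at the vertex or passes to a child; in the second
  case tameness moves the image to the corresponding child and \<open>aff_child\<close>
  applies.\<close>

lemma act_stable:
  assumes t: "tame n r N f" and x: "x \<in> X" and "N \<le> M"
  shows "act M f x = act N f x"
  using assms(3)
proof (induction M rule: dec_induct)
  case (step M)
  have "act (Suc M) f x = act M f x"
  proof (cases "vx M x")
    case (Vertex i w)
    show ?thesis
    proof (cases "vx (Suc M) x = vx M x")
      case True
      then show ?thesis by (simp add: act_def)
    next
      case False
      then obtain d where d: "vx (Suc M) x = Vertex i (w @ [d])" "d < n" "length w = M"
        using Vertex by (auto simp: Let_def split: if_splits)
      have "Vertex i w \<in> S" using vx_in_S[OF x, of M] Vertex by simp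
      then obtain i' w' where "f (Vertex i w) = Vertex i' w'" "f (Vertex i (w @ [d])) = Vertex i' (w' @ [d])"
        using tameE[OF t] d(2,3) step.hyps(1) by metis
      then show ?thesis using d(1) Vertex by (simp add: act_def aff_child del: vx.simps)
    qed
  qed (simp add: act_def)
  then show ?case using step.IH by simp
qed simp

lemma emb_eq:
  assumes t: "tame n r N f" and x: "x \<in> X"
  shows "emb f x = act N f x"
proof -
  define M where "M = (SOME N. tame n r N f)"
  have "tame n r M f" unfolding M_def using t by (rule someI)
  then show ?thesis
    using act_stable[OF t x, of "max N M"] act_stable[OF _ x, of M f "max N M"] x
    by (simp add: emb_def flip: M_def)
qed

text \<open>From depth \<open>level v\<close> on, the descent of a point owned by \<open>v\<close>
  ends at \<open>v\<close>, so \<open>emb f\<close> also remembers the values of \<open>f\<close> at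
  shallow and isolated vertices.\<close>

lemma emb_owned:
  assumes t: "\<exists>N. tame n r N f" and v: "v \<in> S" "owns v x"
  shows "emb f x = aff v (f v) x"
proof -
  obtain N where "tame n r N f" using t by blast
  then have "tame n r (max N (level v)) f" by (rule tame_mono) simp
  then show ?thesis
    using emb_eq vx_owned[OF v] X_if_at[OF v(1)] v(2) by (simp add: act_def)
qed

lemma act_at:
  assumes t: "tame n r N f" and x: "x \<in> X"
  shows "(owns (f (vx N x)) (act N f x)) \<or> (\<exists>i w. vx N x = Vertex i w \<and> N = length w \<and> in_cone (f (vx N x)) (act N f x))"
  using vx_at[OF x, of N]
proof
  assume "\<exists>i w. vx N x = Vertex i w \<and> length w = N \<and> in_cone (vx N x) x"
  then obtain i w where w: "vx N x = Vertex i w" "length w = N" "in_cone (Vertex i w) x" by auto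
  have "Vertex i w \<in> S" using vx_in_S[OF x, of N] w(1) by simp
  then obtain i' w' where "f (Vertex i w) = Vertex i' w'" using tameE[OF t] w(2) by blast
  then show ?thesis using w in_cone_aff[OF w(3)] by (simp add: act_def)
qed (simp add: act_def owns_aff)

lemma emb_in_X:
  assumes f: "f \<in> Bij S" and t: "\<exists>N. tame n r N f" and x: "x \<in> X"
  shows "emb f x \<in> X"
proof -
  obtain N where N: "tame n r N f" using t by blast
  have "f (vx N x) \<in> S" using Bij_mem[OF f vx_in_S[OF x]] .
  then show ?thesis using X_if_at act_at[OF N x] emb_eq[OF N x] by auto
qed

text \<open>\<open>N\<close> is chosen so that \<open>f\<close> sends vertices of depth at least
  \<open>N\<close> to depth at least \<open>L\<close>, from which on \<open>g\<close> is tame. The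
  two maps can then be evaluated through \<open>v\<close> and \<open>f v\<close>, and the affine
  maps compose.\<close>

lemma emb_compose:
  assumes f: "f \<in> Bij S" "\<exists>N. tame n r N f" and g: "g \<in> Bij S" "\<exists>N. tame n r N g"
  shows "\<exists>N. tame n r N (compose S g f)" "emb (compose S g f) = compose X (emb g) (emb f)"
proof -
  obtain K where K: "tame n r K f" using f(2) by blast
  obtain L where L: "tame n r L g" using g(2) by blast
  obtain M where M: "\<And>i w. Vertex i w \<in> S \<Longrightarrow> M \<le> length w \<Longrightarrow>
      \<exists>i' w'. f (Vertex i w) = Vertex i' w' \<and> L \<le> length w'"
    using Bij_forest_deep[OF f(1)] by metis
  define N where "N = max K M"
  have tN: "tame n r N f" using K by (rule tame_mono) (simp add: N_def)
  have gf: "tame n r N (compose S g f)"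
    unfolding tame_def
  proof (intro allI impI)
    fix i w assume w: "i < r" "set w \<subseteq> {..<n}" "N \<le> length w"
    then have wS: "Vertex i w \<in> S" by simp
    obtain i' w' where f': "f (Vertex i w) = Vertex i' w'" "\<And>j. j < n \<Longrightarrow> f (Vertex i (w @ [j])) = Vertex i' (w' @ [j])"
      using tameE[OF tN wS w(3)] by blast
    have "L \<le> length w'" using M[OF wS] w(3) f'(1) by (auto simp: N_def)
    moreover have "Vertex i' w' \<in> S" using Bij_mem[OF f(1) wS] f'(1) by simp
    ultimately obtain i'' w'' where "g (Vertex i' w') = Vertex i'' w''"
      "\<And>j. j < n \<Longrightarrow> g (Vertex i' (w' @ [j])) = Vertex i'' (w'' @ [j])"
      using tameE[OF L] by metis
    then show "\<exists>i' w'. compose S g f (Vertex i w) = Vertex i' w' \<and>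
        (\<forall>j<n. compose S g f (Vertex i (w @ [j])) = Vertex i' (w' @ [j]))"
      using f' w(1,2) by (auto simp: compose_def)
  qed
  then show "\<exists>N. tame n r N (compose S g f)" by blast
  have "emb (compose S g f) x = emb g (emb f x)" if x: "x \<in> X" for x
  proof -
    define v y where "v = vx N x" and "y = act N f x"
    have vS: "v \<in> S" "f v \<in> S" using vx_in_S[OF x] Bij_mem[OF f(1)] by (auto simp: v_def)
    have y: "emb f x = y" "y \<in> X" using emb_eq[OF tN x] emb_in_X[OF f x] by (auto simp: y_def)
    \<comment> \<open>A depth admissible for \<open>g\<close> at which the descent of
      \<open>y\<close> ends in \<open>f v\<close>: large enough if \<open>f v\<close> owns
      \<open>y\<close>, and exactly the depth of \<open>f v\<close> if \<open>y\<close> is only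
      known to lie in its cone.\<close>
    have "\<exists>J. tame n r J g \<and> vx J y = f v"
      using act_at[OF tN x]
    proof
      assume "owns (f (vx N x)) (act N f x)"
      then have "vx (max L (level (f v))) y = f v"
        using vx_owned[OF vS(2)] by (simp add: v_def y_def)
      then show ?thesis using tame_mono[OF L] by (meson max.cobounded1)
    next
      assume "\<exists>i w. vx N x = Vertex i w \<and> N = length w \<and> in_cone (f (vx N x)) (act N f x)"
      then obtain i w where w: "v = Vertex i w" "N = length w" "in_cone (f v) y"
        by (auto simp: v_def y_def)
      have "M \<le> length w" using w(2) by (simp add: N_def)
      then obtain i' w' where w': "f v = Vertex i' w'" "L \<le> length w'"
        using M[of i w] w(1) vS(1) by blast
      have "vx (length w') y = f v" using vx_cone[of i' w' y] vS(2) w(3) w'(1) by simp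
      then show ?thesis using tame_mono[OF L w'(2)] by blast
    qed
    then obtain J where J: "tame n r J g" "vx J y = f v" by blast
    have "emb g y = aff (f v) (g (f v)) y" using emb_eq[OF J(1) y(2)] J(2) by (simp add: act_def)
    also have "\<dots> = aff v (g (f v)) x" by (simp add: y_def act_def v_def)
    also have "\<dots> = emb (compose S g f) x"
      using emb_eq[OF gf x] vS(1) by (simp add: act_def compose_eq flip: v_def)
    finally show ?thesis using y by simp
  qed
  then show "emb (compose S g f) = compose X (emb g) (emb f)"
    by (auto simp: fun_eq_iff compose_def emb_def)
qed

lemma emb_id: "emb (\<lambda>v\<in>S. v) = (\<lambda>x\<in>X. x)"
proof -
  have t: "tame n r 0 (\<lambda>v\<in>S. v)" by (simp add: tame_def)
  have "emb (\<lambda>v\<in>S. v) x = x" if "x \<in> X" for x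
    using emb_eq[OF t that] vx_in_S[OF that] by (simp add: act_def del: vx.simps)
  then show ?thesis by (auto simp: fun_eq_iff emb_def)
qed

lemma emb_inverse:
  assumes f: "f \<in> Bij S" "\<exists>N. tame n r N f"
  obtains g where "g \<in> Bij S" "\<exists>N. tame n r N g"
    "\<And>x. x \<in> X \<Longrightarrow> emb g (emb f x) = x" "\<And>x. x \<in> X \<Longrightarrow> emb f (emb g x) = x"
proof -
  define g where "g = (\<lambda>v\<in>S. inv_into S f v)"
  have g: "g \<in> Bij S" "\<exists>N. tame n r N g"
    using restrict_inv_into_Bij[OF f(1)] tame_inv[OF f(1)] f(2) by (auto simp: g_def)
  have "compose S g f = (\<lambda>v\<in>S. v)" "compose S f g = (\<lambda>v\<in>S. v)"
    using f(1) by (auto simp: fun_eq_iff compose_def g_def Bij_inv Bij_mem)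
  then have "compose X (emb g) (emb f) = (\<lambda>x\<in>X. x)" "compose X (emb f) (emb g) = (\<lambda>x\<in>X. x)"
    using emb_compose(2)[OF f g] emb_compose(2)[OF g f] emb_id by simp_all
  then show ?thesis using that[OF g] by (metis compose_eq restrict_apply')
qed

lemma emb_Bij:
  assumes f: "f \<in> Bij S" "\<exists>N. tame n r N f"
  shows "emb f \<in> Bij X"
proof -
  obtain g where g: "g \<in> Bij S" "\<exists>N. tame n r N g"
    "\<And>x. x \<in> X \<Longrightarrow> emb g (emb f x) = x" "\<And>x. x \<in> X \<Longrightarrow> emb f (emb g x) = x"
    using emb_inverse[OF f] by blast
  have "bij_betw (emb f) X X"
    by (rule bij_betw_byWitness[where f' = "emb g"]) (use g emb_in_X[OF f] emb_in_X[OF g(1,2)] in auto)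
  then show ?thesis by (simp add: Bij_def emb_def)
qed

text \<open>\<open>vx N\<close> is constant on a cell of level \<open>N\<close>, so one affine map
  serves there; for a cell that misses \<open>X\<close> the claim is vacuous.\<close>

lemma emb_affine:
  assumes t: "tame n r N f"
  obtains k :: int and c where "c \<in> n_adic q"
    "\<And>x. x \<in> X \<Longrightarrow> \<lfloor>real q ^ N * x\<rfloor> = a \<Longrightarrow> emb f x = real q powi k * x + c"
proof (cases "\<exists>x\<in>X. \<lfloor>real q ^ N * x\<rfloor> = a")
  case True
  then obtain x where x: "x \<in> X" "\<lfloor>real q ^ N * x\<rfloor> = a" by blast
  define v where "v = vx N x"
  obtain k :: int and c where kc: "c \<in> n_adic q" "\<And>x. aff v (f v) x = real q powi k * x + c"
    using aff_affine by blast
  have "emb f y = real q powi k * y + c" if "y \<in> X" "\<lfloor>real q ^ N * y\<rfloor> = a" for y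
    using emb_eq[OF t that(1)] vx_cong[of N x y] that x kc(2) by (simp add: act_def v_def)
  then show ?thesis using that kc(1) by blast
qed (use that[of 0] n_adic_of_int[of 0] in auto)

lemma emb_n_adic:
  assumes f: "f \<in> Bij S" "\<exists>N. tame n r N f" and x: "x \<in> n_adic q \<inter> X"
  shows "emb f x \<in> n_adic q \<inter> X"
proof -
  obtain N where "tame n r N f" using f(2) by blast
  then obtain k :: int and c where "c \<in> n_adic q" "emb f x = real q powi k * x + c"
    using emb_affine x by (metis Int_iff)
  then have "emb f x \<in> n_adic q"
    using x by (auto intro!: n_adic_add n_adic_mult n_adic_powi simp del: of_nat_Suc)
  then show ?thesis using emb_in_X[OF f] x by simp
qed

text \<open>The pieces are cells closed on the left, whence right continuity. That every
  \<open>q\<close>-adic point is attained follows by applying \<open>emb_n_adic\<close> to the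
  inverse.\<close>

lemma emb_higman_V:
  assumes f: "f \<in> Bij S" "\<exists>N. tame n r N f"
  shows "(\<forall>x\<in>X. continuous (at_right x) (emb f)) \<and> pw_affine q X (emb f) \<and>
    emb f ` (n_adic q \<inter> X) = n_adic q \<inter> X"
proof (intro conjI ballI)
  obtain N where N: "tame n r N f" using f(2) by blast
  have fl: "\<lfloor>real q ^ N * t\<rfloor> = a \<longleftrightarrow> of_int a / real q ^ N \<le> t \<and> t < of_int (a + 1) / real q ^ N" for a t
    by (simp add: floor_eq_iff field_simps del: of_nat_Suc)
  define Q where "Q = int (r + p) * int q ^ N"
  \<comment> \<open>\<open>X\<close> has integral ends, so it is the union of the cells of level
    \<open>N\<close> with indices from 0 to \<open>Q - 1\<close>.\<close>
  have cell_X: "0 \<le> a" "a < Q" if "x \<in> X" "\<lfloor>real q ^ N * x\<rfloor> = a" for x a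
  proof -
    have x: "0 \<le> x" "x < real (r + p)" using that(1) by (auto simp: X_def)
    have "0 \<le> real q ^ N * x" using x by (simp del: of_nat_Suc)
    then show "0 \<le> a" using that(2) by linarith
    have "real q ^ N * x < real q ^ N * real (r + p)"
      using x by (intro mult_strict_left_mono) (simp_all del: of_nat_Suc)
    also have "\<dots> = of_int Q" by (simp add: Q_def)
    finally show "a < Q" using that(2) by linarith
  qed
  have in_X: "t \<in> X" if "0 \<le> a" "a < Q" "\<lfloor>real q ^ N * t\<rfloor> = a" for t a
    using that unfolding Q_def by (rule X_if_floor)
  show "continuous (at_right x) (emb f)" if x: "x \<in> X" for x
  proof -
    define a where "a = \<lfloor>real q ^ N * x\<rfloor>"
    obtain k :: int and c where kc: "\<And>t. t \<in> X \<Longrightarrow> \<lfloor>real q ^ N * t\<rfloor> = a \<Longrightarrow> emb f t = real q powi k * t + c"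
      using emb_affine[OF N] by blast
    show ?thesis
    proof (rule right_continuous_affine)
      show "x < of_int (a + 1) / real q ^ N" using fl[of x a] a_def by simp
      fix t assume "x \<le> t" "t < of_int (a + 1) / real q ^ N"
      then have "\<lfloor>real q ^ N * t\<rfloor> = a" using fl[of x a] fl[of t a] a_def by linarith
      then show "emb f t = real q powi k * t + c"
        using kc in_X cell_X[OF x] a_def by blast
    qed
  qed
  show "pw_affine q X (emb f)"
  proof -
    define B where "B = (\<lambda>a. of_int a / real q ^ N) ` {0..Q}"
    have "\<exists>(k::int) c. \<forall>x\<in>{u<..<v}. emb f x = real q powi k * x + c" if uv: "{u<..<v} \<subseteq> X - B" for u v
    proof (cases "u < v")
      case True
      define z where "z = (u + v) / 2"
      have z: "z \<in> {u<..<v}" using True by (simp add: z_def)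
      define a where "a = \<lfloor>real q ^ N * z\<rfloor>"
      have a: "0 \<le> a" "a < Q" using cell_X[of z a] z uv by (auto simp: a_def)
      have za: "of_int a / real q ^ N \<le> z" "z < of_int (a + 1) / real q ^ N" using fl[of z a] by (auto simp: a_def)
      have "of_int a / real q ^ N \<in> B" "of_int (a + 1) / real q ^ N \<in> B"
        unfolding B_def using a by (intro imageI; simp)+
      then have "of_int a / real q ^ N \<notin> {u<..<v}" "of_int (a + 1) / real q ^ N \<notin> {u<..<v}"
        using uv by blast+
      then have "of_int a / real q ^ N \<le> u" "v \<le> of_int (a + 1) / real q ^ N"
        using za z unfolding greaterThanLessThan_iff by linarith+
      then have "\<lfloor>real q ^ N * t\<rfloor> = a" if "t \<in> {u<..<v}" for t
        using that fl[of t a] unfolding greaterThanLessThan_iff by linarith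
      moreover obtain k :: int and c where
        "\<And>t. t \<in> X \<Longrightarrow> \<lfloor>real q ^ N * t\<rfloor> = a \<Longrightarrow> emb f t = real q powi k * t + c"
        using emb_affine[OF N] by blast
      ultimately show ?thesis using uv by blast
    qed auto
    moreover have "B \<subseteq> n_adic q" "finite B" by (auto simp: B_def intro: n_adicI)
    ultimately show ?thesis
      unfolding pw_affine_def by (intro exI[of _ B] conjI allI impI)
  qed
  obtain g where g: "g \<in> Bij S" "\<exists>N. tame n r N g" "\<And>x. x \<in> X \<Longrightarrow> emb f (emb g x) = x"
    using emb_inverse[OF f] by metis
  show "emb f ` (n_adic q \<inter> X) = n_adic q \<inter> X"
  proof
    show "emb f ` (n_adic q \<inter> X) \<subseteq> n_adic q \<inter> X" using emb_n_adic[OF f] by blast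
    show "n_adic q \<inter> X \<subseteq> emb f ` (n_adic q \<inter> X)"
      using emb_n_adic[OF g(1,2)] g(3) by (metis Int_iff image_eqI subsetI)
  qed
qed

text \<open>The left end of the cell owned by \<open>v\<close> is sent into the cell owned by
  \<open>f v\<close>, and the descent reads \<open>f v\<close> off from the image.\<close>

lemma emb_inj:
  assumes f: "f \<in> Bij S" "\<exists>N. tame n r N f" and g: "g \<in> Bij S" "\<exists>N. tame n r N g" and eq: "emb f = emb g"
  shows "f = g"
proof
  fix v
  show "f v = g v"
  proof (cases "v \<in> S")
    case True
    define x where "x = of_int (cell v) / real q ^ level v"
    have v: "owns v x" unfolding owns_def x_def by (simp del: of_nat_Suc)
    define y where "y = aff v (f v) x"
    have "y = aff v (g v) x"
      using emb_owned[OF f(2) True v] emb_owned[OF g(2) True v] eq by (simp add: y_def)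
    then have "owns (f v) y" "owns (g v) y"
      using owns_aff[OF v, of "f v"] owns_aff[OF v, of "g v"] by (simp_all only: y_def)
    then have "vx (max (level (f v)) (level (g v))) y = f v" "vx (max (level (f v)) (level (g v))) y = g v"
      by (intro vx_owned Bij_mem[OF f(1) True] Bij_mem[OF g(1) True]; simp)+
    then show ?thesis by simp
  next
    case False
    then show ?thesis using f(1) g(1) by (auto simp: Bij_def extensional_def)
  qed
qed

lemma mon_tame: "emb \<in> mon (perm_group S (\<lambda>f. \<exists>N. tame n r N f)) (higman_V q (r + p))"
  unfolding higman_V_def
proof (rule perm_group_monI, goal_cases)
  case (1 f)
  then show ?case using emb_Bij emb_higman_V unfolding X_def by blast
next
  case (2 f g)
  then show ?case using emb_compose(2) unfolding X_def by blast
next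
  case (3 f g)
  then show ?case using emb_inj by blast
qed

end

section \<open>Quasi-automorphisms and Houghton groups\<close>

text \<open>Induction from 0 gives \<open>j \<le> d j\<close>, induction downwards from
  \<open>n - 1\<close> the converse.\<close>

lemma strict_mono_endo_id:
  fixes d :: "nat \<Rightarrow> nat"
  assumes mono: "\<And>j j'. j < j' \<Longrightarrow> j' < n \<Longrightarrow> d j < d j'" and bound: "\<And>j. j < n \<Longrightarrow> d j < n" and "j < n"
  shows "d j = j"
proof (rule antisym)
  show "j \<le> d j"
    using assms(3)
  proof (induction j)
    case (Suc j)
    then show ?case using mono[of j "Suc j"] by simp
  qed simp
  have "d (n - 1 - k) \<le> n - 1 - k" if "k < n" for k
    using that
  proof (induction k)
    case 0
    then show ?case using bound[of "n - 1"] by simp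
  next
    case (Suc k)
    then have "d (n - 1 - Suc k) < d (n - 1 - k)" by (intro mono) simp_all
    then show ?case using Suc by linarith
  qed
  from this[of "n - 1 - j"] show "d j \<le> j" using assms(3) by simp
qed

text \<open>As \<open>n \<ge> 2\<close>, every child has a sibling, and the order relation between
  siblings includes that they are children of the given vertex. The induced map of child indices is
  increasing on a finite range, hence the identity.\<close>

lemma child_order_preserved_children:
  assumes n: "n \<ge> 2" and f: "f \<in> Bij (forest_vertices n r p)" and v: "Vertex i w \<in> forest_vertices n r p"
    and ord: "child_order_preserved_at (forest_vertices n r p) f (Vertex i w)"
  shows "\<exists>i' w'. f (Vertex i w) = Vertex i' w' \<and> (\<forall>j<n. f (Vertex i (w @ [j])) = Vertex i' (w' @ [j]))"
proof -
  define u where "u j = Vertex i (w @ [j])" for j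
  have uS: "u j \<in> forest_vertices n r p" if "j < n" for j
    using v that by (simp add: u_def)
  have lr: "children_left_right (f (Vertex i w)) (f (u j)) (f (u j'))" if "j < j'" "j' < n" for j j'
  proof -
    have "children_left_right (Vertex i w) (u j) (u j')"
      using that by (auto simp: children_left_right_def nth_child_def u_def)
    then show ?thesis using ord uS that unfolding child_order_preserved_at_def by auto
  qed
  obtain i' w' where w': "f (Vertex i w) = Vertex i' w'"
    using lr[of 0 1] n by (auto simp: children_left_right_def nth_child_def)
  have "\<exists>d. f (u j) = Vertex i' (w' @ [d])" if "j < n" for j
  proof (cases "j = 0")
    case True
    then show ?thesis using lr[of 0 1] n w' by (auto simp: children_left_right_def nth_child_def)
  next
    case False
    then show ?thesis using lr[of 0 j] that w' by (auto simp: children_left_right_def nth_child_def)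
  qed
  then obtain d where d: "\<And>j. j < n \<Longrightarrow> f (u j) = Vertex i' (w' @ [d j])" by metis
  have "d j = j" if "j < n" for j
  proof (rule strict_mono_endo_id[OF _ _ that])
    show "d j < d j'" if "j < j'" "j' < n" for j j'
      using lr[OF that] d that w' by (auto simp: children_left_right_def nth_child_def)
    show "d j < n" if "j < n" for j
      using Bij_mem[OF f uS[OF that]] d[OF that] by simp
  qed
  then show ?thesis using w' d unfolding u_def by auto
qed

lemma tame_if_finite_bad:
  assumes fin: "finite {v \<in> forest_vertices n r p. \<not> P v}"
    and good: "\<And>i w. Vertex i w \<in> forest_vertices n r p \<Longrightarrow> P (Vertex i w) \<Longrightarrow>
      \<exists>i' w'. f (Vertex i w) = Vertex i' w' \<and> (\<forall>j<n. f (Vertex i (w @ [j])) = Vertex i' (w' @ [j]))"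
  shows "\<exists>N. tame n r N f"
proof -
  define len :: "nat list vertex \<Rightarrow> nat" where "len v = (case v of Vertex i w \<Rightarrow> length w | Isolated j \<Rightarrow> 0)" for v
  obtain N where N: "\<And>v. v \<in> forest_vertices n r p \<Longrightarrow> \<not> P v \<Longrightarrow> len v < N"
    using finite_imageI[OF fin, of len] unfolding finite_nat_set_iff_bounded by blast
  have "P (Vertex i w)" if "Vertex i w \<in> forest_vertices n r p" "N \<le> length w" for i w
    using N[OF that(1)] that(2) by (auto simp: len_def)
  then have "tame n r N f"
    unfolding tame_def using good by (meson Vertex_in_forest)
  then show ?thesis by blast
qed

lemma mon_QV_tame:
  assumes n: "n \<ge> 2"
  shows "(\<lambda>f. f) \<in> mon (QV n r p) (perm_group (forest_vertices n r p) (\<lambda>f. \<exists>N. tame n r N f))"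
  unfolding QV_def
proof (rule perm_group_monI)
  fix f assume f: "f \<in> Bij (forest_vertices n r p)" and
    "finite {v \<in> forest_vertices n r p. \<not> (adj_preserved_at (forest_vertices n r p) forest_adj f v \<and>
      child_order_preserved_at (forest_vertices n r p) f v)}"
  then have "\<exists>N. tame n r N f"
    by (elim tame_if_finite_bad) (use child_order_preserved_children[OF n f] in blast)
  then show "f \<in> Bij (forest_vertices n r p) \<and> (\<exists>N. tame n r N f)" using f by blast
qed simp_all

section \<open>Rays as unary trees\<close>

definition ray_path :: "nat vertex \<Rightarrow> nat list vertex" where
  "ray_path v = (case v of Vertex i k \<Rightarrow> Vertex i (replicate k 0) | Isolated j \<Rightarrow> Isolated j)"

lemma ray_path_simps [simp]:
  "ray_path (Vertex i k) = Vertex i (replicate k 0)" "ray_path (Isolated j) = Isolated j"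
  by (simp_all add: ray_path_def)

lemma unary_word: "set w \<subseteq> {..<1::nat} \<Longrightarrow> w = replicate (length w) 0"
  by (intro replicate_eqI) auto

lemma bij_betw_ray_path: "bij_betw ray_path (ray_vertices r p) (forest_vertices 1 r p)"
  unfolding bij_betw_def
proof
  show "inj_on ray_path (ray_vertices r p)"
    by (auto simp: inj_on_def ray_vertices_def dest: arg_cong[of _ _ length])
  show "ray_path ` ray_vertices r p = forest_vertices 1 r p"
  proof (intro equalityI subsetI)
    fix v assume "v \<in> forest_vertices 1 r p"
    then show "v \<in> ray_path ` ray_vertices r p"
    proof (cases v)
      case (Vertex i w)
      then have "i < r" "w = replicate (length w) 0"
        using \<open>v \<in> _\<close> unary_word[of w] by auto
      then have "v = ray_path (Vertex i (length w))" "Vertex i (length w) \<in> ray_vertices r p"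
        using Vertex by (auto simp: ray_vertices_def)
      then show ?thesis by blast
    next
      case (Isolated j)
      then have "v = ray_path (Isolated j)" "Isolated j \<in> ray_vertices r p"
        using \<open>v \<in> _\<close> by (auto simp: ray_vertices_def)
      then show ?thesis by blast
    qed
  qed (auto simp: ray_vertices_def)
qed

text \<open>A path in a ray which takes one step down and does not backtrack has to
  go down forever, so all the steps go up.\<close>

lemma ray_path_increasing:
  assumes f: "f \<in> Bij (ray_vertices r p)" and i: "i < r"
    and good: "\<And>k. k \<ge> N \<Longrightarrow> adj_preserved_at (ray_vertices r p) ray_adj f (Vertex i k)"
    and k: "k \<ge> N"
  shows "\<exists>a b. f (Vertex i k) = Vertex a b \<and> f (Vertex i (Suc k)) = Vertex a (Suc b)"
proof (rule ccontr)
  assume no: "\<not> ?thesis"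
  have V: "Vertex i l \<in> ray_vertices r p" for l using i by (simp add: ray_vertices_def)
  have adj: "ray_adj (f (Vertex i l)) (f (Vertex i (Suc l)))" if "l \<ge> N" for l
  proof -
    have "ray_adj (Vertex i l) (Vertex i (Suc l))" unfolding ray_adj_def by blast
    then show ?thesis using good[OF that] V unfolding adj_preserved_at_def by blast
  qed
  \<comment> \<open>Injectivity of \<open>f\<close> forbids the image path to return to the vertex
    it has just left.\<close>
  have inj: "f (Vertex i l) \<noteq> f (Vertex i (Suc (Suc l)))" for l
    using f V[of l] V[of "Suc (Suc l)"] by (auto simp: Bij_def bij_betw_def dest: inj_onD)
  obtain a b where start: "f (Vertex i k) = Vertex a (Suc b)" "f (Vertex i (Suc k)) = Vertex a b"
    using adj[OF k] no unfolding ray_adj_def by blast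
  \<comment> \<open>Each step down costs one, as \<open>b' + t = b\<close> records; this is
    impossible for \<open>t = Suc b\<close>.\<close>
  have "\<exists>b'. f (Vertex i (k + t)) = Vertex a (Suc b') \<and> f (Vertex i (Suc (k + t))) = Vertex a b' \<and> b' + t = b" for t
  proof (induction t)
    case 0
    then show ?case using start by simp
  next
    case (Suc t)
    then obtain b' where b': "f (Vertex i (k + t)) = Vertex a (Suc b')" "f (Vertex i (Suc (k + t))) = Vertex a b'"
      "b' + t = b" by blast
    have "ray_adj (f (Vertex i (Suc (k + t)))) (f (Vertex i (Suc (Suc (k + t)))))"
      using k by (intro adj) simp
    moreover have "f (Vertex i (Suc (Suc (k + t)))) \<noteq> Vertex a (Suc b')"
      using inj[of "k + t"] b'(1) by simp
    ultimately obtain b'' where "b' = Suc b''" "f (Vertex i (Suc (Suc (k + t)))) = Vertex a b''"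
      using b'(2) unfolding ray_adj_def by auto
    then show ?case using b' by simp
  qed
  from this[of "Suc b"] show False by simp
qed

lemma mon_houghton_H_tame:
  "conj_by ray_path (ray_vertices r p) (forest_vertices 1 r p) \<in>
    mon (houghton_H r p) (perm_group (forest_vertices 1 r p) (\<lambda>f. \<exists>N. tame 1 r N f))"
  unfolding houghton_H_def
proof (rule mon_conj_by[OF bij_betw_ray_path])
  fix f assume f: "f \<in> Bij (ray_vertices r p)" and
    fin: "finite {v \<in> ray_vertices r p. \<not> adj_preserved_at (ray_vertices r p) ray_adj f v}"
  define index :: "nat vertex \<Rightarrow> nat" where "index v = (case v of Vertex i k \<Rightarrow> k | Isolated j \<Rightarrow> 0)" for v
  obtain N where N: "\<And>v. v \<in> ray_vertices r p \<Longrightarrow>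
      \<not> adj_preserved_at (ray_vertices r p) ray_adj f v \<Longrightarrow> index v < N"
    using finite_imageI[OF fin, of index] unfolding finite_nat_set_iff_bounded by blast
  have good: "adj_preserved_at (ray_vertices r p) ray_adj f (Vertex i k)" if "i < r" "k \<ge> N" for i k
    using N[of "Vertex i k"] that by (auto simp: ray_vertices_def index_def)
  define g where "g = conj_by ray_path (ray_vertices r p) (forest_vertices 1 r p) f"
  have g: "g (Vertex i (replicate k 0)) = ray_path (f (Vertex i k))" if "i < r" for i k
    using conj_by_apply[OF bij_betw_ray_path, of "Vertex i k" r p f] that
    by (simp add: g_def ray_vertices_def)
  have "tame 1 r N g"
    unfolding tame_def
  proof (intro allI impI)
    fix i :: nat and w :: "nat list"
    assume i: "i < r" and w: "set w \<subseteq> {..<1}" "N \<le> length w"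
    obtain k where k: "w = replicate k 0" "N \<le> k" using unary_word[OF w(1)] w(2) by blast
    obtain a b where "f (Vertex i k) = Vertex a b" "f (Vertex i (Suc k)) = Vertex a (Suc b)"
      using ray_path_increasing[OF f i good[OF i] k(2)] by blast
    then have "g (Vertex i w) = Vertex a (replicate b 0)"
      "g (Vertex i (w @ [0])) = Vertex a (replicate b 0 @ [0])"
      using g[OF i, of k] g[OF i, of "Suc k"] k(1) by (simp_all add: replicate_append_same)
    then show "\<exists>i' w'. g (Vertex i w) = Vertex i' w' \<and> (\<forall>j<1. g (Vertex i (w @ [j])) = Vertex i' (w' @ [j]))"
      by auto
  qed
  then show "\<exists>N. tame 1 r N (conj_by ray_path (ray_vertices r p) (forest_vertices 1 r p) f)"
    unfolding g_def by blast
qed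

text \<open>The coding leads to V with parameters \<open>n + 1, r + p\<close>, and conjugation by
  \<open>\<Phi>\<close> for these parameters leads on to V with parameters
  \<open>2, 1\<close>.\<close>

lemma ex_mon_tame_V:
  assumes "n \<ge> 1" "r + p \<ge> 1"
  shows "\<exists>h. h \<in> mon (perm_group (forest_vertices n r p) (\<lambda>f. \<exists>N. tame n r N f)) (higman_V 2 1)"
proof -
  interpret C: forest_code n r p .
  interpret T: thompson_conj "Suc n" "r + p" by unfold_locales (use assms in auto)
  show ?thesis using mon_compose[OF C.mon_tame T.mon_higman_V] by blast
qed

theorem corollary1p3:
  fixes n r p :: nat
  assumes "n \<ge> 2" and "r \<ge> 1"
  shows "(\<exists>h. h \<in> mon (thompson_F n r) (thompson_F 2 1)) \<and>
         (\<exists>h. h \<in> mon (thompson_T n r) (thompson_T 2 1)) \<and>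
         (\<exists>h. h \<in> mon (higman_V n r) (higman_V 2 1)) \<and>
         (\<exists>h. h \<in> mon (QV n r p) (higman_V 2 1)) \<and>
         (\<exists>h. h \<in> mon (houghton_H r p) (higman_V 2 1))"
proof -
  interpret thompson_conj n r by unfold_locales (use assms in auto)
  have n1: "n \<ge> 1" and rp: "r + p \<ge> 1" using assms by simp_all
  have "\<exists>h. h \<in> mon (QV n r p) (higman_V 2 1)"
    using mon_compose[OF mon_QV_tame[OF assms(1)]] ex_mon_tame_V[of n r p, OF n1 rp] by blast
  moreover have "\<exists>h. h \<in> mon (houghton_H r p) (higman_V 2 1)"
    using mon_compose[OF mon_houghton_H_tame] ex_mon_tame_V[of 1 r p, OF order_refl rp] by blast
  ultimately show ?thesis
    using mon_thompson_F mon_thompson_T mon_higman_V by blast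
qed

end
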